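(* Let $M$ be a smooth manifold of even dimension $k+1$ equipped with a $GL(2)$-structure $TM\simeq S^k(E)$, and let a $GL(2)$-connection on $B(E)$ be given by a $1$-form $\phi=(\phi^i_j)_{i,j=1,2}$ with values in $\mathfrak{gl}(2)$. Then there is a canonical almost-complex structure $\mathfrak{J}_\phi$ on the quotient bundle $B(E)/CO(2)$ whose $(1,0)$-forms are characterized by the property that their pullbacks to $B(E)$ are linear combinations (with complex-valued function coefficients) of the forms $\xi^{k,0},\ldots,\xi^{k,\lfloor k/2\rfloor}$ and of $$\zeta=(\phi^1_2+\phi^2_1)+\mathrm{i}(\phi^2_2-\phi^1_1).$$
   Context: $\mathcal{H}_k$ is the real vector space of homogeneous polynomials of degree $k$ in $x,y$, with basis of monomials $(x^k,x^{k-1}y,\ldots,y^k)$ and right action of $GL(2)=GL(2,\mathbb{R})$ given by $(V\cdot g)(x,y)=V((x,y)g)$ (row vector times matrix); $\rho_k(g)$ denotes the matrix of $V\mapsto V\cdot g$ in the monomial basis. A $GL(2)$-structure on a manifold $M$ of dimension $k+1$ is an isomorphism of vector bundles $TM\simeq S^k(E)$, where $E\to M$ is a real rank-2 vector bundle and $S^k(E)$ is its $k$-th symmetric tensor power. $\pi:B(E)\to M$ is the bundle of frames of $TM$ of the form $\chi=(x^k,x^{k-1}y,\ldots,y^k)$, where $(x,y)$ is a basis of $E_p$; $GL(2)$ acts on it on the right via $(x,y)\mapsto(x,y)g$, i.e. $\chi\mapsto\chi\rho_k(g)$. $CO(2)\subset GL(2)$ is the subgroup of matrices $\begin{pmatrix}u&-v\\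 v&u\end{pmatrix}$ with $u^2+v^2\neq0$. A basis $(x,y)$ of $E_p$ identifies $T_pM$ with $\mathcal{H}_k$, and $\omega=(\omega^0,\ldots,\omega^k)^t$ is the canonical $\mathcal{H}_k$-valued soldering form on $B(E)$: $\pi_*v=\sum_i x^{k-i}y^i\,\omega^i(v)$ at $\chi$. A $GL(2)$-connection is given by a $1$-form on $B(E)$ with values in $\mathfrak{gl}(2)$, written as $\begin{pmatrix}\phi^1_1&\phi^2_1\\\phi^1_2&\phi^2_2\end{pmatrix}$, whose image $\Phi$ under the Lie algebra representation $d\rho_k$ is a principal connection form on $B(E)$. Forms $\xi^{k,j}$ ($k$ odd): for $j=0,\ldots,\lfloor k/2\rfloor$ let $V^{even}_{k,j}$ and $V^{odd}_{k,j}$ be the real and imaginary parts of $(x^2+y^2)^j(x+\mathrm{i}y)^{k-2j}$ ($x,y$ treated as real variables). These polynomials form a basis of $\mathcal{H}_k$; let $(\xi^{k,j}_{even},\xi^{k,j}_{odd})$ be the dual basis of $\mathcal{H}_k^*$ and put $\xi^{k,j}=\xi^{k,j}_{even}+\mathrm{i}\xi^{k,j}_{odd}$. The same symbols denote the complex-valued horizontal $1$-forms on $B(E)$ obtained by composing with $\omega$. *)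

theory Defs
  imports "HOL-Analysis.Analysis" "HOL-Library.Function_Algebras"
begin

text \<open>Functions into a real vector space form a real vector space, pointwise. Tangent
  spaces, symmetric powers and spaces of polynomials below are subspaces of such types, so that
  \<^const>\<open>span\<close> and \<^const>\<open>representation\<close> apply to them.\<close>

instantiation "fun" :: (type, scaleR) scaleR
begin
definition scaleR_fun :: "real \<Rightarrow> ('a \<Rightarrow> 'b) \<Rightarrow> 'a \<Rightarrow> 'b"
  where "scaleR_fun r f = (\<lambda>x. r *\<^sub>R f x)"
instance ..
end

instance "fun" :: (type, real_vector) real_vector
  by standard (auto simp: scaleR_fun_def fun_eq_iff scaleR_add_right scaleR_add_left)

definition linear_on :: "'a::real_vector set \<Rightarrow> ('a \<Rightarrow> 'b::real_vector) \<Rightarrow> bool" where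
  "linear_on V f \<longleftrightarrow> (\<forall>u\<in>V. \<forall>v\<in>V. \<forall>a b. f (a *\<^sub>R u + b *\<^sub>R v) = a *\<^sub>R f u + b *\<^sub>R f v)"


section \<open>Smooth manifolds\<close>

text \<open>In the following two definitions the set is always meant to be open.\<close>

fun C_on :: "nat \<Rightarrow> 'a::euclidean_space set \<Rightarrow> ('a \<Rightarrow> 'b::real_normed_vector) \<Rightarrow> bool" where
  "C_on 0 S f \<longleftrightarrow> continuous_on S f"
| "C_on (Suc n) S f \<longleftrightarrow> (\<forall>x\<in>S. f differentiable at x) \<and>
     (\<forall>v. C_on n S (\<lambda>x. frechet_derivative f (at x) v))"

definition smooth_on :: "'a::euclidean_space set \<Rightarrow> ('a \<Rightarrow> 'b::real_normed_vector) \<Rightarrow> bool" where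
  "smooth_on S f \<longleftrightarrow> (\<forall>n. C_on n S f)"

text \<open>A manifold is given by an atlas, which need not be maximal; the dimension is
  the dimension of \<open>'e\<close>, the underlying set is the union of the chart domains, and the topology is
  the one determined by the charts.\<close>

type_synonym ('a, 'e) chart = "'a set \<times> ('a \<Rightarrow> 'e)"
type_synonym ('a, 'e) atlas = "('a, 'e) chart set"

definition points :: "('a, 'e) atlas \<Rightarrow> 'a set" where
  "points M = \<Union> (fst ` M)"

definition mopen :: "('a, 'e::euclidean_space) atlas \<Rightarrow> 'a set \<Rightarrow> bool" where
  "mopen M W \<longleftrightarrow> W \<subseteq> points M \<and> (\<forall>(U, c)\<in>M. open (c ` (U \<inter> W)))"

definition smooth_manifold :: "('a, 'e::euclidean_space) atlas \<Rightarrow> bool" where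
  "smooth_manifold M \<longleftrightarrow>
     (\<forall>(U, c)\<in>M. inj_on c U \<and> open (c ` U)) \<and>
     (\<forall>(U, c)\<in>M. \<forall>(U', c')\<in>M. open (c ` (U \<inter> U')) \<and>
        smooth_on (c ` (U \<inter> U')) (c' \<circ> inv_into U c)) \<and>
     Hausdorff_space (topology (mopen M)) \<and>
     second_countable (topology (mopen M))"

definition smooth_fun ::
  "('a, 'e::euclidean_space) atlas \<Rightarrow> 'a set \<Rightarrow> ('a \<Rightarrow> 'b::real_normed_vector) \<Rightarrow> bool" where
  "smooth_fun M W f \<longleftrightarrow> (\<forall>(U, c)\<in>M. smooth_on (c ` (U \<inter> W)) (f \<circ> inv_into U c))"

text \<open>A tangent vector at \<open>p\<close> assigns to every chart around \<open>p\<close> a coordinate vector, compatibly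
  with the Jacobians of the coordinate changes (and 0 to every other pair).\<close>

type_synonym ('a, 'e) tvec = "('a, 'e) chart \<Rightarrow> 'e"

definition chart_at :: "('a, 'e) atlas \<Rightarrow> 'a \<Rightarrow> ('a, 'e) chart \<Rightarrow> bool" where
  "chart_at M p C \<longleftrightarrow> C \<in> M \<and> p \<in> fst C"

definition tangent_space ::
  "('a, 'e::euclidean_space) atlas \<Rightarrow> 'a \<Rightarrow> ('a, 'e) tvec set" where
  "tangent_space M p = {v.
     (\<forall>C. \<not> chart_at M p C \<longrightarrow> v C = 0) \<and>
     (\<forall>C C'. chart_at M p C \<longrightarrow> chart_at M p C' \<longrightarrow>
        v C' = frechet_derivative (snd C' \<circ> inv_into (fst C) (snd C)) (at (snd C p)) (v C))}"

text \<open>The tangent vector at \<open>p\<close> with coordinate vector \<open>e\<close> in the chart \<open>C\<close>.\<close>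

definition coord_vec ::
  "('a, 'e::euclidean_space) atlas \<Rightarrow> ('a, 'e) chart \<Rightarrow> 'a \<Rightarrow> 'e \<Rightarrow> ('a, 'e) tvec" where
  "coord_vec M C p e = (\<lambda>C'. if chart_at M p C'
     then frechet_derivative (snd C' \<circ> inv_into (fst C) (snd C)) (at (snd C p)) e else 0)"

text \<open>The differential of a smooth map at \<open>p\<close>; by the chain rule the choice of the chart
  around \<open>p\<close> does not matter.\<close>

definition tangent_map ::
  "('a, 'e::euclidean_space) atlas \<Rightarrow> ('b, 'd::euclidean_space) atlas \<Rightarrow> ('a \<Rightarrow> 'b) \<Rightarrow> 'a \<Rightarrow>
   ('a, 'e) tvec \<Rightarrow> ('b, 'd) tvec" where
  "tangent_map M N f p v = (\<lambda>C'. if chart_at N (f p) C'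
     then (let C = (SOME C. chart_at M p C) in
       frechet_derivative (snd C' \<circ> f \<circ> inv_into (fst C) (snd C)) (at (snd C p)) (v C))
     else 0)"

definition velocity ::
  "('a, 'e::euclidean_space) atlas \<Rightarrow> (real \<Rightarrow> 'a) \<Rightarrow> ('a, 'e) tvec" where
  "velocity M \<gamma> = (\<lambda>C. if chart_at M (\<gamma> 0) C
     then vector_derivative (snd C \<circ> \<gamma>) (at 0) else 0)"

definition smooth_form ::
  "('a, 'e::euclidean_space) atlas \<Rightarrow> 'a set \<Rightarrow>
   ('a \<Rightarrow> ('a, 'e) tvec \<Rightarrow> 'b::real_normed_vector) \<Rightarrow> bool" where
  "smooth_form M W \<alpha> \<longleftrightarrow>
     (\<forall>p\<in>W. linear_on (tangent_space M p) (\<alpha> p)) \<and>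
     (\<forall>C\<in>M. \<forall>e. smooth_fun M (fst C \<inter> W) (\<lambda>p. \<alpha> p (coord_vec M C p e)))"


section \<open>Vector bundles\<close>

text \<open>A vector bundle with typical fibre \<open>'f\<close> consists of its fibres \<open>E p\<close>, which are subspaces
  of a real vector space \<open>'v\<close> without further structure (no restriction, since \<open>'v\<close> may be the
  direct sum of the fibres), and a set \<open>T\<close> of local frames \<open>(U, t)\<close>, where \<open>t p\<close> is an
  isomorphism from \<open>'f\<close> onto \<open>E p\<close> for \<open>p\<close> in \<open>U\<close>.\<close>

type_synonym ('a, 'f, 'v) frames = "('a set \<times> ('a \<Rightarrow> 'f \<Rightarrow> 'v)) set"

definition smooth_section ::
  "('a, 'e::euclidean_space) atlas \<Rightarrow> ('a, 'f::euclidean_space, 'v::real_vector) frames \<Rightarrow>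
   'a set \<Rightarrow> ('a \<Rightarrow> 'v) \<Rightarrow> bool" where
  "smooth_section M T W s \<longleftrightarrow>
     (\<forall>(U, t)\<in>T. \<exists>c. smooth_fun M (U \<inter> W) c \<and> (\<forall>p\<in>U \<inter> W. s p = t p (c p)))"

definition vector_bundle ::
  "('a, 'e::euclidean_space) atlas \<Rightarrow> ('a \<Rightarrow> 'v::real_vector set) \<Rightarrow>
   ('a, 'f::euclidean_space, 'v) frames \<Rightarrow> bool" where
  "vector_bundle M E T \<longleftrightarrow>
     (\<forall>(U, t)\<in>T. mopen M U \<and> (\<forall>p\<in>U. linear (t p) \<and> inj (t p) \<and> range (t p) = E p)) \<and>
     \<Union> (fst ` T) = points M \<and>
     (\<forall>(U, t)\<in>T. \<forall>w. smooth_section M T U (\<lambda>p. t p w))"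

definition tangent_frames ::
  "('a, 'e::euclidean_space) atlas \<Rightarrow> ('a, 'e, ('a, 'e) tvec) frames" where
  "tangent_frames M = (\<lambda>C. (fst C, coord_vec M C)) ` M"

text \<open>The \<open>k\<close>-th symmetric power of \<open>V\<close>, realised as the space of homogeneous polynomial functions
  of degree \<open>k\<close> on the dual space: the symmetric product of \<open>v\<^sub>1, \<dots>, v\<^sub>k\<close> is the function
  sending a linear form \<open>f\<close> to \<open>f v\<^sub>1 \<cdots> f v\<^sub>k\<close>.\<close>

definition sym_prod :: "'v::real_vector list \<Rightarrow> ('v \<Rightarrow> real) \<Rightarrow> real" where
  "sym_prod vs = (\<lambda>f. if linear f then prod_list (map f vs) else 0)"

definition sym_power :: "nat \<Rightarrow> 'v::real_vector set \<Rightarrow> (('v \<Rightarrow> real) \<Rightarrow> real) set" where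
  "sym_power k V = span {sym_prod vs | vs. length vs = k \<and> set vs \<subseteq> V}"

definition sym_mono :: "nat \<Rightarrow> nat \<Rightarrow> 'v::real_vector \<Rightarrow> 'v \<Rightarrow> ('v \<Rightarrow> real) \<Rightarrow> real" where
  "sym_mono k i x y = sym_prod (replicate (k - i) x @ replicate i y)"

text \<open>Quotient manifold of \<open>N\<close> by the fibres of \<open>f\<close>: the charts are those local coordinates on the
  image of \<open>f\<close> for which \<open>f\<close> becomes a smooth submersion.\<close>

definition quotient_atlas ::
  "('a, 'e::euclidean_space) atlas \<Rightarrow> ('a \<Rightarrow> 'q) \<Rightarrow> ('q, 'd::euclidean_space) atlas" where
  "quotient_atlas N f = {(U, \<psi>).
     U \<subseteq> f ` points N \<and> inj_on \<psi> U \<and> open (\<psi> ` U) \<and>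
     mopen N (points N \<inter> f -` U) \<and>
     smooth_fun N (points N \<inter> f -` U) (\<psi> \<circ> f) \<and>
     (\<forall>(V, c)\<in>N. \<forall>b\<in>V \<inter> f -` U.
        surj (frechet_derivative (\<psi> \<circ> f \<circ> inv_into V c) (at (c b))))}"


section \<open>Binary forms\<close>

definition mono_xy :: "nat \<Rightarrow> nat \<Rightarrow> real \<Rightarrow> real \<Rightarrow> real" where
  "mono_xy k i = (\<lambda>x y. x ^ (k - i) * y ^ i)"

definition poly_act :: "(real \<Rightarrow> real \<Rightarrow> real) \<Rightarrow> real^2^2 \<Rightarrow> real \<Rightarrow> real \<Rightarrow> real" where
  "poly_act V g = (\<lambda>x y. V (x * g$1$1 + y * g$2$1) (x * g$1$2 + y * g$2$2))"

text \<open>\<open>(k+1)\<times>(k+1)\<close> matrices are functions of two indices, of which only the values at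
  indices \<open>\<le> k\<close> are relevant. Column \<open>j\<close> of \<open>\<rho>\<^sub>k(g)\<close> holds the coordinates of the image of
  the \<open>j\<close>-th monomial.\<close>

type_synonym nmat = "nat \<Rightarrow> nat \<Rightarrow> real"

definition nmat_mult :: "nat \<Rightarrow> nmat \<Rightarrow> nmat \<Rightarrow> nmat" where
  "nmat_mult k A B = (\<lambda>i j. \<Sum>l\<le>k. A i l * B l j)"

definition rho :: "nat \<Rightarrow> real^2^2 \<Rightarrow> nmat" where
  "rho k g = (\<lambda>i j.
     representation (mono_xy k ` {..k}) (poly_act (mono_xy k j) g) (mono_xy k i))"

definition drho :: "nat \<Rightarrow> real^2^2 \<Rightarrow> nmat" where
  "drho k X = (\<lambda>i j. deriv (\<lambda>t. rho k (mat 1 + t *\<^sub>R X) i j) 0)"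

definition CO2 :: "(real^2^2) set" where
  "CO2 = {vector [vector [u, - v], vector [v, u]] | u v. u\<^sup>2 + v\<^sup>2 \<noteq> 0}"

definition V_cplx :: "nat \<Rightarrow> nat \<Rightarrow> real \<Rightarrow> real \<Rightarrow> complex" where
  "V_cplx k j = (\<lambda>x y.
     (of_real x ^ 2 + of_real y ^ 2) ^ j * (of_real x + \<i> * of_real y) ^ (k - 2 * j))"

definition V_even :: "nat \<Rightarrow> nat \<Rightarrow> real \<Rightarrow> real \<Rightarrow> real" where
  "V_even k j = (\<lambda>x y. Re (V_cplx k j x y))"

definition V_odd :: "nat \<Rightarrow> nat \<Rightarrow> real \<Rightarrow> real \<Rightarrow> real" where
  "V_odd k j = (\<lambda>x y. Im (V_cplx k j x y))"

definition V_basis :: "nat \<Rightarrow> (real \<Rightarrow> real \<Rightarrow> real) set" where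
  "V_basis k = V_even k ` {..k div 2} \<union> V_odd k ` {..k div 2}"

text \<open>\<open>\<xi>\<^bsup>k,j\<^esup>\<close> as a complex-valued linear form on the binary forms of degree \<open>k\<close>, \<open>k\<close> odd: its real and
  imaginary parts are the members of the dual basis belonging to \<^term>\<open>V_even k j\<close> and
  \<^term>\<open>V_odd k j\<close>.\<close>

definition xi_lin :: "nat \<Rightarrow> nat \<Rightarrow> (real \<Rightarrow> real \<Rightarrow> real) \<Rightarrow> complex" where
  "xi_lin k j V =
     Complex (representation (V_basis k) V (V_even k j)) (representation (V_basis k) V (V_odd k j))"


section \<open>\<open>GL(2)\<close>-structures\<close>

text \<open>\<open>\<Theta> p\<close> is the isomorphism from \<open>S\<^sup>k(E\<^sub>p)\<close> to \<open>T\<^sub>pM\<close>. Since the products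
  \<open>x\<^bsup>k-i\<^esup>y\<^bsup>i\<^esup>\<close> of the members of a smooth frame \<open>x, y\<close> of \<open>E\<close> are a smooth frame of
  \<open>S\<^sup>k(E)\<close>, the last condition says that \<open>\<Theta>\<close> is a smooth bundle map.\<close>

definition gl2_structure ::
  "nat \<Rightarrow> ('m, 'e::euclidean_space) atlas \<Rightarrow> ('m \<Rightarrow> 'v::real_vector set) \<Rightarrow>
   ('m, real^2, 'v) frames \<Rightarrow> ('m \<Rightarrow> (('v \<Rightarrow> real) \<Rightarrow> real) \<Rightarrow> ('m, 'e) tvec) \<Rightarrow> bool" where
  "gl2_structure k M E T \<Theta> \<longleftrightarrow>
     vector_bundle M E T \<and>
     (\<forall>p\<in>points M. linear_on (sym_power k (E p)) (\<Theta> p) \<and>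
        bij_betw (\<Theta> p) (sym_power k (E p)) (tangent_space M p)) \<and>
     (\<forall>(U, t)\<in>T. \<forall>i\<le>k. smooth_section M (tangent_frames M) U
        (\<lambda>p. \<Theta> p (sym_mono k i (t p (axis 1 1)) (t p (axis 2 1)))))"

text \<open>A point of \<open>B(E)\<close> is a pair \<open>(p, \<chi>)\<close> with \<open>\<chi> = (x\<^bsup>k\<^esup>, \<dots>, y\<^bsup>k\<^esup>)\<close> a frame of
  \<open>T\<^sub>pM\<close>, indexed by \<open>0, \<dots>, k\<close>.\<close>

type_synonym ('m, 'e) fpoint = "'m \<times> (nat \<Rightarrow> ('m, 'e) tvec)"

definition power_frame ::
  "nat \<Rightarrow> ('m \<Rightarrow> (('v::real_vector \<Rightarrow> real) \<Rightarrow> real) \<Rightarrow> ('m, 'e::euclidean_space) tvec) \<Rightarrow>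
   'm \<Rightarrow> 'v \<Rightarrow> 'v \<Rightarrow> nat \<Rightarrow> ('m, 'e) tvec" where
  "power_frame k \<Theta> p x y = (\<lambda>i. if i \<le> k then \<Theta> p (sym_mono k i x y) else 0)"

definition frame_set ::
  "nat \<Rightarrow> ('m, 'e::euclidean_space) atlas \<Rightarrow> ('m \<Rightarrow> 'v::real_vector set) \<Rightarrow>
   ('m \<Rightarrow> (('v \<Rightarrow> real) \<Rightarrow> real) \<Rightarrow> ('m, 'e) tvec) \<Rightarrow> ('m, 'e) fpoint set" where
  "frame_set k M E \<Theta> = {(p, power_frame k \<Theta> p x y) | p x y.
     p \<in> points M \<and> x \<noteq> y \<and> independent {x, y} \<and> span {x, y} = E p}"

text \<open>A chart \<open>c\<close> of \<open>M\<close> and a local frame \<open>t\<close> of \<open>E\<close> give coordinates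
  \<open>(c p, g)\<close> with \<open>(x, y) = (t\<^sub>1, t\<^sub>2) g\<close>; for odd \<open>k\<close> the basis \<open>(x, y)\<close>, hence \<open>g\<close>, is
  determined by \<open>\<chi>\<close>.\<close>

definition frame_bundle ::
  "nat \<Rightarrow> ('m, 'e::euclidean_space) atlas \<Rightarrow> ('m \<Rightarrow> 'v::real_vector set) \<Rightarrow>
   ('m, real^2, 'v) frames \<Rightarrow> ('m \<Rightarrow> (('v \<Rightarrow> real) \<Rightarrow> real) \<Rightarrow> ('m, 'e) tvec) \<Rightarrow>
   (('m, 'e) fpoint, 'e \<times> (real^2^2)) atlas" where
  "frame_bundle k M E T \<Theta> =
     {({b \<in> frame_set k M E \<Theta>. fst b \<in> U \<inter> V},
       \<lambda>(p, F). (c p, THE g. F = power_frame k \<Theta> p (t p (column 1 g)) (t p (column 2 g))))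
      | U c V t. (U, c) \<in> M \<and> (V, t) \<in> T}"

definition frame_act ::
  "nat \<Rightarrow> ('m, 'e::euclidean_space) fpoint \<Rightarrow> real^2^2 \<Rightarrow> ('m, 'e) fpoint" where
  "frame_act k b g =
     (fst b, \<lambda>i. if i \<le> k then \<Sum>j\<le>k. rho k g j i *\<^sub>R snd b j else 0)"

definition CO2_orbit :: "nat \<Rightarrow> ('m, 'e::euclidean_space) fpoint \<Rightarrow> ('m, 'e) fpoint set" where
  "CO2_orbit k b = frame_act k b ` CO2"

definition soldering ::
  "nat \<Rightarrow> ('m, 'e::euclidean_space) atlas \<Rightarrow> (('m, 'e) fpoint, 'e \<times> (real^2^2)) atlas \<Rightarrow>
   ('m, 'e) fpoint \<Rightarrow> (('m, 'e) fpoint, 'e \<times> (real^2^2)) tvec \<Rightarrow> real \<Rightarrow> real \<Rightarrow> real" where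
  "soldering k M B b v =
     (\<Sum>i\<le>k. representation (snd b ` {..k}) (tangent_map B M fst b v) (snd b i) *\<^sub>R mono_xy k i)"

definition xi_form ::
  "nat \<Rightarrow> nat \<Rightarrow> ('m, 'e::euclidean_space) atlas \<Rightarrow> (('m, 'e) fpoint, 'e \<times> (real^2^2)) atlas \<Rightarrow>
   ('m, 'e) fpoint \<Rightarrow> (('m, 'e) fpoint, 'e \<times> (real^2^2)) tvec \<Rightarrow> complex" where
  "xi_form k j M B b v = xi_lin k j (soldering k M B b v)"

text \<open>Principal connection forms on \<open>B(E)\<close> with structure group \<open>\<rho>\<^sub>k(GL(2))\<close>. The curve
  \<open>t \<mapsto> 1 + tX\<close>, invertible near \<open>0\<close>, has the same velocity at \<open>0\<close> as \<open>exp(tX)\<close>, so the first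
  argument in the second condition is the fundamental vector of \<open>d\<rho>\<^sub>k(X)\<close> at \<open>b\<close>.\<close>

definition principal_connection ::
  "nat \<Rightarrow> (('m, 'e::euclidean_space) fpoint, 'e \<times> (real^2^2)) atlas \<Rightarrow>
   (('m, 'e) fpoint \<Rightarrow> (('m, 'e) fpoint, 'e \<times> (real^2^2)) tvec \<Rightarrow> nmat) \<Rightarrow> bool" where
  "principal_connection k B \<Phi> \<longleftrightarrow>
     (\<forall>i\<le>k. \<forall>j\<le>k. smooth_form B (points B) (\<lambda>b v. \<Phi> b v i j)) \<and>
     (\<forall>b\<in>points B. \<forall>X. \<forall>i\<le>k. \<forall>j\<le>k.
        \<Phi> b (velocity B (\<lambda>t. frame_act k b (mat 1 + t *\<^sub>R X))) i j = drho k X i j) \<and>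
     (\<forall>b\<in>points B. \<forall>v\<in>tangent_space B b. \<forall>g. invertible g \<longrightarrow> (\<forall>i\<le>k. \<forall>j\<le>k.
        \<Phi> (frame_act k b g) (tangent_map B B (\<lambda>b. frame_act k b g) b v) i j =
        nmat_mult k (rho k (matrix_inv g)) (nmat_mult k (\<Phi> b v) (rho k g)) i j))"

text \<open>The matrix \<open>\<phi> b v\<close> has rows indexed by the lower and columns by the upper index, that is,
  \<open>\<phi>\<^sup>i\<^sub>j\<close> is the entry \<open>\<phi> b v $ j $ i\<close>.\<close>

definition gl2_connection ::
  "nat \<Rightarrow> (('m, 'e::euclidean_space) fpoint, 'e \<times> (real^2^2)) atlas \<Rightarrow>
   (('m, 'e) fpoint \<Rightarrow> (('m, 'e) fpoint, 'e \<times> (real^2^2)) tvec \<Rightarrow> real^2^2) \<Rightarrow> bool" where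
  "gl2_connection k B \<phi> \<longleftrightarrow>
     smooth_form B (points B) \<phi> \<and> principal_connection k B (\<lambda>b v. drho k (\<phi> b v))"

definition zeta_form ::
  "(('m, 'e::euclidean_space) fpoint \<Rightarrow> (('m, 'e) fpoint, 'e \<times> (real^2^2)) tvec \<Rightarrow> real^2^2) \<Rightarrow>
   ('m, 'e) fpoint \<Rightarrow> (('m, 'e) fpoint, 'e \<times> (real^2^2)) tvec \<Rightarrow> complex" where
  "zeta_form \<phi> b v =
     of_real (\<phi> b v $ 2 $ 1 + \<phi> b v $ 1 $ 2) + \<i> * of_real (\<phi> b v $ 2 $ 2 - \<phi> b v $ 1 $ 1)"


section \<open>Almost complex structures\<close>

definition almost_complex_structure ::
  "('a, 'e::euclidean_space) atlas \<Rightarrow> ('a \<Rightarrow> ('a, 'e) tvec \<Rightarrow> ('a, 'e) tvec) \<Rightarrow> bool" where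
  "almost_complex_structure M J \<longleftrightarrow>
     (\<forall>p\<in>points M. linear_on (tangent_space M p) (J p) \<and>
        (\<forall>v\<in>tangent_space M p. J p v \<in> tangent_space M p \<and> J p (J p v) = - v)) \<and>
     (\<forall>C\<in>M. \<forall>e. smooth_section M (tangent_frames M) (fst C) (\<lambda>p. J p (coord_vec M C p e)))"

definition form_10 ::
  "('a, 'e::euclidean_space) atlas \<Rightarrow> ('a \<Rightarrow> ('a, 'e) tvec \<Rightarrow> ('a, 'e) tvec) \<Rightarrow> 'a set \<Rightarrow>
   ('a \<Rightarrow> ('a, 'e) tvec \<Rightarrow> complex) \<Rightarrow> bool" where
  "form_10 M J W \<alpha> \<longleftrightarrow> (\<forall>p\<in>W. \<forall>v\<in>tangent_space M p. \<alpha> p (J p v) = \<i> * \<alpha> p v)"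

text \<open>The coefficients \<open>c j\<close> and \<open>d\<close> are arbitrary complex-valued functions on \<open>B(E)\<close>;
  for smooth \<open>\<alpha>\<close> they are automatically smooth, because the \<open>\<xi>\<^bsup>k,j\<^esup>\<close> and \<open>\<zeta>\<close>
  are pointwise linearly independent smooth forms.\<close>

definition forms_10_characterized ::
  "nat \<Rightarrow> ('m, 'e::euclidean_space) atlas \<Rightarrow> (('m, 'e) fpoint, 'e \<times> (real^2^2)) atlas \<Rightarrow>
   (('m, 'e) fpoint set, 'd::euclidean_space) atlas \<Rightarrow>
   (('m, 'e) fpoint \<Rightarrow> (('m, 'e) fpoint, 'e \<times> (real^2^2)) tvec \<Rightarrow> real^2^2) \<Rightarrow>
   (('m, 'e) fpoint set \<Rightarrow> (('m, 'e) fpoint set, 'd) tvec \<Rightarrow> (('m, 'e) fpoint set, 'd) tvec) \<Rightarrow>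
   bool" where
  "forms_10_characterized k M B Q \<phi> J \<longleftrightarrow>
     (\<forall>W \<alpha>. mopen Q W \<and> smooth_form Q W \<alpha> \<longrightarrow>
        (form_10 Q J W \<alpha> \<longleftrightarrow>
         (\<exists>c d. \<forall>b\<in>points B \<inter> CO2_orbit k -` W. \<forall>v\<in>tangent_space B b.
            \<alpha> (CO2_orbit k b) (tangent_map B Q (CO2_orbit k) b v) =
            (\<Sum>j\<le>k div 2. c j b * xi_form k j M B b v) + d b * zeta_form \<phi> b v)))"

end

theory Submission
  imports Defs
begin

text \<open>
  The structure comes from linear algebra at the points of \<open>B(E)\<close>; explicit coordinates make it
  smooth.

  A chart \<open>c\<close> of \<open>M\<close> and a local frame of \<open>E\<close> identify a part of \<open>B(E)\<close> with an open set times
  \<open>GL(2)\<close>, and \<open>GL(2)\<close> acts by right multiplication (\<open>frame_chart\<close>, \<open>frame_act_frame_pt\<close>). If the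
  rows of \<open>g\<close> are read as complex numbers \<open>z\<^sub>1, z\<^sub>2\<close>, a conformal matrix multiplies both of them by the
  same number \<open>u - \<i> v\<close>. So an orbit of \<open>CO(2)\<close> in \<open>GL(2)\<close> is determined by the ratio \<open>z\<^sub>2 / z\<^sub>1\<close>,
  which can be any non-real number, and \<open>(c p, z\<^sub>2 / z\<^sub>1)\<close> is a chart of the quotient
  (\<open>orbit_chart\<close>). Every chart of the quotient atlas is an injective submersion in these
  coordinates, hence a diffeomorphism (\<open>quotient_chart_compatible\<close>). The Hausdorff property and
  second countability are inherited from \<open>M\<close> and from the half planes.

  The derivative of \<open>z\<^sub>2 / z\<^sub>1\<close> at \<open>g\<close> in direction \<open>X\<close> is \<open>det g / z\<^sub>1\<^sup>2\<close> times the value of \<open>\<zeta>\<close> on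
  \<open>g\<^sup>-\<^sup>1 X\<close> (\<open>ratio_has_derivative\<close>), and \<open>g\<^sup>-\<^sup>1 X\<close> is what a connection form yields on the vertical
  vector \<open>X\<close>. Therefore the kernel of the differential of the projection to the quotient is the
  common kernel of the soldering form \<open>\<omega>\<close> and of \<open>\<zeta>\<close> (\<open>dorbit_eq_iff\<close>), while \<open>\<omega>\<close> and \<open>\<zeta>\<close> together
  take all values (\<open>forms_surjective\<close>). For odd \<open>k\<close> the \<open>\<xi>\<^bsup>k,j\<^esup>\<close> are complex coordinates on the binary
  forms, so at each point of an orbit the values of the \<open>\<xi>\<^bsup>k,j\<^esup>\<close> and \<open>\<zeta>\<close> identify the tangent space of
  the quotient with a complex vector space. The structure \<open>J\<close> is multiplication by \<open>\<i>\<close> there. It is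
  the same at all points of the orbit because a conformal matrix multiplies each of these forms by
  a complex number (\<open>xi_form_conformal\<close>, \<open>zeta_form_conformal\<close>, \<open>J_dorbit\<close>).

  A complex-valued form pulled back from the quotient is a real linear function of the \<open>\<xi>\<^bsup>k,j\<^esup>\<close>
  and \<open>\<zeta>\<close>. It is of type \<open>(1,0)\<close> iff this function commutes with multiplication by \<open>\<i>\<close>, that
  is, iff it is complex linear (\<open>complex_linear_combination\<close>). In the coordinates \<open>(c p, z\<^sub>2 / z\<^sub>1)\<close> the
  matrix of \<open>J\<close> is a constant matrix conjugated by a smooth family (\<open>smooth_J_coords\<close>). Finally,
  \<open>J\<close> is determined by its forms of type \<open>(1,0)\<close>, since \<open>\<beta> - \<i> \<beta> \<circ> J\<close> is one of them for every
  real form \<open>\<beta>\<close> (\<open>almost_complex_structure_determined\<close>).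
\<close>

section \<open>Smooth maps between Euclidean spaces\<close>

lemma C_on_cong:
  assumes "open S" "\<And>x. x \<in> S \<Longrightarrow> f x = g x" "C_on n S f"
  shows "C_on n S g"
  using assms(2,3)
proof (induction n arbitrary: f g)
  case 0
  then show ?case using continuous_on_cong by fastforce
next
  case (Suc n)
  have D: "(g has_derivative frechet_derivative f (at x)) (at x)" if x: "x \<in> S" for x
  proof -
    have "(f has_derivative frechet_derivative f (at x)) (at x)"
      using Suc.prems(2) x by (simp add: frechet_derivative_works)
    then show ?thesis
      using has_derivative_transform_within_open[OF _ assms(1) x] Suc.prems(1) by blast
  qed
  have "C_on n S (\<lambda>x. frechet_derivative g (at x) v)" for v
    by (rule Suc.IH[of "\<lambda>x. frechet_derivative f (at x) v"])
      (use frechet_derivative_at[OF D] Suc.prems(2) in auto)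
  with D show ?case by (auto simp: differentiable_def)
qed

lemma C_on_SucI:
  assumes "open S" "\<And>x. x \<in> S \<Longrightarrow> (f has_derivative D x) (at x)"
    "\<And>v. C_on n S (\<lambda>x. D x v)"
  shows "C_on (Suc n) S f"
proof -
  have "C_on n S (\<lambda>x. frechet_derivative f (at x) v)" for v
    by (rule C_on_cong[OF assms(1) _ assms(3)]) (simp add: frechet_derivative_at[OF assms(2)])
  with assms(2) show ?thesis by (auto simp: differentiable_def)
qed

lemma C_on_Suc_has_derivative:
  "C_on (Suc n) S f \<Longrightarrow> x \<in> S \<Longrightarrow> (f has_derivative frechet_derivative f (at x)) (at x)"
  by (simp add: frechet_derivative_works)

lemma C_on_subset: "C_on n S f \<Longrightarrow> S' \<subseteq> S \<Longrightarrow> C_on n S' f"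
  by (induction n arbitrary: f) (auto intro: continuous_on_subset)

lemma C_on_local:
  assumes "\<And>x. x \<in> S \<Longrightarrow> \<exists>U. open U \<and> x \<in> U \<and> C_on n U f"
  shows "C_on n S f"
  using assms
proof (induction n arbitrary: f)
  case 0
  have "continuous (at x) f" if "x \<in> S" for x
    using 0[OF that] continuous_on_eq_continuous_at by auto
  then show ?case by (simp add: continuous_at_imp_continuous_on)
next
  case (Suc n)
  have "f differentiable at x" if "x \<in> S" for x
    using Suc.prems[OF that] by auto
  moreover have "C_on n S (\<lambda>x. frechet_derivative f (at x) v)" for v
    by (rule Suc.IH) (use Suc.prems in fastforce)
  ultimately show ?case by simp
qed

lemma C_on_Suc_imp: "C_on (Suc n) S f \<Longrightarrow> C_on n S f"
proof (induction n arbitrary: f)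
  case 0
  then show ?case
    by (auto intro!: continuous_at_imp_continuous_on differentiable_imp_continuous_within)
next
  case (Suc n)
  have "C_on (Suc n) S (\<lambda>x. frechet_derivative f (at x) v)" for v
    using Suc.prems C_on.simps(2) by blast
  then have "C_on n S (\<lambda>x. frechet_derivative f (at x) v)" for v
    using Suc.IH by blast
  then show ?case using Suc.prems by simp
qed

lemma C_on_const: "open S \<Longrightarrow> C_on n S (\<lambda>x. c)"
  by (induction n arbitrary: c) auto

lemma C_on_bounded_linear_comp:
  assumes "open S" "bounded_linear L" "C_on n S f"
  shows "C_on n S (\<lambda>x. L (f x))"
  using assms(3)
proof (induction n arbitrary: f)
  case 0
  then show ?case using bounded_linear.continuous_on[OF assms(2)] by simp
next
  case (Suc n)
  show ?case
  proof (rule C_on_SucI[OF assms(1)])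
    show "((\<lambda>x. L (f x)) has_derivative (\<lambda>v. L (frechet_derivative f (at x) v))) (at x)"
      if "x \<in> S" for x
      using bounded_linear.has_derivative[OF assms(2) C_on_Suc_has_derivative[OF Suc.prems that]] .
    show "C_on n S (\<lambda>x. L (frechet_derivative f (at x) v))" for v
      using Suc by simp
  qed
qed

lemma C_on_ident: "open S \<Longrightarrow> C_on n S (\<lambda>x. x)"
proof (induction n)
  case (Suc n)
  show ?case
    by (rule C_on_SucI[OF Suc.prems has_derivative_ident]) (rule C_on_const[OF Suc.prems])
qed simp

lemma C_on_add:
  assumes "open S" "C_on n S f" "C_on n S g"
  shows "C_on n S (\<lambda>x. f x + g x)"
  using assms(2,3)
proof (induction n arbitrary: f g)
  case 0
  then show ?case by (simp add: continuous_on_add)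
next
  case (Suc n)
  show ?case
  proof (rule C_on_SucI[OF assms(1)])
    show "((\<lambda>x. f x + g x) has_derivative
        (\<lambda>v. frechet_derivative f (at x) v + frechet_derivative g (at x) v)) (at x)" if "x \<in> S" for x
      using that Suc.prems by (intro has_derivative_add C_on_Suc_has_derivative)
    show "C_on n S (\<lambda>x. frechet_derivative f (at x) v + frechet_derivative g (at x) v)" for v
      using Suc by simp
  qed
qed

lemma C_on_sum:
  assumes "open S" "\<And>i. i \<in> I \<Longrightarrow> C_on n S (f i)"
  shows "C_on n S (\<lambda>x. \<Sum>i\<in>I. f i x)"
  using assms(2)
  by (induction I rule: infinite_finite_induct) (auto intro: C_on_const C_on_add assms(1))

lemma C_on_bilinear:
  assumes "open S" "bounded_bilinear pr" "C_on n S f" "C_on n S g"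
  shows "C_on n S (\<lambda>x. pr (f x) (g x))"
  using assms(3,4)
proof (induction n arbitrary: f g)
  case 0
  then show ?case using bounded_bilinear.continuous_on[OF assms(2)] by simp
next
  case (Suc n)
  show ?case
  proof (rule C_on_SucI[OF assms(1)])
    show "((\<lambda>x. pr (f x) (g x)) has_derivative
        (\<lambda>v. pr (f x) (frechet_derivative g (at x) v) + pr (frechet_derivative f (at x) v) (g x))) (at x)"
      if "x \<in> S" for x
      using that Suc.prems
      by (intro bounded_bilinear.FDERIV[OF assms(2)] C_on_Suc_has_derivative)
    have "C_on n S f" "C_on n S g"
      using Suc.prems C_on_Suc_imp by blast+
    then show "C_on n S (\<lambda>x. pr (f x) (frechet_derivative g (at x) v) +
        pr (frechet_derivative f (at x) v) (g x))" for v
      using Suc by (intro C_on_add assms(1)) simp_all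
  qed
qed

lemma linear_sum_Basis:
  fixes x :: "'a::euclidean_space" and L :: "'a \<Rightarrow> 'b::real_vector"
  assumes "linear L"
  shows "L x = (\<Sum>b\<in>Basis. (x \<bullet> b) *\<^sub>R L b)"
proof -
  have "L x = L (\<Sum>b\<in>Basis. (x \<bullet> b) *\<^sub>R b)" by (simp add: euclidean_representation)
  also have "\<dots> = (\<Sum>b\<in>Basis. (x \<bullet> b) *\<^sub>R L b)"
    using assms by (simp add: linear_sum linear_cmul)
  finally show ?thesis .
qed

text \<open>In coordinates a family of linear maps applied to a varying vector is a sum of products. All
  derivatives of composite maps and of inverses below have this shape.\<close>

lemma C_on_linear_family:
  fixes h :: "'a::euclidean_space \<Rightarrow> 'b::euclidean_space" and L :: "'a \<Rightarrow> 'b \<Rightarrow> 'c::real_normed_vector"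
  assumes "open S" "\<And>x. x \<in> S \<Longrightarrow> linear (L x)" "\<And>b. C_on n S (\<lambda>x. L x b)" "C_on n S h"
  shows "C_on n S (\<lambda>x. L x (h x))"
proof (rule C_on_cong[OF assms(1)])
  show "C_on n S (\<lambda>x. \<Sum>b\<in>Basis. (h x \<bullet> b) *\<^sub>R L x b)"
    by (intro C_on_sum C_on_bilinear[OF _ bounded_bilinear_scaleR] assms
        C_on_bounded_linear_comp[OF _ bounded_linear_inner_left])
qed (simp add: linear_sum_Basis[OF assms(2), symmetric])

lemma C_on_compose:
  fixes f :: "'a::euclidean_space \<Rightarrow> 'b::euclidean_space" and g :: "'b \<Rightarrow> 'c::real_normed_vector"
  assumes S: "open S" and T: "open T" "f ` S \<subseteq> T" and "C_on n S f" "C_on n T g"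
  shows "C_on n S (\<lambda>x. g (f x))"
  using assms(4,5)
proof (induction n arbitrary: g)
  case 0
  then show ?case using continuous_on_compose2[OF _ _ T(2)] by simp
next
  case (Suc n)
  show ?case
  proof (rule C_on_SucI[OF S])
    show "((\<lambda>x. g (f x)) has_derivative
        (\<lambda>v. frechet_derivative g (at (f x)) (frechet_derivative f (at x) v))) (at x)" if "x \<in> S" for x
      using has_derivative_compose[OF C_on_Suc_has_derivative[OF Suc.prems(1) that]
        C_on_Suc_has_derivative[OF Suc.prems(2)]] that T(2) by auto
    show "C_on n S (\<lambda>x. frechet_derivative g (at (f x)) (frechet_derivative f (at x) v))" for v
    proof (rule C_on_linear_family[OF S])
      show "linear (frechet_derivative g (at (f x)))" if "x \<in> S" for x
        using that Suc.prems(2) T(2) by (intro linear_frechet_derivative) auto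
      show "C_on n S (\<lambda>x. frechet_derivative g (at (f x)) b)" for b
        using Suc.IH[OF C_on_Suc_imp[OF Suc.prems(1)], of "\<lambda>y. frechet_derivative g (at y) b"]
          Suc.prems(2) by simp
      show "C_on n S (\<lambda>x. frechet_derivative f (at x) v)"
        using Suc.prems(1) by simp
    qed
  qed
qed

text \<open>The derivative of the inverse is a polynomial in the inverse, so one order of differentiability
  leads to the next.\<close>

lemma C_on_complex_inverse:
  "C_on n (- {0}) (inverse :: complex \<Rightarrow> complex)"
proof (induction n)
  case 0
  show ?case by (auto intro!: continuous_intros)
next
  case (Suc n)
  have op: "open (- {0::complex})" by (rule open_Compl) simp
  show ?case
  proof (rule C_on_SucI[OF op])
    show "(inverse has_derivative (\<lambda>v. - (inverse x * v * inverse x))) (at x)"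
      if "x \<in> - {0}" for x :: complex
      using that by (intro has_derivative_inverse') auto
    show "C_on n (- {0}) (\<lambda>x. - (inverse x * v * inverse x))" for v :: complex
      by (intro C_on_bounded_linear_comp[OF op bounded_linear_minus[OF bounded_linear_ident]]
          C_on_bilinear[OF op bounded_bilinear_mult] C_on_const[OF op] Suc)
  qed
qed

subsection \<open>Smooth families of linear isomorphisms\<close>

text \<open>\<open>G y v - G x v = - G y ((A y - A x) (G x v))\<close>, so it suffices to bound the operators \<open>G y\<close> near \<open>x\<close>.\<close>

lemma linear_inverse_family_continuous:
  fixes A G :: "'a::euclidean_space \<Rightarrow> 'b::euclidean_space \<Rightarrow> 'b"
  assumes S: "open S" and A: "\<And>x. x \<in> S \<Longrightarrow> linear (A x)" and G: "\<And>x. x \<in> S \<Longrightarrow> linear (G x)"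
    and GA: "\<And>x v. x \<in> S \<Longrightarrow> G x (A x v) = v" and AG: "\<And>x v. x \<in> S \<Longrightarrow> A x (G x v) = v"
    and cont: "\<And>v. continuous_on S (\<lambda>x. A x v)"
  shows "continuous_on S (\<lambda>x. G x v)"
proof (rule continuous_at_imp_continuous_on, safe)
  fix x assume x: "x \<in> S"
  obtain c where c: "c > 0" "\<And>w. norm (G x w) \<le> c * norm w"
    using linear_bounded_pos[OF G[OF x]] by metis
  have Ab: "((\<lambda>y. A y b) \<longlongrightarrow> A x b) (at x)" for b
    using cont[of b] S x by (metis at_within_open continuous_on)
  define r where "r y = (\<Sum>b\<in>Basis. norm (A y b - A x b))" for y
  have r: "norm (A y w - A x w) \<le> r y * norm w" if y: "y \<in> S" for y w
  proof -
    have "norm (A y w - A x w) = norm (\<Sum>b\<in>Basis. (w \<bullet> b) *\<^sub>R (A y b - A x b))"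
      by (simp add: linear_sum_Basis[OF A[OF x], of w] linear_sum_Basis[OF A[OF y], of w]
          scaleR_diff_right sum_subtractf)
    also have "\<dots> \<le> (\<Sum>b\<in>Basis. norm w * norm (A y b - A x b))"
      by (rule order_trans[OF norm_sum]) (auto intro!: sum_mono mult_right_mono Basis_le_norm)
    finally show ?thesis by (simp add: r_def sum_distrib_left mult.commute)
  qed
  have r0: "(r \<longlongrightarrow> 0) (at x)"
  proof -
    have "(r \<longlongrightarrow> (\<Sum>b\<in>Basis. norm (A x b - A x b))) (at x)"
      unfolding r_def by (intro tendsto_intros Ab)
    then show ?thesis by simp
  qed
  \<comment> \<open>\<open>c\<close> bounds \<open>G x\<close>; as soon as \<open>A y\<close> is closer than \<open>1 / (2 * c)\<close> to \<open>A x\<close>, the operator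
    \<open>G y\<close> is bounded by \<open>2 * c\<close>.\<close>
  have ev: "\<forall>\<^sub>F y in at x. y \<in> S \<and> c * r y < 1/2"
  proof (rule eventually_conj)
    show "\<forall>\<^sub>F y in at x. y \<in> S" using S x by (rule eventually_at_in_open')
    have "((\<lambda>y. c * r y) \<longlongrightarrow> c * 0) (at x)" by (intro tendsto_intros r0)
    then show "\<forall>\<^sub>F y in at x. c * r y < 1/2" by (rule order_tendstoD) simp
  qed
  have "\<forall>\<^sub>F y in at x. norm (G y v - G x v) \<le> 2 * c * (norm (A y (G x v) - A x (G x v)))"
    using ev
  proof eventually_elim
    case (elim y)
    have b: "norm w \<le> 2 * c * norm (A y w)" for w
    proof -
      have "norm w = norm (G x (A x w))" using GA x by simp
      also have "\<dots> \<le> c * norm (A x w)" by (rule c)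
      also have "\<dots> \<le> c * (norm (A y w) + norm (A y w - A x w))"
        using c(1) norm_triangle_ineq4[of "A y w" "A y w - A x w"] by (intro mult_left_mono) auto
      also have "\<dots> \<le> c * (norm (A y w) + r y * norm w)"
        using c(1) r[of y w] elim by (intro mult_left_mono) auto
      also have "\<dots> = c * norm (A y w) + (c * r y) * norm w" by (simp add: algebra_simps)
      also have "\<dots> \<le> c * norm (A y w) + 1/2 * norm w"
        using elim by (intro add_left_mono mult_right_mono) auto
      finally show ?thesis by simp
    qed
    have "A y (G y v - G x v) = - (A y (G x v) - A x (G x v))"
      using elim x by (simp add: linear_diff[OF A] AG)
    then show ?case using b[of "G y v - G x v"] by (simp add: norm_minus_commute)
  qed
  moreover have "((\<lambda>y. 2 * c * norm (A y (G x v) - A x (G x v))) \<longlongrightarrow>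
      2 * c * norm (A x (G x v) - A x (G x v))) (at x)"
    by (intro tendsto_intros Ab)
  ultimately have "((\<lambda>y. G y v - G x v) \<longlongrightarrow> 0) (at x)"
    by (rule_tac Lim_null_comparison) auto
  then show "isCont (\<lambda>x. G x v) x"
    by (simp add: isCont_def LIM_zero_iff)
qed

text \<open>Differentiating \<open>A x (G x v) = v\<close> expresses the derivative of the inverse family by
  \<open>G\<close> itself and the derivative of \<open>A\<close>; smoothness of \<open>G\<close> follows by induction.\<close>

lemma C_on_linear_inverse:
  fixes A G :: "'a::euclidean_space \<Rightarrow> 'b::euclidean_space \<Rightarrow> 'b"
  assumes S: "open S" and A: "\<And>x. x \<in> S \<Longrightarrow> linear (A x)" and G: "\<And>x. x \<in> S \<Longrightarrow> linear (G x)"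
    and GA: "\<And>x v. x \<in> S \<Longrightarrow> G x (A x v) = v" and AG: "\<And>x v. x \<in> S \<Longrightarrow> A x (G x v) = v"
    and "\<And>v. C_on n S (\<lambda>x. A x v)"
  shows "C_on n S (\<lambda>x. G x v)"
  using assms(6)
proof (induction n arbitrary: v)
  case 0
  then show ?case using linear_inverse_family_continuous[OF S A G GA AG] by simp
next
  case (Suc n)
  define dA where "dA x w u = frechet_derivative (\<lambda>y. A y u) (at x) w" for x w u
  have dA: "((\<lambda>y. A y u) has_derivative (\<lambda>w. dA x w u)) (at x)" if "x \<in> S" for x u
    using C_on_Suc_has_derivative[OF Suc.prems that] by (simp add: dA_def[abs_def])
  have lin: "linear (dA x w)" if x: "x \<in> S" for x w
  proof (rule linearI)
    fix a b :: 'b and s :: real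
    have "((\<lambda>y. A y (a + b)) has_derivative (\<lambda>w. dA x w a + dA x w b)) (at x)"
      by (rule has_derivative_transform_within_open[OF has_derivative_add[OF dA[OF x] dA[OF x]] S x])
        (simp add: linear_add[OF A])
    then show "dA x w (a + b) = dA x w a + dA x w b"
      using has_derivative_unique[OF dA[OF x]] by metis
    have "((\<lambda>y. A y (s *\<^sub>R b)) has_derivative (\<lambda>w. s *\<^sub>R dA x w b)) (at x)"
      by (rule has_derivative_transform_within_open[OF has_derivative_scaleR_right[OF dA[OF x]] S x])
        (simp add: linear_cmul[OF A])
    then show "dA x w (s *\<^sub>R b) = s *\<^sub>R dA x w b"
      using has_derivative_unique[OF dA[OF x]] by metis
  qed
  have contG: "continuous_on S (\<lambda>x. G x u)" for u
  proof (rule linear_inverse_family_continuous[OF S A G GA AG])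
    have "C_on 0 S (\<lambda>x. A x v)" for v using Suc.prems[of v]
      by (metis C_on.simps(1) C_on.simps(2) continuous_at_imp_continuous_on differentiable_imp_continuous_within)
    then show "continuous_on S (\<lambda>x. A x v)" for v by simp
  qed
  show ?case
  proof (rule C_on_SucI[OF S])
    fix x assume x: "x \<in> S"
    have blin: "bounded_linear (\<lambda>w. dA x w u)" for u
      using has_derivative_bounded_linear[OF dA[OF x]] .
    show "((\<lambda>x. G x v) has_derivative (\<lambda>w. - G x (dA x w (G x v)))) (at x)"
      unfolding has_derivative_at_within
    proof (intro conjI)
      show "bounded_linear (\<lambda>w. - G x (dA x w (G x v)))"
        using bounded_linear_compose[OF linear_conv_bounded_linear[THEN iffD1, OF G[OF x]] blin[of "G x v"]]
        by (intro bounded_linear_minus)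
      \<comment> \<open>\<open>R\<close> is the remainder in the derivative of \<open>A\<close> at the vector \<open>G x v\<close>, and \<open>D\<close> is the
        bounded difference quotient of its linear part; the remainder for \<open>G\<close> is
        \<open>- G y (R y) - (G y - G x) (D y)\<close>.\<close>
      define R where "R y = (A y (G x v) - A x (G x v) - dA x (y - x) (G x v)) /\<^sub>R norm (y - x)" for y
      have R: "(R \<longlongrightarrow> 0) (at x)"
        using dA[OF x, of "G x v"] unfolding has_derivative_at_within R_def by blast
      obtain K where K: "\<And>w. norm (dA x w (G x v)) \<le> norm w * K"
        using bounded_linear.bounded[OF blin] by metis
      define D where "D y = dA x (y - x) (G x v) /\<^sub>R norm (y - x)" for y
      have D: "norm (D y) \<le> \<bar>K\<bar>" for y
      proof -
        have "norm (dA x (y - x) (G x v)) \<le> norm (y - x) * \<bar>K\<bar>"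
          by (rule order_trans[OF K]) (simp add: mult_left_mono)
        then show ?thesis by (cases "y = x") (auto simp: D_def divide_simps mult.commute)
      qed
      show "((\<lambda>y. ((G y v - G x v) - - G x (dA x (y - x) (G x v))) /\<^sub>R norm (y - x)) \<longlongrightarrow> 0) (at x)"
      proof -
        have Gt: "((\<lambda>y. G y b) \<longlongrightarrow> G x b) (at x)" for b
          using contG[of b] S x by (metis at_within_open continuous_on)
        have "((\<lambda>y. \<Sum>b\<in>Basis. (R y \<bullet> b) *\<^sub>R G y b) \<longlongrightarrow> (\<Sum>b\<in>Basis. (0 \<bullet> b) *\<^sub>R G x b)) (at x)"
          by (intro tendsto_intros R Gt)
        then have 1: "((\<lambda>y. \<Sum>b\<in>Basis. (R y \<bullet> b) *\<^sub>R G y b) \<longlongrightarrow> 0) (at x)" by simp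
        have "((\<lambda>y. \<Sum>b\<in>Basis. \<bar>K\<bar> * norm (G y b - G x b)) \<longlongrightarrow> (\<Sum>b\<in>Basis. \<bar>K\<bar> * norm (G x b - G x b))) (at x)"
          by (intro tendsto_intros Gt)
        then have 2: "((\<lambda>y. \<Sum>b\<in>Basis. \<bar>K\<bar> * norm (G y b - G x b)) \<longlongrightarrow> 0) (at x)" by simp
        have 3: "((\<lambda>y. \<Sum>b\<in>Basis. (D y \<bullet> b) *\<^sub>R (G y b - G x b)) \<longlongrightarrow> 0) (at x)"
        proof (rule Lim_null_comparison[OF _ 2], rule always_eventually, rule allI)
          fix y
          have "\<bar>D y \<bullet> b\<bar> * norm (G y b - G x b) \<le> \<bar>K\<bar> * norm (G y b - G x b)" if "b \<in> Basis" for b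
            using Basis_le_norm[OF that, of "D y"] D[of y] by (intro mult_right_mono) auto
          then show "norm (\<Sum>b\<in>Basis. (D y \<bullet> b) *\<^sub>R (G y b - G x b))
              \<le> (\<Sum>b\<in>Basis. \<bar>K\<bar> * norm (G y b - G x b))"
            by (intro order_trans[OF norm_sum] sum_mono) simp
        qed
        have "((\<lambda>y. - (\<Sum>b\<in>Basis. (R y \<bullet> b) *\<^sub>R G y b) - (\<Sum>b\<in>Basis. (D y \<bullet> b) *\<^sub>R (G y b - G x b)))
            \<longlongrightarrow> - 0 - 0) (at x)"
          by (intro tendsto_intros 1 3)
        then have lim: "((\<lambda>y. - (\<Sum>b\<in>Basis. (R y \<bullet> b) *\<^sub>R G y b) - (\<Sum>b\<in>Basis. (D y \<bullet> b) *\<^sub>R (G y b - G x b)))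
            \<longlongrightarrow> 0) (at x)" by simp
        have eq: "- (\<Sum>b\<in>Basis. (R y \<bullet> b) *\<^sub>R G y b) - (\<Sum>b\<in>Basis. (D y \<bullet> b) *\<^sub>R (G y b - G x b)) =
            ((G y v - G x v) - - G x (dA x (y - x) (G x v))) /\<^sub>R norm (y - x)" if y: "y \<in> S" for y
        proof -
          have e1: "(\<Sum>b\<in>Basis. (R y \<bullet> b) *\<^sub>R G y b) = G y (R y)"
            by (rule linear_sum_Basis[OF G[OF y], symmetric])
          have e2: "(\<Sum>b\<in>Basis. (D y \<bullet> b) *\<^sub>R (G y b - G x b)) = G y (D y) - G x (D y)"
            unfolding linear_sum_Basis[OF G[OF y], of "D y"] linear_sum_Basis[OF G[OF x], of "D y"]
            by (simp add: scaleR_diff_right sum_subtractf)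
          have e3: "G y (A y (G x v) - A x (G x v)) = G x v - G y v"
            by (simp add: linear_diff[OF G[OF y]] GA[OF y] AG[OF x])
          have "G y (R y) + G y (D y) = (G x v - G y v) /\<^sub>R norm (y - x)"
            unfolding linear_add[OF G[OF y], symmetric]
            by (simp add: R_def D_def scaleR_add_right[symmetric] linear_cmul[OF G[OF y]] e3)
          moreover have "G x (D y) = G x (dA x (y - x) (G x v)) /\<^sub>R norm (y - x)"
            by (simp add: D_def linear_cmul[OF G[OF x]])
          ultimately show ?thesis unfolding e1 e2
            by (simp add: algebra_simps)
        qed
        show ?thesis
          by (rule Lim_transform_within_open[OF lim S x eq])
      qed
    qed
  next
    fix w
    show "C_on n S (\<lambda>x. - G x (dA x w (G x v)))"
    proof -
      have IH: "C_on n S (\<lambda>x. G x u)" for u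
        using Suc.IH C_on_Suc_imp[OF Suc.prems] by blast
      have "C_on n S (\<lambda>x. dA x w u)" for u
        using Suc.prems by (simp add: dA_def)
      then have "C_on n S (\<lambda>x. dA x w (G x v))"
        using C_on_linear_family[where L = "\<lambda>x. dA x w", OF S lin _ IH] by blast
      then have "C_on n S (\<lambda>x. G x (dA x w (G x v)))"
        using C_on_linear_family[where L = G, OF S G IH] by blast
      then show ?thesis
        by (rule C_on_bounded_linear_comp[OF S bounded_linear_minus[OF bounded_linear_ident]])
    qed
  qed
qed

subsection \<open>Smoothness\<close>

named_theorems smooth_intros

lemma smooth_on_cong: "open S \<Longrightarrow> (\<And>x. x \<in> S \<Longrightarrow> f x = g x) \<Longrightarrow> smooth_on S f \<Longrightarrow> smooth_on S g"
  unfolding smooth_on_def using C_on_cong by blast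

lemma smooth_on_subset: "smooth_on S f \<Longrightarrow> S' \<subseteq> S \<Longrightarrow> smooth_on S' f"
  unfolding smooth_on_def using C_on_subset by blast

lemma smooth_on_local:
  "(\<And>x. x \<in> S \<Longrightarrow> \<exists>U. open U \<and> x \<in> U \<and> smooth_on U f) \<Longrightarrow> smooth_on S f"
  unfolding smooth_on_def by (meson C_on_local)

lemma smooth_on_imp_continuous_on: "smooth_on S f \<Longrightarrow> continuous_on S f"
  unfolding smooth_on_def by (metis C_on.simps(1))

lemma smooth_on_has_derivative:
  "smooth_on S f \<Longrightarrow> x \<in> S \<Longrightarrow> (f has_derivative frechet_derivative f (at x)) (at x)"
  unfolding smooth_on_def using C_on_Suc_has_derivative by blast

lemma smooth_on_frechet_derivative: "smooth_on S f \<Longrightarrow> smooth_on S (\<lambda>x. frechet_derivative f (at x) v)"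
  unfolding smooth_on_def using C_on.simps(2) by blast

lemma smooth_on_const [smooth_intros]: "open S \<Longrightarrow> smooth_on S (\<lambda>x. c)"
  unfolding smooth_on_def using C_on_const by blast

lemma smooth_on_ident [smooth_intros]: "open S \<Longrightarrow> smooth_on S (\<lambda>x. x)"
  unfolding smooth_on_def using C_on_ident by blast

lemma smooth_on_bounded_linear:
  "open S \<Longrightarrow> bounded_linear L \<Longrightarrow> smooth_on S f \<Longrightarrow> smooth_on S (\<lambda>x. L (f x))"
  unfolding smooth_on_def using C_on_bounded_linear_comp by blast

lemma smooth_on_linear:
  fixes f :: "'a::euclidean_space \<Rightarrow> 'b::euclidean_space"
  shows "open S \<Longrightarrow> linear L \<Longrightarrow> smooth_on S f \<Longrightarrow> smooth_on S (\<lambda>x. L (f x))"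
  by (simp add: linear_conv_bounded_linear smooth_on_bounded_linear)

lemma smooth_on_add [smooth_intros]:
  "open S \<Longrightarrow> smooth_on S f \<Longrightarrow> smooth_on S g \<Longrightarrow> smooth_on S (\<lambda>x. f x + g x)"
  unfolding smooth_on_def using C_on_add by blast

lemma smooth_on_minus [smooth_intros]: "open S \<Longrightarrow> smooth_on S f \<Longrightarrow> smooth_on S (\<lambda>x. - f x)"
  by (rule smooth_on_bounded_linear[OF _ bounded_linear_minus[OF bounded_linear_ident]])

lemma smooth_on_diff [smooth_intros]:
  "open S \<Longrightarrow> smooth_on S f \<Longrightarrow> smooth_on S g \<Longrightarrow> smooth_on S (\<lambda>x. f x - g x)"
  using smooth_on_add[OF _ _ smooth_on_minus] by fastforce

lemma smooth_on_sum [smooth_intros]: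
  "open S \<Longrightarrow> (\<And>i. i \<in> I \<Longrightarrow> smooth_on S (f i)) \<Longrightarrow> smooth_on S (\<lambda>x. \<Sum>i\<in>I. f i x)"
  unfolding smooth_on_def using C_on_sum[of S I] by blast

lemma smooth_on_bilinear:
  "open S \<Longrightarrow> bounded_bilinear pr \<Longrightarrow> smooth_on S f \<Longrightarrow> smooth_on S g \<Longrightarrow> smooth_on S (\<lambda>x. pr (f x) (g x))"
  unfolding smooth_on_def using C_on_bilinear by blast

lemmas smooth_on_mult [smooth_intros] = smooth_on_bilinear[OF _ bounded_bilinear_mult]
lemmas smooth_on_scaleR [smooth_intros] = smooth_on_bilinear[OF _ bounded_bilinear_scaleR]

lemma smooth_on_componentwise:
  fixes f :: "'a::euclidean_space \<Rightarrow> 'b::euclidean_space"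
  assumes "open S" "\<And>b. b \<in> Basis \<Longrightarrow> smooth_on S (\<lambda>x. f x \<bullet> b)"
  shows "smooth_on S f"
proof (rule smooth_on_cong[OF assms(1)])
  show "smooth_on S (\<lambda>x. \<Sum>b\<in>Basis. (f x \<bullet> b) *\<^sub>R b)"
    using assms by (intro smooth_intros)
qed (simp add: euclidean_representation)

lemma smooth_on_Pair [smooth_intros]:
  fixes f :: "'a::euclidean_space \<Rightarrow> 'b::euclidean_space" and g :: "'a \<Rightarrow> 'c::euclidean_space"
  assumes S: "open S" and "smooth_on S f" "smooth_on S g"
  shows "smooth_on S (\<lambda>x. (f x, g x))"
proof -
  have "smooth_on S (\<lambda>x. (\<lambda>u. (u, 0)) (f x) + (\<lambda>u. (0, u)) (g x))"
    by (intro smooth_on_add[OF S] smooth_on_bounded_linear[OF S _ assms(2)]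
        smooth_on_bounded_linear[OF S _ assms(3)] bounded_linear_Pair bounded_linear_ident bounded_linear_zero)
  then show ?thesis by simp
qed

lemma smooth_on_fst [smooth_intros]:
  "open S \<Longrightarrow> smooth_on S f \<Longrightarrow> smooth_on S (\<lambda>x. fst (f x))"
  by (rule smooth_on_bounded_linear[OF _ bounded_linear_fst])

lemma smooth_on_snd [smooth_intros]:
  "open S \<Longrightarrow> smooth_on S f \<Longrightarrow> smooth_on S (\<lambda>x. snd (f x))"
  by (rule smooth_on_bounded_linear[OF _ bounded_linear_snd])

lemma smooth_on_compose:
  fixes f :: "'a::euclidean_space \<Rightarrow> 'b::euclidean_space" and g :: "'b \<Rightarrow> 'c::real_normed_vector"
  shows "open S \<Longrightarrow> open T \<Longrightarrow> f ` S \<subseteq> T \<Longrightarrow> smooth_on S f \<Longrightarrow> smooth_on T g \<Longrightarrow> smooth_on S (\<lambda>x. g (f x))"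
  unfolding smooth_on_def using C_on_compose by blast

lemma smooth_on_linear_family:
  fixes h :: "'a::euclidean_space \<Rightarrow> 'b::euclidean_space" and L :: "'a \<Rightarrow> 'b \<Rightarrow> 'c::real_normed_vector"
  shows "open S \<Longrightarrow> (\<And>x. x \<in> S \<Longrightarrow> linear (L x)) \<Longrightarrow> (\<And>b. smooth_on S (\<lambda>x. L x b)) \<Longrightarrow> smooth_on S h
    \<Longrightarrow> smooth_on S (\<lambda>x. L x (h x))"
  unfolding smooth_on_def using C_on_linear_family by blast

lemma smooth_on_linear_inverse:
  fixes A G :: "'a::euclidean_space \<Rightarrow> 'b::euclidean_space \<Rightarrow> 'b"
  shows "open S \<Longrightarrow> (\<And>x. x \<in> S \<Longrightarrow> linear (A x)) \<Longrightarrow> (\<And>x. x \<in> S \<Longrightarrow> linear (G x)) \<Longrightarrow>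
    (\<And>x v. x \<in> S \<Longrightarrow> G x (A x v) = v) \<Longrightarrow> (\<And>x v. x \<in> S \<Longrightarrow> A x (G x v) = v) \<Longrightarrow>
    (\<And>v. smooth_on S (\<lambda>x. A x v)) \<Longrightarrow> smooth_on S (\<lambda>x. G x v)"
  unfolding smooth_on_def using C_on_linear_inverse[of S A G] by blast

lemma smooth_on_complex_inverse [smooth_intros]:
  fixes f :: "'a::euclidean_space \<Rightarrow> complex"
  assumes "open S" "smooth_on S f" "\<And>x. x \<in> S \<Longrightarrow> f x \<noteq> 0"
  shows "smooth_on S (\<lambda>x. inverse (f x))"
proof (rule smooth_on_compose[OF assms(1) _ _ assms(2)])
  show "open (- {0::complex})" by (rule open_Compl) simp
qed (use assms(3) C_on_complex_inverse in \<open>auto simp: smooth_on_def\<close>)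

lemma smooth_on_complex_divide [smooth_intros]:
  fixes f :: "'a::euclidean_space \<Rightarrow> complex"
  assumes "open S" "smooth_on S f" "smooth_on S g" "\<And>x. x \<in> S \<Longrightarrow> g x \<noteq> 0"
  shows "smooth_on S (\<lambda>x. f x / g x)"
  unfolding divide_inverse using assms by (intro smooth_intros)

text \<open>An injective smooth map between open sets of the same dimension is a homeomorphism by
  invariance of domain, so only the differentiability of its inverse has to be derived from the
  inverse function theorem.\<close>

lemma smooth_inverse_function:
  fixes f :: "'a::euclidean_space \<Rightarrow> 'a"
  assumes S: "open S" and f: "smooth_on S f" and inj: "inj_on f S"
    and surj: "\<And>x. x \<in> S \<Longrightarrow> surj (frechet_derivative f (at x))"
  shows "open (f ` S)" and "smooth_on (f ` S) (inv_into S f)"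
proof -
  have cf: "continuous_on S f" using f by (rule smooth_on_imp_continuous_on)
  show op: "open (f ` S)" by (rule invariance_of_domain[OF cf S inj])
  define h where "h = inv_into S f"
  obtain g where "homeomorphism S (f ` S) f g"
    by (rule invariance_of_domain_homeomorphism[OF S cf _ inj]) simp
  then have "continuous_on (f ` S) g" "\<And>x. x \<in> S \<Longrightarrow> g (f x) = x"
    by (auto simp: homeomorphism_def)
  then have ch: "continuous_on (f ` S) h"
    by (rule_tac continuous_on_eq[of _ g]) (auto simp: h_def inj)
  have hS: "h y \<in> S" "f (h y) = y" if "y \<in> f ` S" for y
    using that by (auto simp: h_def inv_into_into f_inv_into_f)
  define A where "A y = frechet_derivative f (at (h y))" for y
  define G where "G y = inv (A y)" for y
  have A: "linear (A y)" if "y \<in> f ` S" for y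
    unfolding A_def using smooth_on_has_derivative[OF f hS(1)[OF that]] has_derivative_linear by blast
  have bijA: "bij (A y)" if "y \<in> f ` S" for y
    using linear_surjective_imp_injective[OF A[OF that]] surj[OF hS(1)[OF that]]
    by (simp add: A_def bij_def)
  have GA: "G y (A y v) = v" "A y (G y v) = v" if "y \<in> f ` S" for y v
    using bijA[OF that] by (simp_all add: G_def bij_is_inj bij_is_surj surj_f_inv_f)
  have G: "linear (G y)" if y: "y \<in> f ` S" for y
  proof -
    obtain g where g: "linear g" "g \<circ> A y = id"
      using linear_injective_left_inverse[OF A[OF y] bij_is_inj[OF bijA[OF y]]] by blast
    have "G y v = g v" for v
      using fun_cong[OF g(2), of "G y v"] GA(2)[OF y] by simp
    then have "G y = g" by blast
    with g(1) show ?thesis by simp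
  qed
  have D: "(h has_derivative G y) (at y)" if y: "y \<in> f ` S" for y
  proof (rule has_derivative_inverse_basic[where f = f and f' = "A y", OF _ _ _ _ op y hS(2)])
    show "(f has_derivative A y) (at (h y))"
      unfolding A_def by (rule smooth_on_has_derivative[OF f hS(1)[OF y]])
    show "bounded_linear (G y)" using G[OF y] by (simp add: linear_conv_bounded_linear)
    show "G y \<circ> A y = id" using GA[OF y] by auto
    show "isCont h y" using continuous_on_eq_continuous_at[OF op] ch y by blast
  qed
  have "C_on n (f ` S) h" for n
  proof (induction n)
    case 0
    show ?case using ch by simp
  next
    case (Suc n)
    show ?case
    proof (rule C_on_SucI[OF op D])
      have "C_on n (f ` S) (\<lambda>y. A y v)" for v
        unfolding A_def
        using C_on_compose[OF op S _ Suc, of "\<lambda>x. frechet_derivative f (at x) v"] hS(1)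
          smooth_on_frechet_derivative[OF f, of v] unfolding smooth_on_def by blast
      then show "C_on n (f ` S) (\<lambda>y. G y v)" for v
        using C_on_linear_inverse[where A = A and G = G, OF op A G GA] by blast
    qed
  qed
  then show "smooth_on (f ` S) (inv_into S f)" by (simp add: smooth_on_def h_def)
qed

section \<open>Tangent spaces in coordinates\<close>

definition chart_inv :: "('a, 'e) chart \<Rightarrow> 'e \<Rightarrow> 'a" where
  "chart_inv C = inv_into (fst C) (snd C)"

definition coord_change :: "('a, 'e) chart \<Rightarrow> ('a, 'e) chart \<Rightarrow> 'e \<Rightarrow> 'e" where
  "coord_change C C' = snd C' \<circ> chart_inv C"

definition coord_jacobian :: "('a, 'e::euclidean_space) chart \<Rightarrow> ('a, 'e) chart \<Rightarrow> 'a \<Rightarrow> 'e \<Rightarrow> 'e" where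
  "coord_jacobian C C' p = frechet_derivative (coord_change C C') (at (snd C p))"

text \<open>The part of being a smooth manifold that the differential calculus rests on. The frame bundle
  and its quotient are shown to have it before any separation or countability property.\<close>

locale smooth_atlas =
  fixes N :: "('a, 'e::euclidean_space) atlas"
  assumes chart_inj: "C \<in> N \<Longrightarrow> inj_on (snd C) (fst C)"
    and chart_open: "C \<in> N \<Longrightarrow> open (snd C ` fst C)"
    and overlap_open: "C \<in> N \<Longrightarrow> C' \<in> N \<Longrightarrow> open (snd C ` (fst C \<inter> fst C'))"
    and coord_change_smooth: "C \<in> N \<Longrightarrow> C' \<in> N \<Longrightarrow> smooth_on (snd C ` (fst C \<inter> fst C')) (coord_change C C')"

lemma smooth_manifold_imp_smooth_atlas: "smooth_manifold M \<Longrightarrow> smooth_atlas M"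
  unfolding smooth_manifold_def smooth_atlas_def coord_change_def chart_inv_def by fastforce

lemma smooth_manifoldI:
  "smooth_atlas M \<Longrightarrow> Hausdorff_space (topology (mopen M)) \<Longrightarrow> second_countable (topology (mopen M))
    \<Longrightarrow> smooth_manifold M"
  unfolding smooth_manifold_def smooth_atlas_def coord_change_def chart_inv_def by fastforce

context smooth_atlas
begin

lemma chart_inv [simp]: "C \<in> N \<Longrightarrow> p \<in> fst C \<Longrightarrow> chart_inv C (snd C p) = p"
  by (simp add: chart_inv_def chart_inj)

lemma coord_change_chart: "C \<in> N \<Longrightarrow> p \<in> fst C \<Longrightarrow> coord_change C C' (snd C p) = snd C' p"
  by (simp add: coord_change_def)

lemma coord_change_derivative:
  assumes "chart_at N p C" "chart_at N p C'"
  shows "(coord_change C C' has_derivative coord_jacobian C C' p) (at (snd C p))"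
  unfolding coord_jacobian_def
  using assms smooth_on_has_derivative[OF coord_change_smooth] by (auto simp: chart_at_def)

lemma coord_jacobian_self:
  assumes "chart_at N p C"
  shows "coord_jacobian C C p = (\<lambda>e. e)"
proof -
  have C: "C \<in> N" "p \<in> fst C" using assms by (auto simp: chart_at_def)
  have "(coord_change C C has_derivative (\<lambda>e. e)) (at (snd C p))"
    by (rule has_derivative_transform_within_open[OF has_derivative_ident chart_open[OF C(1)]])
      (use C in \<open>auto simp: coord_change_chart\<close>)
  then show ?thesis
    using has_derivative_unique coord_change_derivative[OF assms assms] by blast
qed

lemma coord_jacobian_trans:
  assumes "chart_at N p C" "chart_at N p C'" "chart_at N p C''"
  shows "coord_jacobian C C'' p e = coord_jacobian C' C'' p (coord_jacobian C C' p e)"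
proof -
  have C: "C \<in> N" "p \<in> fst C" "C' \<in> N" "p \<in> fst C'" using assms by (auto simp: chart_at_def)
  have "((\<lambda>x. coord_change C' C'' (coord_change C C' x)) has_derivative
      (\<lambda>e. coord_jacobian C' C'' p (coord_jacobian C C' p e))) (at (snd C p))"
    using has_derivative_compose[OF coord_change_derivative[OF assms(1,2)], of "coord_change C' C''" "coord_jacobian C' C'' p"]
      coord_change_derivative[OF assms(2,3)] coord_change_chart[OF C(1,2)] by simp
  then have "(coord_change C C'' has_derivative (\<lambda>e. coord_jacobian C' C'' p (coord_jacobian C C' p e))) (at (snd C p))"
    by (rule has_derivative_transform_within_open[OF _ overlap_open[OF C(1,3)]])
      (use C in \<open>auto simp: coord_change_chart\<close>)
  then show ?thesis
    using has_derivative_unique coord_change_derivative[OF assms(1,3)] by metis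
qed

lemma coord_vec_apply: "chart_at N p C' \<Longrightarrow> coord_vec N C p e C' = coord_jacobian C C' p e"
  by (simp add: coord_vec_def coord_jacobian_def coord_change_def chart_inv_def)

lemma tangent_space_iff:
  "v \<in> tangent_space N p \<longleftrightarrow> (\<forall>C. \<not> chart_at N p C \<longrightarrow> v C = 0) \<and>
     (\<forall>C C'. chart_at N p C \<longrightarrow> chart_at N p C' \<longrightarrow> v C' = coord_jacobian C C' p (v C))"
  by (simp add: tangent_space_def coord_jacobian_def coord_change_def chart_inv_def)

lemma coord_vec_self [simp]: "chart_at N p C \<Longrightarrow> coord_vec N C p e C = e"
  by (simp add: coord_vec_apply coord_jacobian_self)

lemma coord_vec_in_tangent_space:
  assumes "chart_at N p C"
  shows "coord_vec N C p e \<in> tangent_space N p"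
  unfolding tangent_space_iff
proof (intro conjI allI impI)
  show "coord_vec N C p e C' = 0" if "\<not> chart_at N p C'" for C'
    using that by (simp add: coord_vec_def)
  show "coord_vec N C p e C'' = coord_jacobian C' C'' p (coord_vec N C p e C')"
    if "chart_at N p C'" "chart_at N p C''" for C' C''
    using coord_jacobian_trans[OF assms that] that by (simp add: coord_vec_apply)
qed

lemma coord_vec_eq:
  assumes "v \<in> tangent_space N p" "chart_at N p C"
  shows "coord_vec N C p (v C) = v"
proof
  fix C'
  show "coord_vec N C p (v C) C' = v C'"
  proof (cases "chart_at N p C'")
    case True
    then show ?thesis
      using assms(2) assms(1)[unfolded tangent_space_iff] coord_vec_apply by metis
  next
    case False
    then show ?thesis
      using assms(1)[unfolded tangent_space_iff] unfolding coord_vec_def by metis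
  qed
qed

lemma tangent_space_eqI:
  "u \<in> tangent_space N p \<Longrightarrow> v \<in> tangent_space N p \<Longrightarrow> chart_at N p C \<Longrightarrow> u C = v C \<Longrightarrow> u = v"
  using coord_vec_eq by metis

lemma coord_jacobian_linear: "chart_at N p C \<Longrightarrow> chart_at N p C' \<Longrightarrow> linear (coord_jacobian C C' p)"
  using coord_change_derivative has_derivative_linear by blast

lemma tangent_space_subspace: "subspace (tangent_space N p)"
proof -
  have lin: "linear (coord_jacobian C C' p)" if "chart_at N p C" "chart_at N p C'" for C C'
    using that by (rule coord_jacobian_linear)
  show ?thesis
    unfolding subspace_def
  proof (intro conjI ballI allI)
    show "0 \<in> tangent_space N p"
      unfolding tangent_space_iff using linear_0[OF lin] by simp
    show "u + v \<in> tangent_space N p" if "u \<in> tangent_space N p" "v \<in> tangent_space N p" for u v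
      using that[unfolded tangent_space_iff] linear_add[OF lin]
      unfolding tangent_space_iff plus_fun_apply by (metis add.right_neutral)
    show "r *\<^sub>R v \<in> tangent_space N p" if "v \<in> tangent_space N p" for r v
      using that[unfolded tangent_space_iff] linear_cmul[OF lin]
      unfolding tangent_space_iff scaleR_fun_def by (metis scaleR_zero_right)
  qed
qed

lemma coord_vec_linear:
  assumes "chart_at N p C" shows "linear (coord_vec N C p)"
proof (rule linearI)
  show "coord_vec N C p (x + y) = coord_vec N C p x + coord_vec N C p y" for x y
    using linear_add[OF coord_jacobian_linear[OF assms]]
    by (auto simp: fun_eq_iff coord_vec_def coord_jacobian_def coord_change_def chart_inv_def)
  show "coord_vec N C p (r *\<^sub>R x) = r *\<^sub>R coord_vec N C p x" for r x
    using linear_cmul[OF coord_jacobian_linear[OF assms]]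
    by (auto simp: fun_eq_iff scaleR_fun_def coord_vec_def coord_jacobian_def coord_change_def chart_inv_def)
qed

text \<open>\<^const>\<open>tangent_map\<close> is evaluated in an unspecified chart around \<open>p\<close>; the chain rule replaces it by a
  chart of one's choice.\<close>

lemma tangent_map_apply:
  assumes C: "chart_at N p C" and C': "chart_at N' (f p) C'" and v: "v \<in> tangent_space N p"
    and D: "((snd C' \<circ> f \<circ> chart_inv C) has_derivative D) (at (snd C p))"
  shows "tangent_map N N' f p v C' = D (v C)"
proof -
  define C1 where "C1 = (SOME C. chart_at N p C)"
  have C1: "chart_at N p C1" unfolding C1_def using C by (rule someI)
  have in1: "C1 \<in> N" "p \<in> fst C1" "C \<in> N" "p \<in> fst C" using C C1 by (auto simp: chart_at_def)
  have "((\<lambda>x. (snd C' \<circ> f \<circ> chart_inv C) (coord_change C1 C x)) has_derivative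
      (\<lambda>e. D (coord_jacobian C1 C p e))) (at (snd C1 p))"
    using has_derivative_compose[OF coord_change_derivative[OF C1 C]] D coord_change_chart[OF in1(1,2)] by metis
  then have "((snd C' \<circ> f \<circ> chart_inv C1) has_derivative (\<lambda>e. D (coord_jacobian C1 C p e))) (at (snd C1 p))"
    by (rule has_derivative_transform_within_open[OF _ overlap_open[OF in1(1,3)]])
      (use in1 in \<open>auto simp: coord_change_chart\<close>)
  then have "frechet_derivative (snd C' \<circ> f \<circ> chart_inv C1) (at (snd C1 p)) (v C1) = D (coord_jacobian C1 C p (v C1))"
    by (simp add: frechet_derivative_at[symmetric])
  also have "coord_jacobian C1 C p (v C1) = v C"
    using v C C1 unfolding tangent_space_iff by metis
  finally show ?thesis
    using C' by (simp add: tangent_map_def Let_def C1_def[symmetric] chart_inv_def del: comp_apply o_apply)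
qed

text \<open>The set \<open>G\<close> stands in for the continuity of \<open>f\<close>: near \<open>p\<close> the coordinate expressions of \<open>f\<close> in two charts
  around \<open>f p\<close> differ by a coordinate change.\<close>

lemma tangent_map_eq_coord_vec:
  assumes N': "smooth_atlas N'" and C: "chart_at N p C" and C': "chart_at N' (f p) C'"
    and v: "v \<in> tangent_space N p"
    and D: "((snd C' \<circ> f \<circ> chart_inv C) has_derivative D) (at (snd C p))"
    and G: "open G" "snd C p \<in> G" "\<And>y. y \<in> G \<Longrightarrow> f (chart_inv C y) \<in> fst C'"
  shows "tangent_map N N' f p v = coord_vec N' C' (f p) (D (v C))"
proof
  fix C''
  interpret N': smooth_atlas N' by fact
  have in1: "C \<in> N" "p \<in> fst C" "C' \<in> N'" "f p \<in> fst C'" using C C' by (auto simp: chart_at_def)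
  show "tangent_map N N' f p v C'' = coord_vec N' C' (f p) (D (v C)) C''"
  proof (cases "chart_at N' (f p) C''")
    case True
    have "(coord_change C' C'' has_derivative coord_jacobian C' C'' (f p)) (at ((snd C' \<circ> f \<circ> chart_inv C) (snd C p)))"
      using N'.coord_change_derivative[OF C' True] in1 by simp
    from has_derivative_compose[OF D this]
    have "((snd C'' \<circ> f \<circ> chart_inv C) has_derivative (\<lambda>e. coord_jacobian C' C'' (f p) (D e))) (at (snd C p))"
      by (rule has_derivative_transform_within_open[OF _ G(1,2)])
        (use G(3) in1 N'.coord_change_chart in auto)
    from tangent_map_apply[OF C True v this] show ?thesis
      by (simp add: N'.coord_vec_apply[OF True])
  qed (simp add: tangent_map_def coord_vec_def)
qed

lemma velocity_eq_coord_vec: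
  assumes C: "chart_at N (\<gamma> 0) C" and w: "((snd C \<circ> \<gamma>) has_vector_derivative w) (at 0)"
    and near: "open G" "0 \<in> G" "\<And>t. t \<in> G \<Longrightarrow> \<gamma> t \<in> fst C"
  shows "velocity N \<gamma> = coord_vec N C (\<gamma> 0) w"
proof
  fix C'
  show "velocity N \<gamma> C' = coord_vec N C (\<gamma> 0) w C'"
  proof (cases "chart_at N (\<gamma> 0) C'")
    case True
    have CN: "C \<in> N" using C by (simp add: chart_at_def)
    have "(coord_change C C' has_derivative coord_jacobian C C' (\<gamma> 0)) (at ((snd C \<circ> \<gamma>) 0))"
      using coord_change_derivative[OF C True] by simp
    from has_derivative_compose[OF w[unfolded has_vector_derivative_def] this]
    have "((snd C' \<circ> \<gamma>) has_derivative (\<lambda>x. coord_jacobian C C' (\<gamma> 0) (x *\<^sub>R w))) (at 0)"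
      by (rule has_derivative_transform_within_open[OF _ near(1,2)])
        (use near(3) CN coord_change_chart in auto)
    then have "((snd C' \<circ> \<gamma>) has_vector_derivative coord_jacobian C C' (\<gamma> 0) w) (at 0)"
      by (simp add: has_vector_derivative_def linear_cmul[OF coord_jacobian_linear[OF C True]])
    then show ?thesis
      using True by (simp add: velocity_def coord_vec_apply vector_derivative_at)
  qed (simp add: velocity_def coord_vec_def)
qed

text \<open>The chart around \<open>p\<close> can be chosen to suit \<open>f\<close>, because coordinate changes carry smoothness over to
  all other charts.\<close>

lemma smooth_funI_local:
  assumes "\<And>p. p \<in> W \<Longrightarrow> p \<in> points N \<Longrightarrow> \<exists>C G. chart_at N p C \<and> open G \<and> snd C p \<in> G \<and>
    G \<subseteq> snd C ` fst C \<and> smooth_on G (f \<circ> chart_inv C)"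
  shows "smooth_fun N W f"
  unfolding smooth_fun_def
proof (clarify)
  fix U c assume "(U, c) \<in> N"
  define C' where "C' = (U, c)"
  have C': "C' \<in> N" using \<open>(U, c) \<in> N\<close> by (simp add: C'_def)
  have "smooth_on (snd C' ` (fst C' \<inter> W)) (f \<circ> chart_inv C')"
  proof (rule smooth_on_local)
    fix x assume "x \<in> snd C' ` (fst C' \<inter> W)"
    then obtain p where p: "p \<in> fst C'" "p \<in> W" "x = snd C' p" by auto
    then have "p \<in> points N" using C' by (auto simp: points_def)
    from assms[OF p(2) this] obtain C G where C: "chart_at N p C" and G: "open G" "snd C p \<in> G"
      "G \<subseteq> snd C ` fst C" and s: "smooth_on G (f \<circ> chart_inv C)" by blast
    have CN: "C \<in> N" "p \<in> fst C" using C by (auto simp: chart_at_def)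
    let ?S = "snd C' ` (fst C' \<inter> fst C)"
    let ?V = "?S \<inter> coord_change C' C -` G"
    have sm: "smooth_on ?S (coord_change C' C)" by (rule coord_change_smooth[OF C' CN(1)])
    have op: "open ?V"
      by (rule continuous_open_preimage[OF smooth_on_imp_continuous_on[OF sm] overlap_open[OF C' CN(1)] G(1)])
    have "smooth_on ?V (\<lambda>y. (f \<circ> chart_inv C) (coord_change C' C y))"
      by (rule smooth_on_compose[OF op G(1) _ smooth_on_subset[OF sm] s]) auto
    then have "smooth_on ?V (f \<circ> chart_inv C')"
      by (rule smooth_on_cong[OF op, rotated]) (use C' CN in \<open>auto simp: coord_change_chart\<close>)
    moreover have "x \<in> ?V"
      using p CN C' G by (auto simp: coord_change_chart)
    ultimately show "\<exists>V. open V \<and> x \<in> V \<and> smooth_on V (f \<circ> chart_inv C')"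
      using op by blast
  qed
  then show "smooth_on (c ` (U \<inter> W)) (f \<circ> inv_into U c)" by (simp add: C'_def chart_inv_def)
qed

lemma mopen_iff: "mopen N W \<longleftrightarrow> W \<subseteq> points N \<and> (\<forall>C\<in>N. open (snd C ` (fst C \<inter> W)))"
  unfolding mopen_def by (simp add: case_prod_beta)

lemma mopen_Int: "mopen N W \<Longrightarrow> mopen N W' \<Longrightarrow> mopen N (W \<inter> W')"
proof -
  assume W: "mopen N W" "mopen N W'"
  have "snd C ` (fst C \<inter> (W \<inter> W')) = snd C ` (fst C \<inter> W) \<inter> snd C ` (fst C \<inter> W')" if "C \<in> N" for C
    using chart_inj[OF that] by (auto simp: inj_on_def)
  with W show ?thesis unfolding mopen_iff by auto
qed

lemma istopology_mopen: "istopology (mopen N)"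
  unfolding istopology_def
proof (intro conjI allI impI)
  fix K assume K: "\<forall>k\<in>K. mopen N k"
  have "c ` (U \<inter> \<Union> K) = (\<Union>k\<in>K. c ` (U \<inter> k))" for U :: "'a set" and c :: "'a \<Rightarrow> 'e" by auto
  then show "mopen N (\<Union> K)" using K unfolding mopen_def by fastforce
qed (rule mopen_Int)

lemma openin_mopen [simp]: "openin (topology (mopen N)) = mopen N"
  by (rule topology_inverse'[OF istopology_mopen])

lemma mopen_chart_preimage:
  assumes C: "C \<in> N" and G: "open G"
  shows "mopen N {p \<in> fst C. snd C p \<in> G}"
  unfolding mopen_def
proof (intro conjI, goal_cases)
  case 2
  show ?case
  proof clarify
    fix U c assume "(U, c) \<in> N"
    define C' where "C' = (U, c)"
    have C': "C' \<in> N" using \<open>(U, c) \<in> N\<close> by (simp add: C'_def)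
    have "snd C' ` (fst C' \<inter> {p \<in> fst C. snd C p \<in> G}) =
        snd C' ` (fst C' \<inter> fst C) \<inter> coord_change C' C -` G"
      using C' C by (auto simp: coord_change_chart)
    moreover have "open \<dots>"
      by (rule continuous_open_preimage[OF smooth_on_imp_continuous_on[OF coord_change_smooth[OF C' C]]
            overlap_open[OF C' C] G])
    ultimately show "open (c ` (U \<inter> {p \<in> fst C. snd C p \<in> G}))" by (simp add: C'_def)
  qed
qed (use C in \<open>auto simp: points_def\<close>)

lemma mopen_domain: "C \<in> N \<Longrightarrow> mopen N (fst C)"
  using mopen_chart_preimage[of C UNIV] by simp

lemma topspace_mopen: "topspace (topology (mopen N)) = points N"
proof -
  have "mopen N (points N)"
  proof -
    have "points N = \<Union> (fst ` N)" by (simp add: points_def)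
    moreover have "openin (topology (mopen N)) (\<Union> (fst ` N))"
      by (rule openin_Union) (use mopen_domain in auto)
    ultimately show ?thesis by simp
  qed
  then show ?thesis
    by (metis mopen_def openin_mopen openin_subset openin_topspace subset_antisym)
qed

lemma mopen_open_image: "mopen N W \<Longrightarrow> C \<in> N \<Longrightarrow> open (snd C ` (fst C \<inter> W))"
  unfolding mopen_def by fastforce

lemma smooth_funD: "smooth_fun N W f \<Longrightarrow> C \<in> N \<Longrightarrow> smooth_on (snd C ` (fst C \<inter> W)) (f \<circ> chart_inv C)"
  unfolding smooth_fun_def chart_inv_def by fastforce

lemma smooth_fun_cong:
  assumes "mopen N W" "\<And>p. p \<in> W \<Longrightarrow> f p = g p" "smooth_fun N W f"
  shows "smooth_fun N W g"
  unfolding smooth_fun_def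
proof clarify
  fix U c assume C: "(U, c) \<in> N"
  show "smooth_on (c ` (U \<inter> W)) (g \<circ> inv_into U c)"
  proof (rule smooth_on_cong)
    show "open (c ` (U \<inter> W))" using mopen_open_image[OF assms(1) C] by simp
    show "smooth_on (c ` (U \<inter> W)) (f \<circ> inv_into U c)" using assms(3) C by (auto simp: smooth_fun_def)
    show "(f \<circ> inv_into U c) x = (g \<circ> inv_into U c) x" if "x \<in> c ` (U \<inter> W)" for x
      using that chart_inj[OF C] assms(2) by auto
  qed
qed

lemma smooth_tangent_sectionI:
  assumes "\<And>p. p \<in> W \<Longrightarrow> s p \<in> tangent_space N p" "\<And>C. C \<in> N \<Longrightarrow> smooth_fun N (fst C \<inter> W) (\<lambda>p. s p C)"
  shows "smooth_section N (tangent_frames N) W s"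
  unfolding smooth_section_def
proof clarify
  fix U t assume "(U, t) \<in> tangent_frames N"
  then obtain C where C: "C \<in> N" "U = fst C" "t = coord_vec N C"
    unfolding tangent_frames_def by blast
  have "s p = t p (s p C)" if "p \<in> U \<inter> W" for p
    using coord_vec_eq[OF assms(1)] that C by (simp add: chart_at_def)
  then show "\<exists>c. smooth_fun N (U \<inter> W) c \<and> (\<forall>p\<in>U \<inter> W. s p = t p (c p))"
    using assms(2)[OF C(1)] C(2) by blast
qed

lemma smooth_tangent_sectionD:
  assumes "smooth_section N (tangent_frames N) W s" "C \<in> N" "mopen N W"
  shows "smooth_fun N (fst C \<inter> W) (\<lambda>p. s p C)"
proof -
  obtain c where c: "smooth_fun N (fst C \<inter> W) c" "\<forall>p\<in>fst C \<inter> W. s p = coord_vec N C p (c p)"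
    using bspec[OF assms(1)[unfolded smooth_section_def], of "(fst C, coord_vec N C)", simplified] assms(2)
    unfolding tangent_frames_def by blast
  show ?thesis
    by (rule smooth_fun_cong[OF mopen_Int[OF mopen_domain[OF assms(2)] assms(3)] _ c(1)])
      (use c(2) assms(2) in \<open>auto simp: chart_at_def\<close>)
qed

end

section \<open>Independent families\<close>

lemma sum_fun_apply: "(\<Sum>i\<in>I. f i) x = (\<Sum>i\<in>I. f i x)"
  by (induction I rule: infinite_finite_induct) auto

lemma scaleR_fun_apply: "(r *\<^sub>R f) x = r *\<^sub>R f x"
  by (simp add: scaleR_fun_def)

text \<open>\<^const>\<open>representation\<close> refers to bases as sets, while frames and dual bases are indexed; for an
  independent family the index can be recovered from the member.\<close>

definition indep_family :: "'i set \<Rightarrow> ('i \<Rightarrow> 'a::real_vector) \<Rightarrow> bool" where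
  "indep_family I f \<longleftrightarrow> (\<forall>c. (\<Sum>i\<in>I. c i *\<^sub>R f i) = 0 \<longrightarrow> (\<forall>i\<in>I. c i = (0::real)))"

lemma indep_family_inj_on:
  assumes "finite I" "indep_family I f"
  shows "inj_on f I"
proof (rule inj_onI, rule ccontr)
  fix i j assume ij: "i \<in> I" "j \<in> I" "f i = f j" "i \<noteq> j"
  define c where "c l = (if l = i then 1 else if l = j then -1 else (0::real))" for l
  have "(\<Sum>l\<in>I. c l *\<^sub>R f l) = (\<Sum>l\<in>{i, j}. c l *\<^sub>R f l)"
    using assms(1) ij by (intro sum.mono_neutral_right) (auto simp: c_def)
  also have "\<dots> = 0" using ij by (simp add: c_def)
  finally have "c i = 0" using assms(2) ij(1) unfolding indep_family_def by blast
  then show False by (simp add: c_def)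
qed

lemma indep_family_independent:
  assumes "finite I" "indep_family I f"
  shows "independent (f ` I)"
proof -
  note inj = indep_family_inj_on[OF assms]
  show ?thesis
    unfolding independent_explicit_finite_subsets
  proof (intro allI impI ballI)
    fix A u v assume A: "A \<subseteq> f ` I" and "finite A" "(\<Sum>v\<in>A. u v *\<^sub>R v) = 0" and v: "v \<in> A"
    define c where "c i = (if f i \<in> A then u (f i) else 0)" for i
    have "(\<Sum>i\<in>I. c i *\<^sub>R f i) = (\<Sum>w\<in>f ` I. (if w \<in> A then u w else 0) *\<^sub>R w)"
      by (simp add: sum.reindex[OF inj] c_def)
    also have "\<dots> = (\<Sum>w\<in>A. u w *\<^sub>R w)"
      using A assms(1) by (intro sum.mono_neutral_cong_right) auto
    finally have "\<forall>i\<in>I. c i = 0"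
      using assms(2) \<open>(\<Sum>v\<in>A. u v *\<^sub>R v) = 0\<close> unfolding indep_family_def by metis
    then show "u v = 0" using v A by (force simp: c_def)
  qed
qed

lemma indep_family_representation:
  assumes "finite I" "indep_family I f" "i \<in> I"
  shows "representation (f ` I) (\<Sum>i\<in>I. c i *\<^sub>R f i) (f i) = c i"
proof -
  note inj = indep_family_inj_on[OF assms(1,2)]
  define u where "u w = (if w \<in> f ` I then c (inv_into I f w) else 0)" for w
  have "representation (f ` I) (\<Sum>i\<in>I. c i *\<^sub>R f i) = u"
  proof (rule representation_eqI[OF indep_family_independent[OF assms(1,2)]])
    show "(\<Sum>i\<in>I. c i *\<^sub>R f i) \<in> span (f ` I)"
      by (intro span_sum span_scale span_base) auto
    have fin: "{b. u b \<noteq> 0} \<subseteq> f ` I" by (auto simp: u_def)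
    then show "finite {b. u b \<noteq> 0}" using assms(1) finite_subset by blast
    have "(\<Sum>b | u b \<noteq> 0. u b *\<^sub>R b) = (\<Sum>b\<in>f ` I. u b *\<^sub>R b)"
      using fin assms(1) by (intro sum.mono_neutral_left) auto
    also have "\<dots> = (\<Sum>i\<in>I. c i *\<^sub>R f i)"
      by (simp add: sum.reindex[OF inj] u_def inj)
    finally show "(\<Sum>b | u b \<noteq> 0. u b *\<^sub>R b) = (\<Sum>i\<in>I. c i *\<^sub>R f i)" .
    show "b \<in> f ` I" if "u b \<noteq> 0" for b
      using that by (simp add: u_def split: if_splits)
  qed
  then show ?thesis using assms(3) inj by (simp add: u_def)
qed

lemma sum_representation_family:
  assumes "finite I" "indep_family I f" "v \<in> span (f ` I)"
  shows "(\<Sum>i\<in>I. representation (f ` I) v (f i) *\<^sub>R f i) = v"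
proof -
  have "(\<Sum>w\<in>f ` I. representation (f ` I) v w *\<^sub>R w) = v"
    by (rule sum_representation_eq[OF indep_family_independent[OF assms(1,2)] assms(3)])
      (use assms(1) in auto)
  then show ?thesis by (simp add: sum.reindex[OF indep_family_inj_on[OF assms(1,2)]])
qed

lemma span_family_iff:
  "finite I \<Longrightarrow> v \<in> span (f ` I) \<longleftrightarrow> (\<exists>c. v = (\<Sum>i\<in>I. c i *\<^sub>R f i))"
proof
  assume I: "finite I" and v: "v \<in> span (f ` I)"
  have "\<exists>c. v = (\<Sum>i\<in>I. c i *\<^sub>R f i)"
    using v
  proof (induction rule: span_induct_alt)
    case base
    show ?case by (rule exI[of _ "\<lambda>_. 0"]) simp
  next
    case (step r x y)
    then obtain j c where j: "j \<in> I" "x = f j" and y: "y = (\<Sum>i\<in>I. c i *\<^sub>R f i)" by auto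
    have "r *\<^sub>R x + y = (\<Sum>i\<in>I. (c i + (if i = j then r else 0)) *\<^sub>R f i)"
      using j I by (simp add: y scaleR_add_left sum.distrib if_distrib[of "\<lambda>r. r *\<^sub>R _"] cong: if_cong)
    then show ?case by (intro exI[of _ "\<lambda>i. c i + (if i = j then r else 0)"]) simp
  qed
  then show "\<exists>c. v = (\<Sum>i\<in>I. c i *\<^sub>R f i)" .
next
  assume "\<exists>c. v = (\<Sum>i\<in>I. c i *\<^sub>R f i)"
  then obtain c where "v = (\<Sum>i\<in>I. c i *\<^sub>R f i)" ..
  then show "v \<in> span (f ` I)"
    by (simp only:) (intro span_sum span_scale span_base imageI)
qed

text \<open>A vector of the larger span outside of \<open>span s\<close> could be added to \<open>s\<close>, giving more independent vectors
  in \<open>span t\<close> than \<open>t\<close> has members. So the bases of binary forms and the frames of tangent spaces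
  below are recognised by counting.\<close>

lemma span_eq_card:
  fixes s t :: "'a::real_vector set"
  assumes "finite t" "independent s" "s \<subseteq> span t" "card s = card t"
  shows "span s = span t"
proof (rule subset_antisym)
  show "span s \<subseteq> span t" using assms(3) by (rule span_minimal) (rule subspace_span)
  have fin: "finite s" using independent_span_bound[OF assms(1-3)] by blast
  have "x \<in> span s" if "x \<in> t" for x
  proof (rule ccontr)
    assume x: "x \<notin> span s"
    then have "x \<notin> s" using span_base by blast
    moreover have "independent (insert x s)" using x assms(2) by (rule independent_insertI)
    moreover have "insert x s \<subseteq> span t" using assms(3) that span_base by blast
    ultimately have "card s + 1 \<le> card t"
      using independent_span_bound[OF assms(1), of "insert x s"] fin by simp
    then show False using assms(4) by simp
  qed
  then have "t \<subseteq> span s" by blast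
  then show "span t \<subseteq> span s" by (rule span_minimal) (rule subspace_span)
qed

section \<open>Binary forms\<close>

abbreviation forms :: "nat \<Rightarrow> (real \<Rightarrow> real \<Rightarrow> real) set" where
  "forms k \<equiv> span (mono_xy k ` {..k})"

lemma indep_mono_xy: "indep_family {..k} (mono_xy k)"
  unfolding indep_family_def
proof (intro allI impI)
  fix c :: "nat \<Rightarrow> real" assume "(\<Sum>i\<le>k. c i *\<^sub>R mono_xy k i) = 0"
  then have "(\<Sum>i\<le>k. c i *\<^sub>R mono_xy k i) 1 y = 0" for y :: real
    by (simp only: zero_fun_apply)
  then have "(\<Sum>i\<le>k. c i * y ^ i) = 0" for y
    by (simp add: sum_fun_apply scaleR_fun_apply) (simp add: mono_xy_def)
  then show "\<forall>i\<in>{..k}. c i = 0" using polyfun_eq_0[of c k] by auto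
qed

lemma forms_iff: "P \<in> forms k \<longleftrightarrow> (\<exists>c. P = (\<Sum>i\<le>k. c i *\<^sub>R mono_xy k i))"
  by (rule span_family_iff) simp

text \<open>The coefficients of a binary form after multiplication by the linear form \<open>\<alpha> x + \<beta> y\<close>.\<close>

definition mult_linear_coeff :: "nat \<Rightarrow> 'f::real_normed_field \<Rightarrow> 'f \<Rightarrow> (nat \<Rightarrow> 'f) \<Rightarrow> nat \<Rightarrow> 'f" where
  "mult_linear_coeff n \<alpha> \<beta> a i = \<alpha> * (if i \<le> n then a i else 0) + \<beta> * (if i = 0 then 0 else a (i - 1))"

lemma mult_linear_form:
  "(x *\<^sub>R \<alpha> + y *\<^sub>R \<beta>) * (\<Sum>i\<le>n. mono_xy n i x y *\<^sub>R a i) =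
   (\<Sum>i\<le>Suc n. mono_xy (Suc n) i x y *\<^sub>R mult_linear_coeff n \<alpha> \<beta> a i)"
proof -
  have "(\<Sum>i\<le>Suc n. mono_xy (Suc n) i x y *\<^sub>R mult_linear_coeff n \<alpha> \<beta> a i) =
    (\<Sum>i\<le>Suc n. mono_xy (Suc n) i x y *\<^sub>R (\<alpha> * (if i \<le> n then a i else 0))) +
    (\<Sum>i\<le>Suc n. mono_xy (Suc n) i x y *\<^sub>R (\<beta> * (if i = 0 then 0 else a (i - 1))))"
    by (simp only: mult_linear_coeff_def scaleR_add_right sum.distrib)
  also have "(\<Sum>i\<le>Suc n. mono_xy (Suc n) i x y *\<^sub>R (\<alpha> * (if i \<le> n then a i else 0))) =
      (\<Sum>i\<le>n. (x * mono_xy n i x y) *\<^sub>R (\<alpha> * a i))"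
    by (simp add: mono_xy_def Suc_diff_le mult.assoc)
  also have "(\<Sum>i\<le>Suc n. mono_xy (Suc n) i x y *\<^sub>R (\<beta> * (if i = 0 then 0 else a (i - 1)))) =
      (\<Sum>i\<le>n. (y * mono_xy n i x y) *\<^sub>R (\<beta> * a i))"
    by (subst sum.atMost_Suc_shift) (simp add: mono_xy_def mult.left_commute)
  finally show ?thesis
    by (simp add: distrib_right distrib_left sum_distrib_left scaleR_add_right sum.distrib mult.commute
        del: sum.atMost_Suc)
qed

text \<open>Multiplication by a linear form acts on coefficients by sums and products, hence preserves
  their smooth dependence on a parameter. Over the reals this will give the smoothness of \<open>\<rho>\<^sub>k\<close>, over the
  complex numbers (with a constant family) the expansion of \<open>V_cplx\<close> into monomials.\<close>

lemma power_product_coefficients: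
  fixes \<alpha> \<beta> \<gamma> \<delta> :: "'s::euclidean_space \<Rightarrow> 'f::real_normed_field"
  assumes S: "open S" and "smooth_on S \<alpha>" "smooth_on S \<beta>" "smooth_on S \<gamma>" "smooth_on S \<delta>"
  shows "\<exists>a. (\<forall>i. smooth_on S (\<lambda>s. a s i)) \<and>
    (\<forall>s x y. (x *\<^sub>R \<alpha> s + y *\<^sub>R \<beta> s) ^ p * (x *\<^sub>R \<gamma> s + y *\<^sub>R \<delta> s) ^ q =
      (\<Sum>i\<le>p + q. mono_xy (p + q) i x y *\<^sub>R a s i))"
proof -
  have mult: "smooth_on S (\<lambda>s. mult_linear_coeff n (\<alpha> s) (\<beta> s) (a s) i)"
    if "smooth_on S \<alpha>" "smooth_on S \<beta>" "\<forall>i. smooth_on S (\<lambda>s. a s i)" for n \<alpha> \<beta> i and a :: "'s \<Rightarrow> nat \<Rightarrow> 'f"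
    unfolding mult_linear_coeff_def using S that
    by (cases "i \<le> n"; cases "i = 0") (auto intro!: smooth_intros)
  have q: "\<exists>a. (\<forall>i. smooth_on S (\<lambda>s. a s i)) \<and>
    (\<forall>s x y. (x *\<^sub>R \<gamma> s + y *\<^sub>R \<delta> s) ^ q = (\<Sum>i\<le>q. mono_xy q i x y *\<^sub>R a s i))"
  proof (induction q)
    case 0
    show ?case
      by (rule exI[of _ "\<lambda>_ _. 1"]) (simp add: mono_xy_def smooth_on_const[OF S])
  next
    case (Suc q)
    then obtain a where "\<forall>i. smooth_on S (\<lambda>s. a s i)"
      "\<forall>s x y. (x *\<^sub>R \<gamma> s + y *\<^sub>R \<delta> s) ^ q = (\<Sum>i\<le>q. mono_xy q i x y *\<^sub>R a s i)" by blast
    then show ?case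
      using mult[OF assms(4,5)]
      by (intro exI[of _ "\<lambda>s. mult_linear_coeff q (\<gamma> s) (\<delta> s) (a s)"])
        (simp only: mult_linear_form[symmetric] power_Suc, blast)
  qed
  show ?thesis
  proof (induction p)
    case 0
    show ?case using q by simp
  next
    case (Suc p)
    then obtain a where "\<forall>i. smooth_on S (\<lambda>s. a s i)"
      "\<forall>s x y. (x *\<^sub>R \<alpha> s + y *\<^sub>R \<beta> s) ^ p * (x *\<^sub>R \<gamma> s + y *\<^sub>R \<delta> s) ^ q =
        (\<Sum>i\<le>p + q. mono_xy (p + q) i x y *\<^sub>R a s i)" by blast
    then show ?case
      using mult[OF assms(2,3)]
      by (intro exI[of _ "\<lambda>s. mult_linear_coeff (p + q) (\<alpha> s) (\<beta> s) (a s)"])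
        (simp only: add_Suc mult_linear_form[symmetric] power_Suc mult.assoc, blast)
  qed
qed

subsection \<open>The representation on binary forms\<close>

lemma poly_act_sum: "poly_act (\<Sum>i\<in>I. c i *\<^sub>R P i) g = (\<Sum>i\<in>I. c i *\<^sub>R poly_act (P i) g)"
  by (simp add: poly_act_def fun_eq_iff sum_fun_apply scaleR_fun_apply)

text \<open>\<open>g\<close> acts on the arguments \<open>(x, y)\<close> before \<open>h\<close>; this order makes \<open>\<rho>\<^sub>k\<close> multiplicative.\<close>

lemma poly_act_mult: "poly_act (poly_act P h) g = poly_act P (g ** h)"
  by (simp add: poly_act_def fun_eq_iff matrix_matrix_mult_def sum_2 algebra_simps)

lemma poly_act_mat_1 [simp]: "poly_act P (mat 1) = P"
  by (simp add: poly_act_def mat_def)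

lemma poly_act_mono_smooth:
  assumes "j \<le> k"
  obtains a where "\<And>i. smooth_on UNIV (\<lambda>g. a g i)"
    "\<And>g. poly_act (mono_xy k j) g = (\<Sum>i\<le>k. a g i *\<^sub>R mono_xy k i)"
proof -
  have sm: "smooth_on UNIV (\<lambda>g::real^2^2. g$r$s)" for r s
  proof -
    have "bounded_linear (\<lambda>g::real^2^2. g$r$s)"
      using bounded_linear_compose[OF bounded_linear_vec_nth bounded_linear_vec_nth] .
    then show ?thesis
      by (rule smooth_on_bounded_linear[OF open_UNIV _ smooth_on_ident[OF open_UNIV]])
  qed
  obtain a where a: "\<forall>i. smooth_on UNIV (\<lambda>g::real^2^2. a g i)"
    "\<And>g x y. (x *\<^sub>R g$1$1 + y *\<^sub>R g$2$1) ^ (k - j) * (x *\<^sub>R g$1$2 + y *\<^sub>R g$2$2) ^ j =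
      (\<Sum>i\<le>(k - j) + j. mono_xy ((k - j) + j) i x y *\<^sub>R (a g i :: real))"
    using power_product_coefficients[OF open_UNIV sm sm sm sm, of 1 1 2 1 "k - j" 1 2 2 2 j] by blast
  show ?thesis
  proof (rule that)
    show "smooth_on UNIV (\<lambda>g. a g i)" for i using a(1) by blast
    show "poly_act (mono_xy k j) g = (\<Sum>i\<le>k. a g i *\<^sub>R mono_xy k i)" for g
      using a(2)[of _ g] assms
      by (simp add: fun_eq_iff sum_fun_apply scaleR_fun_apply poly_act_def mono_xy_def mult.commute)
  qed
qed

lemma poly_act_mono:
  assumes "j \<le> k"
  shows "poly_act (mono_xy k j) g = (\<Sum>i\<le>k. rho k g i j *\<^sub>R mono_xy k i)"
proof -
  have "poly_act (mono_xy k j) g \<in> forms k"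
    using poly_act_mono_smooth[OF assms] unfolding forms_iff by metis
  then show ?thesis
    unfolding rho_def by (rule sum_representation_family[OF finite_atMost indep_mono_xy, symmetric])
qed

lemma rho_eqI:
  assumes "j \<le> k" "poly_act (mono_xy k j) g = (\<Sum>i\<le>k. c i *\<^sub>R mono_xy k i)" "i \<le> k"
  shows "rho k g i j = c i"
  unfolding rho_def assms(2)
  by (rule indep_family_representation[OF finite_atMost indep_mono_xy]) (use assms in auto)

lemma smooth_rho:
  assumes "i \<le> k" "j \<le> k"
  shows "smooth_on UNIV (\<lambda>g. rho k g i j)"
proof -
  obtain a where a: "\<And>i. smooth_on UNIV (\<lambda>g. a g i)"
    "\<And>g. poly_act (mono_xy k j) g = (\<Sum>i\<le>k. a g i *\<^sub>R mono_xy k i)"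
    using poly_act_mono_smooth[OF assms(2)] by blast
  then have "rho k g i j = a g i" for g
    using rho_eqI assms by blast
  with a(1) show ?thesis by simp
qed

lemma poly_act_form:
  "poly_act (\<Sum>j\<le>k. c j *\<^sub>R mono_xy k j) g = (\<Sum>i\<le>k. (\<Sum>j\<le>k. rho k g i j * c j) *\<^sub>R mono_xy k i)"
proof -
  have "poly_act (\<Sum>j\<le>k. c j *\<^sub>R mono_xy k j) g = (\<Sum>j\<le>k. c j *\<^sub>R (\<Sum>i\<le>k. rho k g i j *\<^sub>R mono_xy k i))"
    unfolding poly_act_sum by (intro sum.cong) (auto simp: poly_act_mono)
  also have "\<dots> = (\<Sum>j\<le>k. \<Sum>i\<le>k. (rho k g i j * c j) *\<^sub>R mono_xy k i)"
    by (simp add: scaleR_sum_right mult.commute)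
  also have "\<dots> = (\<Sum>i\<le>k. (\<Sum>j\<le>k. rho k g i j * c j) *\<^sub>R mono_xy k i)"
    by (subst sum.swap) (simp add: scaleR_sum_left)
  finally show ?thesis .
qed

lemma rho_mult:
  assumes "i \<le> k" "j \<le> k"
  shows "rho k (g ** h) i j = (\<Sum>l\<le>k. rho k g i l * rho k h l j)"
  by (rule rho_eqI[OF assms(2) _ assms(1)])
    (simp add: poly_act_mult[symmetric] poly_act_mono[OF assms(2), of h] poly_act_form)

lemma rho_first_column:
  assumes "i \<le> k" shows "rho k g i 0 = (k choose i) * g$1$1 ^ (k - i) * g$2$1 ^ i"
proof (rule rho_eqI[OF _ _ assms])
  show "poly_act (mono_xy k 0) g =
      (\<Sum>i\<le>k. ((k choose i) * g$1$1 ^ (k - i) * g$2$1 ^ i) *\<^sub>R mono_xy k i)"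
  proof (intro ext)
    fix x y
    have "poly_act (mono_xy k 0) g x y = (y * g$2$1 + x * g$1$1) ^ k"
      by (simp add: poly_act_def mono_xy_def add.commute)
    also have "\<dots> = (\<Sum>i\<le>k. (k choose i) * (y * g$2$1) ^ i * (x * g$1$1) ^ (k - i))"
      by (rule binomial_ring)
    finally show "poly_act (mono_xy k 0) g x y =
      (\<Sum>i\<le>k. ((k choose i) * g$1$1 ^ (k - i) * g$2$1 ^ i) *\<^sub>R mono_xy k i) x y"
      by (simp add: sum_fun_apply scaleR_fun_apply mono_xy_def power_mult_distrib mult_ac)
  qed
qed simp

lemma rho_last_column:
  assumes "i \<le> k" shows "rho k g i k = (k choose i) * g$1$2 ^ (k - i) * g$2$2 ^ i"
proof (rule rho_eqI[OF _ _ assms])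
  show "poly_act (mono_xy k k) g =
      (\<Sum>i\<le>k. ((k choose i) * g$1$2 ^ (k - i) * g$2$2 ^ i) *\<^sub>R mono_xy k i)"
  proof (intro ext)
    fix x y
    have "poly_act (mono_xy k k) g x y = (y * g$2$2 + x * g$1$2) ^ k"
      by (simp add: poly_act_def mono_xy_def add.commute)
    also have "\<dots> = (\<Sum>i\<le>k. (k choose i) * (y * g$2$2) ^ i * (x * g$1$2) ^ (k - i))"
      by (rule binomial_ring)
    finally show "poly_act (mono_xy k k) g x y =
      (\<Sum>i\<le>k. ((k choose i) * g$1$2 ^ (k - i) * g$2$2 ^ i) *\<^sub>R mono_xy k i) x y"
      by (simp add: sum_fun_apply scaleR_fun_apply mono_xy_def power_mult_distrib mult_ac)
  qed
qed simp

lemma drho_has_derivative: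
  assumes "i \<le> k" "j \<le> k"
  shows "((\<lambda>t. rho k (mat 1 + t *\<^sub>R X) i j) has_real_derivative drho k X i j) (at 0)"
proof -
  have "((\<lambda>t::real. mat 1 + t *\<^sub>R X) has_derivative (\<lambda>t. 0 + t *\<^sub>R X)) (at 0)"
    by (intro derivative_intros)
  moreover have "((\<lambda>g. rho k g i j) has_derivative frechet_derivative (\<lambda>g. rho k g i j) (at (mat 1 + 0 *\<^sub>R X)))
      (at (mat 1 + 0 *\<^sub>R X))"
    by (rule smooth_on_has_derivative[OF smooth_rho[OF assms]]) simp
  ultimately have "(\<lambda>t. rho k (mat 1 + t *\<^sub>R X) i j) differentiable (at 0)"
    using has_derivative_compose unfolding differentiable_def by blast
  then show ?thesis
    unfolding drho_def by (simp add: DERIV_deriv_iff_real_differentiable)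
qed

lemma drho_eqI:
  assumes "i \<le> k" "j \<le> k" "((\<lambda>t. rho k (mat 1 + t *\<^sub>R X) i j) has_real_derivative c) (at 0)"
  shows "drho k X i j = c"
  using DERIV_unique[OF drho_has_derivative[OF assms(1,2)] assms(3)] .

text \<open>The first and the last column of \<open>\<rho>\<^sub>k(g)\<close> are binomial expansions of \<open>k\<close>-th powers; their derivatives at
  the unit matrix contain \<open>k\<close> times each entry of \<open>X\<close>.\<close>

lemma drho_inj:
  assumes k: "k \<ge> 1" and eq: "\<And>i j. i \<le> k \<Longrightarrow> j \<le> k \<Longrightarrow> drho k X i j = drho k Y i j"
  shows "X = Y"
proof -
  have 1: "drho k X 0 0 = k * X$1$1" for X
  proof (rule drho_eqI)
    have "((\<lambda>t. (1 + t * X$1$1) ^ k) has_real_derivative k * X$1$1) (at 0)"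
      by (auto intro!: derivative_eq_intros)
    then show "((\<lambda>t. rho k (mat 1 + t *\<^sub>R X) 0 0) has_real_derivative k * X$1$1) (at 0)"
      by (simp add: rho_first_column mat_def)
  qed simp_all
  have 2: "drho k X 1 0 = k * X$2$1" for X
  proof (rule drho_eqI)
    have "((\<lambda>t. k * (1 + t * X$1$1) ^ (k - 1) * (t * X$2$1)) has_real_derivative k * X$2$1) (at 0)"
      by (auto intro!: derivative_eq_intros)
    then show "((\<lambda>t. rho k (mat 1 + t *\<^sub>R X) 1 0) has_real_derivative k * X$2$1) (at 0)"
      using k by (simp add: rho_first_column mat_def)
  qed (use k in simp_all)
  have 3: "drho k X (k - 1) k = k * X$1$2" for X
  proof (rule drho_eqI)
    have "((\<lambda>t. k * (t * X$1$2) * (1 + t * X$2$2) ^ (k - 1)) has_real_derivative k * X$1$2) (at 0)"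
      by (auto intro!: derivative_eq_intros)
    then show "((\<lambda>t. rho k (mat 1 + t *\<^sub>R X) (k - 1) k) has_real_derivative k * X$1$2) (at 0)"
      using k binomial_symmetric[of "k - 1" k] by (simp add: rho_last_column mat_def)
  qed (use k in simp_all)
  have 4: "drho k X k k = k * X$2$2" for X
  proof (rule drho_eqI)
    have "((\<lambda>t. (1 + t * X$2$2) ^ k) has_real_derivative k * X$2$2) (at 0)"
      by (auto intro!: derivative_eq_intros)
    then show "((\<lambda>t. rho k (mat 1 + t *\<^sub>R X) k k) has_real_derivative k * X$2$2) (at 0)"
      by (simp add: rho_last_column mat_def)
  qed simp_all
  show ?thesis
    using k eq[of 0 0] eq[of 1 0] eq[of "k - 1" k] eq[of k k] unfolding 1 2 3 4
    by (simp add: vec_eq_iff forall_2)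
qed

text \<open>The curve \<open>1 + t h X g\<close> is \<open>h (1 + t X) g\<close>.\<close>

lemma drho_conjugate:
  assumes "i \<le> k" "j \<le> k" and gh: "h ** g = mat 1"
  shows "drho k (h ** X ** g) i j = nmat_mult k (rho k h) (nmat_mult k (drho k X) (rho k g)) i j"
proof (rule drho_eqI[OF assms(1,2)])
  have "mat 1 + t *\<^sub>R (h ** X ** g) = h ** ((mat 1 + t *\<^sub>R X) ** g)" for t :: real
  proof -
    have "h ** ((mat 1 + t *\<^sub>R X) ** g) = h ** g + t *\<^sub>R (h ** X ** g)"
      by (simp add: matrix_matrix_mult_def vec_eq_iff sum_2 forall_2 mat_def algebra_simps)
    then show ?thesis by (simp add: gh)
  qed
  then have eq: "rho k (mat 1 + t *\<^sub>R (h ** X ** g)) i j =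
      (\<Sum>l\<le>k. rho k h i l * (\<Sum>m\<le>k. rho k (mat 1 + t *\<^sub>R X) l m * rho k g m j))" for t
    using assms by (simp add: rho_mult)
  show "((\<lambda>t. rho k (mat 1 + t *\<^sub>R (h ** X ** g)) i j) has_real_derivative
      nmat_mult k (rho k h) (nmat_mult k (drho k X) (rho k g)) i j) (at 0)"
    unfolding eq nmat_mult_def
    by (intro DERIV_sum DERIV_cmult DERIV_cmult_right drho_has_derivative) auto
qed

subsection \<open>The basis adapted to conformal matrices\<close>

text \<open>The binary form with \<open>\<xi>\<^bsup>k,j\<^esup>\<close>-coordinates \<open>c j\<close>: the conjugate turns the complex number \<open>c j\<close> into the
  pair of coefficients of the real and the imaginary part of \<open>V_cplx k j\<close>.\<close>

definition form_of_xi :: "nat \<Rightarrow> (nat \<Rightarrow> complex) \<Rightarrow> real \<Rightarrow> real \<Rightarrow> real" where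
  "form_of_xi k c = (\<lambda>x y. \<Sum>j\<le>k div 2. Re (cnj (c j) * V_cplx k j x y))"

text \<open>The second component of the index chooses between real part (\<^const>\<open>True\<close>) and imaginary part.\<close>

definition V_family :: "nat \<Rightarrow> nat \<times> bool \<Rightarrow> real \<Rightarrow> real \<Rightarrow> real" where
  "V_family k p = (if snd p then V_even k (fst p) else V_odd k (fst p))"

abbreviation V_index :: "nat \<Rightarrow> (nat \<times> bool) set" where
  "V_index k \<equiv> {..k div 2} \<times> UNIV"

lemma V_basis_eq: "V_basis k = V_family k ` V_index k"
proof -
  have "V_index k = (\<lambda>j. (j, True)) ` {..k div 2} \<union> (\<lambda>j. (j, False)) ` {..k div 2}"
    by (auto simp: UNIV_bool)
  then show ?thesis
    by (simp only: image_Un image_image) (simp add: V_basis_def V_family_def)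
qed

lemma form_of_xi_eq_sum:
  "form_of_xi k c = (\<Sum>p\<in>V_index k. (if snd p then Re (c (fst p)) else Im (c (fst p))) *\<^sub>R V_family k p)"
proof (intro ext)
  fix x y
  have "(\<Sum>p\<in>V_index k. (if snd p then Re (c (fst p)) else Im (c (fst p))) *\<^sub>R V_family k p) x y =
    (\<Sum>j\<le>k div 2. \<Sum>b\<in>UNIV. (if b then Re (c j) else Im (c j)) * V_family k (j, b) x y)"
    by (simp add: sum_fun_apply scaleR_fun_apply sum.cartesian_product case_prod_beta)
  then show "form_of_xi k c x y =
    (\<Sum>p\<in>V_index k. (if snd p then Re (c (fst p)) else Im (c (fst p))) *\<^sub>R V_family k p) x y"
    by (simp add: form_of_xi_def UNIV_bool V_family_def V_even_def V_odd_def algebra_simps)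
qed

text \<open>On the unit circle \<open>V_cplx k j\<close> is \<open>u ^ (k - 2 * j)\<close>. A vanishing combination, multiplied
  by \<open>u ^ k\<close>, is a polynomial of degree \<open>k\<close> in \<open>u\<^sup>2\<close> with infinitely many roots, in which every
  coefficient occurs on its own because \<open>k\<close> is odd.\<close>

lemma form_of_xi_eq_0:
  assumes k: "odd k" and 0: "form_of_xi k c = 0" and j: "j \<le> k div 2"
  shows "c j = 0"
proof -
  obtain m where m: "k = 2 * m + 1" using k by (rule oddE)
  have kd: "k div 2 = m" using m by simp
  define e where "e l = (if l \<le> m then c l else cnj (c (k - l)))" for l
  have root: "(\<Sum>l\<le>k. e l * v ^ l) = 0" if v: "cmod v = 1" for v
  proof -
    define u where "u = csqrt v"
    have u: "u\<^sup>2 = v" "cmod u = 1" using v by (auto simp: u_def)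
    then have cu: "u * cnj u = 1" by (metis complex_norm_square of_real_1 power_one)
    have x2: "complex_of_real (Re u) ^ 2 + complex_of_real (Im u) ^ 2 = 1"
      using u(2) by (metis cmod_power2 of_real_1 of_real_add of_real_power power_one)
    have z: "complex_of_real (Re u) + \<i> * complex_of_real (Im u) = u"
      by (simp add: complex_eq_iff)
    have V: "V_cplx k j (Re u) (Im u) = u ^ (k - 2 * j)" for j
      by (simp add: V_cplx_def x2 z)
    have "(\<Sum>j\<le>m. Re (cnj (c j) * u ^ (k - 2 * j))) = 0"
    proof -
      have "form_of_xi k c (Re u) (Im u) = 0" using 0 by (simp only: zero_fun_apply)
      then show ?thesis unfolding form_of_xi_def V kd .
    qed
    then have "complex_of_real (2 * (\<Sum>j\<le>m. Re (cnj (c j) * u ^ (k - 2 * j)))) * u ^ k = 0" by simp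
    also have "complex_of_real (2 * (\<Sum>j\<le>m. Re (cnj (c j) * u ^ (k - 2 * j)))) * u ^ k =
        (\<Sum>j\<le>m. (cnj (c j) * u ^ (k - 2 * j) + cnj (cnj (c j) * u ^ (k - 2 * j))) * u ^ k)"
      by (simp only: sum_distrib_left sum_distrib_right complex_add_cnj of_real_sum)
    also have "\<dots> = (\<Sum>j\<le>m. cnj (c j) * v ^ (k - j) + c j * v ^ j)"
    proof (rule sum.cong[OF refl])
      fix j assume "j \<in> {..m}"
      then have j: "2 * j \<le> k" using m by simp
      have "u ^ (k - 2 * j) * u ^ k = v ^ (k - j)"
      proof -
        have "(k - 2 * j) + k = 2 * (k - j)" using j by simp
        then show ?thesis by (metis power_add power_mult u(1))
      qed
      moreover have "cnj u ^ (k - 2 * j) * u ^ k = v ^ j"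
      proof -
        have "cnj u ^ (k - 2 * j) * u ^ k = (u * cnj u) ^ (k - 2 * j) * u ^ (2 * j)"
        proof -
          have "k = (k - 2 * j) + 2 * j" using j by simp
          then have "u ^ k = u ^ (k - 2 * j) * u ^ (2 * j)" by (metis power_add)
          then show ?thesis by (simp add: power_mult_distrib)
        qed
        then show ?thesis by (simp add: cu power_mult u(1))
      qed
      ultimately show "(cnj (c j) * u ^ (k - 2 * j) + cnj (cnj (c j) * u ^ (k - 2 * j))) * u ^ k =
          cnj (c j) * v ^ (k - j) + c j * v ^ j"
        by (simp add: distrib_right mult.assoc)
    qed
    also have "\<dots> = (\<Sum>l\<in>{..m}. e l * v ^ l) + (\<Sum>l\<in>{m<..k}. e l * v ^ l)"
    proof -
      have "(\<Sum>l\<in>{m<..k}. e l * v ^ l) = (\<Sum>j\<le>m. cnj (c j) * v ^ (k - j))"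
        by (rule sum.reindex_bij_witness[of _ "\<lambda>j. k - j" "\<lambda>j. k - j"]) (auto simp: m e_def)
      then show ?thesis by (simp add: sum.distrib e_def)
    qed
    also have "\<dots> = (\<Sum>l\<le>k. e l * v ^ l)"
    proof -
      have "{..k} = {..m} \<union> {m<..k}" using m by auto
      then show ?thesis by (simp only:) (subst sum.union_disjoint, auto)
    qed
    finally show ?thesis .
  qed
  have "\<forall>l\<le>k. e l = 0"
  proof (rule ccontr)
    assume "\<not> (\<forall>l\<le>k. e l = 0)"
    then have fin: "finite {v. (\<Sum>l\<le>k. e l * v ^ l) = 0}"
      using polyfun_finite_roots[of e k] by blast
    have "{v::complex. v ^ (n + 1) = 1} \<subseteq> {v. (\<Sum>l\<le>k. e l * v ^ l) = 0}" for n
    proof clarify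
      fix v :: complex assume "v ^ (n + 1) = 1"
      then have "cmod v = 1" using power_eq_1_iff by fastforce
      then show "(\<Sum>l\<le>k. e l * v ^ l) = 0" by (rule root)
    qed
    then have "n + 1 \<le> card {v. (\<Sum>l\<le>k. e l * v ^ l) = 0}" for n
      using card_mono[OF fin, of "{v. v ^ (n + 1) = 1}"] card_roots_unity_eq[of "n + 1"] by simp
    then show False by (metis Suc_eq_plus1 not_less_eq_eq order_refl)
  qed
  then have "e j = 0" using j m by auto
  then show ?thesis using j m by (simp add: e_def)
qed

lemma indep_V_family:
  assumes "odd k"
  shows "indep_family (V_index k) (V_family k)"
  unfolding indep_family_def
proof (intro allI impI ballI)
  fix a and p assume 0: "(\<Sum>p\<in>V_index k. a p *\<^sub>R V_family k p) = 0" and p: "p \<in> V_index k"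
  define c where "c j = Complex (a (j, True)) (a (j, False))" for j
  have "form_of_xi k c = (\<Sum>p\<in>V_index k. a p *\<^sub>R V_family k p)"
    unfolding form_of_xi_eq_sum by (intro sum.cong) (auto simp: c_def)
  then have "c (fst p) = 0" using form_of_xi_eq_0[OF assms, of c "fst p"] 0 p by auto
  then show "a p = 0" by (cases p; cases "snd p") (auto simp: c_def complex_eq_iff)
qed

text \<open>\<open>x\<^sup>2 + y\<^sup>2\<close> is the product of \<open>x + \<i> y\<close> and \<open>x - \<i> y\<close>.\<close>

lemma V_cplx_factor:
  assumes "2 * j \<le> k"
  shows "V_cplx k j x y = (x *\<^sub>R 1 + y *\<^sub>R \<i>) ^ (k - j) * (x *\<^sub>R 1 + y *\<^sub>R (- \<i>)) ^ j"
proof -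
  define z w where "z = x *\<^sub>R 1 + y *\<^sub>R \<i>" and "w = x *\<^sub>R 1 + y *\<^sub>R (- \<i>)"
  have zw: "complex_of_real x ^ 2 + complex_of_real y ^ 2 = z * w"
    "complex_of_real x + \<i> * complex_of_real y = z"
    by (simp_all add: z_def w_def complex_eq_iff power2_eq_square)
  have "k - j = j + (k - 2 * j)" using assms by simp
  then have "z ^ (k - j) = z ^ j * z ^ (k - 2 * j)" by (metis power_add)
  then show ?thesis
    unfolding V_cplx_def zw z_def[symmetric] w_def[symmetric]
    by (simp add: power_mult_distrib)
qed

lemma V_family_in_forms:
  assumes "p \<in> V_index k"
  shows "V_family k p \<in> forms k"
proof -
  obtain j b where p: "p = (j, b)" "2 * j \<le> k" using assms by fastforce
  have one: "smooth_on UNIV (\<lambda>s::real. c :: complex)" for c by (rule smooth_on_const) simp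
  obtain a where a: "\<And>s x y. (x *\<^sub>R 1 + y *\<^sub>R \<i>) ^ (k - j) * (x *\<^sub>R 1 + y *\<^sub>R (- \<i>)) ^ j =
      (\<Sum>i\<le>(k - j) + j. mono_xy ((k - j) + j) i x y *\<^sub>R (a (s::real) i :: complex))"
    using power_product_coefficients[OF open_UNIV one[of 1] one[of \<i>] one[of 1] one[of "- \<i>"], of "k - j" j] by blast
  have kj: "k - j + j = k" using p(2) by simp
  have V: "V_cplx k j x y = (\<Sum>i\<le>k. mono_xy k i x y *\<^sub>R a 0 i)" for x y
    unfolding V_cplx_factor[OF p(2)] a[of _ _ 0] kj ..
  have "V_family k p = (\<Sum>i\<le>k. (if b then Re (a 0 i) else Im (a 0 i)) *\<^sub>R mono_xy k i)"
    by (simp add: p V_family_def V_even_def V_odd_def V fun_eq_iff sum_fun_apply scaleR_fun_apply mult.commute)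
  then show ?thesis
    unfolding forms_iff by (intro exI[of _ "\<lambda>i. if b then Re (a 0 i) else Im (a 0 i)"])
qed

lemma span_V_basis:
  assumes k: "odd k"
  shows "span (V_family k ` V_index k) = forms k"
proof (rule span_eq_card)
  show "independent (V_family k ` V_index k)"
    by (rule indep_family_independent[OF _ indep_V_family[OF k]]) simp
  show "V_family k ` V_index k \<subseteq> forms k" using V_family_in_forms by blast
  have "card (V_family k ` V_index k) = card (V_index k)"
    by (rule card_image[OF indep_family_inj_on[OF _ indep_V_family[OF k]]]) simp
  also have "\<dots> = k + 1"
    using k by (auto simp: card_cartesian_product UNIV_bool elim!: oddE)
  also have "\<dots> = card (mono_xy k ` {..k})"
    by (simp add: card_image[OF indep_family_inj_on[OF _ indep_mono_xy]])
  finally show "card (V_family k ` V_index k) = card (mono_xy k ` {..k})" .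
qed simp

lemma form_of_xi_in_forms: "form_of_xi k c \<in> forms k"
  unfolding form_of_xi_eq_sum by (intro span_sum span_scale V_family_in_forms)

lemma xi_lin_form_of_xi:
  assumes "odd k" "j \<le> k div 2"
  shows "xi_lin k j (form_of_xi k c) = c j"
proof -
  have "representation (V_basis k) (form_of_xi k c) (V_family k p) =
      (if snd p then Re (c (fst p)) else Im (c (fst p)))" if "p \<in> V_index k" for p
    unfolding V_basis_eq form_of_xi_eq_sum
    by (rule indep_family_representation[OF _ indep_V_family[OF assms(1)] that]) simp
  from this[of "(j, True)"] this[of "(j, False)"] show ?thesis
    using assms(2) by (simp add: xi_lin_def V_family_def)
qed

lemma form_of_xi_xi_lin:
  assumes "odd k" "P \<in> forms k"
  shows "form_of_xi k (\<lambda>j. xi_lin k j P) = P"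
proof -
  have "form_of_xi k (\<lambda>j. xi_lin k j P) =
      (\<Sum>p\<in>V_index k. representation (V_basis k) P (V_family k p) *\<^sub>R V_family k p)"
    unfolding form_of_xi_eq_sum by (intro sum.cong) (auto simp: xi_lin_def V_family_def)
  also have "\<dots> = P"
    unfolding V_basis_eq
    by (rule sum_representation_family[OF _ indep_V_family[OF assms(1)]])
      (use assms span_V_basis in auto)
  finally show ?thesis .
qed

lemma form_of_xi_linear:
  "form_of_xi k (\<lambda>j. a *\<^sub>R c j + b *\<^sub>R d j) = a *\<^sub>R form_of_xi k c + b *\<^sub>R form_of_xi k d"
  by (auto simp: form_of_xi_def fun_eq_iff scaleR_fun_apply sum_distrib_left sum.distrib[symmetric]
      algebra_simps intro!: sum.cong)

lemma xi_lin_linear: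
  assumes "odd k" "P \<in> forms k" "Q \<in> forms k" "j \<le> k div 2"
  shows "xi_lin k j (a *\<^sub>R P + b *\<^sub>R Q) = a *\<^sub>R xi_lin k j P + b *\<^sub>R xi_lin k j Q"
  using xi_lin_form_of_xi[OF assms(1,4), of "\<lambda>j. a *\<^sub>R xi_lin k j P + b *\<^sub>R xi_lin k j Q"]
    form_of_xi_xi_lin[OF assms(1,2)] form_of_xi_xi_lin[OF assms(1,3)]
  by (simp add: form_of_xi_linear)

lemma xi_lin_eqI:
  assumes "odd k" "P \<in> forms k" "Q \<in> forms k" "\<And>j. j \<le> k div 2 \<Longrightarrow> xi_lin k j P = xi_lin k j Q"
  shows "P = Q"
proof -
  have "form_of_xi k (\<lambda>j. xi_lin k j P) = form_of_xi k (\<lambda>j. xi_lin k j Q)"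
    using assms(4) by (simp add: form_of_xi_def)
  then show ?thesis using form_of_xi_xi_lin assms by metis
qed

text \<open>A conformal matrix acts on the argument \<open>x + \<i> y\<close> as multiplication by \<open>u - \<i> v\<close>.\<close>

lemma poly_act_form_of_xi:
  "poly_act (form_of_xi k c) (vector [vector [u, - v], vector [v, u]]) =
   form_of_xi k (\<lambda>j. cnj (of_real (u\<^sup>2 + v\<^sup>2) ^ j * Complex u (- v) ^ (k - 2 * j)) * c j)"
proof (intro ext)
  fix x y
  have 1: "complex_of_real (x * u + y * v) ^ 2 + complex_of_real (y * u - x * v) ^ 2 =
      of_real (u\<^sup>2 + v\<^sup>2) * (complex_of_real x ^ 2 + complex_of_real y ^ 2)"
    by (simp add: algebra_simps power2_eq_square)
  have 2: "complex_of_real (x * u + y * v) + \<i> * complex_of_real (y * u - x * v) =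
      Complex u (- v) * (complex_of_real x + \<i> * complex_of_real y)"
    by (simp add: complex_eq_iff algebra_simps)
  have "V_cplx k j (x * u + y * v) (y * u - x * v) =
      of_real (u\<^sup>2 + v\<^sup>2) ^ j * Complex u (- v) ^ (k - 2 * j) * V_cplx k j x y" for j
    unfolding V_cplx_def 1 2 by (simp add: power_mult_distrib mult_ac del: of_real_add of_real_power)
  then show "poly_act (form_of_xi k c) (vector [vector [u, - v], vector [v, u]]) x y =
      form_of_xi k (\<lambda>j. cnj (of_real (u\<^sup>2 + v\<^sup>2) ^ j * Complex u (- v) ^ (k - 2 * j)) * c j) x y"
    by (simp add: form_of_xi_def poly_act_def mult.commute mult.left_commute)
qed

section \<open>Symmetric powers of a plane\<close>

lemma sym_mono_apply:
  "sym_mono k i x y f = (if linear f then mono_xy k i (f x) (f y) else 0)"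
  by (simp add: sym_mono_def sym_prod_def mono_xy_def)

lemma sym_mono_in_sym_power: "x \<in> V \<Longrightarrow> y \<in> V \<Longrightarrow> i \<le> k \<Longrightarrow> sym_mono k i x y \<in> sym_power k V"
  unfolding sym_power_def sym_mono_def by (rule span_base) auto

text \<open>At a linear form \<open>f\<close> this is the expansion of a transformed monomial at the point \<open>(f x, f y)\<close>.\<close>

lemma sym_mono_change_basis:
  assumes "i \<le> k"
  shows "sym_mono k i (g$1$1 *\<^sub>R x + g$2$1 *\<^sub>R y) (g$1$2 *\<^sub>R x + g$2$2 *\<^sub>R y) =
    (\<Sum>j\<le>k. rho k g j i *\<^sub>R sym_mono k j x y)"
proof
  fix f :: "'a \<Rightarrow> real"
  show "sym_mono k i (g$1$1 *\<^sub>R x + g$2$1 *\<^sub>R y) (g$1$2 *\<^sub>R x + g$2$2 *\<^sub>R y) f =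
    (\<Sum>j\<le>k. rho k g j i *\<^sub>R sym_mono k j x y) f"
  proof (cases "linear f")
    case True
    have "poly_act (mono_xy k i) g (f x) (f y) = (\<Sum>j\<le>k. rho k g j i *\<^sub>R mono_xy k j) (f x) (f y)"
      by (simp only: poly_act_mono[OF assms])
    then show ?thesis
      using True by (simp add: sym_mono_apply poly_act_def sum_fun_apply scaleR_fun_apply
          linear_add linear_cmul mult.commute)
  qed (simp add: sym_mono_apply sum_fun_apply scaleR_fun_apply)
qed

text \<open>Linear forms take arbitrary values at \<open>x\<close> and \<open>y\<close>, so a relation between the \<open>x\<^bsup>k-i\<^esup>y\<^bsup>i\<^esup>\<close> is a relation
  between monomials in two real variables.\<close>

lemma indep_sym_mono:
  fixes x y :: "'v::real_vector"
  assumes "x \<noteq> y" "independent {x, y}"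
  shows "indep_family {..k} (\<lambda>i. sym_mono k i x y)"
  unfolding indep_family_def
proof (intro allI impI)
  fix c assume 0: "(\<Sum>i\<le>k. c i *\<^sub>R sym_mono k i x y) = 0"
  have "(\<Sum>i\<le>k. c i *\<^sub>R mono_xy k i) a b = 0" for a b
  proof -
    obtain f where f: "linear f" "\<forall>z\<in>{x, y}. f z = (if z = x then a else b)"
      using linear_independent_extend[OF assms(2), of "\<lambda>z. if z = x then a else b"] by blast
    have "(\<Sum>i\<le>k. c i *\<^sub>R sym_mono k i x y) f = 0" by (simp only: 0 zero_fun_apply)
    then show ?thesis
      using f assms(1) by (simp add: sum_fun_apply scaleR_fun_apply sym_mono_apply)
  qed
  then have "(\<Sum>i\<le>k. c i *\<^sub>R mono_xy k i) = 0" by (simp add: fun_eq_iff)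
  then show "\<forall>i\<in>{..k}. c i = 0"
    using indep_mono_xy[of k] unfolding indep_family_def by blast
qed

lemma linear_functional_separates:
  fixes x y :: "'v::real_vector"
  assumes "\<And>f. linear f \<Longrightarrow> f x = (f y :: real)"
  shows "x = y"
proof (rule ccontr)
  assume "x \<noteq> y"
  then have "independent {x - y}" by simp
  then obtain f :: "'v \<Rightarrow> real" where "linear f" "\<forall>z\<in>{x - y}. f z = 1"
    using linear_independent_extend[of "{x - y}" "\<lambda>_. 1 :: real"] by blast
  then show False using assms[of f] by (simp add: linear_diff)
qed

text \<open>For odd \<open>k\<close> a real number is determined by its \<open>k\<close>-th power, so a vector is determined by
  its \<open>k\<close>-th symmetric power.\<close>

lemma sym_mono_inj:
  fixes x y x' y' :: "'v::real_vector"
  assumes "odd k" "sym_mono k 0 x y = sym_mono k 0 x' y'" "sym_mono k k x y = sym_mono k k x' y'"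
  shows "x = x'" "y = y'"
proof -
  have "f x = f x' \<and> f y = f y'" if "linear f" for f :: "'v \<Rightarrow> real"
  proof -
    have "f x ^ k = f x' ^ k" "f y ^ k = f y' ^ k"
      using fun_cong[OF assms(2), of f] fun_cong[OF assms(3), of f] that
      by (simp_all add: sym_mono_apply mono_xy_def)
    then show ?thesis using assms(1) by (metis odd_real_root_power_cancel)
  qed
  then show "x = x'" "y = y'" by (auto intro: linear_functional_separates)
qed

section \<open>\<open>GL(2)\<close>-structures and their frames\<close>

locale gl2_bundle =
  fixes k :: nat and M :: "('m, 'e::euclidean_space) atlas" and E :: "'m \<Rightarrow> 'v::real_vector set"
    and T :: "('m, real^2, 'v) frames" and \<Theta> :: "'m \<Rightarrow> (('v \<Rightarrow> real) \<Rightarrow> real) \<Rightarrow> ('m, 'e) tvec"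
  assumes manifold: "smooth_manifold M" and dim: "DIM('e) = k + 1" and odd_k: "odd k"
    and gl2: "gl2_structure k M E T \<Theta>"
begin

sublocale M: smooth_atlas M
  by (rule smooth_manifold_imp_smooth_atlas[OF manifold])

definition plane_basis :: "'m \<Rightarrow> 'v \<Rightarrow> 'v \<Rightarrow> bool" where
  "plane_basis p x y \<longleftrightarrow> x \<noteq> y \<and> independent {x, y} \<and> span {x, y} = E p"

lemma frame_set_iff:
  "b \<in> frame_set k M E \<Theta> \<longleftrightarrow>
   (\<exists>p x y. b = (p, power_frame k \<Theta> p x y) \<and> p \<in> points M \<and> plane_basis p x y)"
  unfolding frame_set_def plane_basis_def by blast

lemma Theta_sum:
  assumes p: "p \<in> points M" and s: "\<And>i. i \<in> I \<Longrightarrow> s i \<in> sym_power k (E p)"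
  shows "\<Theta> p (\<Sum>i\<in>I. c i *\<^sub>R s i) = (\<Sum>i\<in>I. c i *\<^sub>R \<Theta> p (s i))"
proof -
  have lin: "linear_on (sym_power k (E p)) (\<Theta> p)"
    using gl2 p unfolding gl2_structure_def by blast
  have sub: "subspace (sym_power k (E p))" unfolding sym_power_def by (rule subspace_span)
  have 0: "\<Theta> p 0 = 0"
    using lin subspace_0[OF sub] unfolding linear_on_def by (metis scaleR_zero_left add.right_neutral)
  show ?thesis
    using s
  proof (induction I rule: infinite_finite_induct)
    case (insert i I)
    have "(\<Sum>i\<in>I. c i *\<^sub>R s i) \<in> sym_power k (E p)"
      using insert.prems by (intro subspace_sum[OF sub] subspace_scale[OF sub]) auto
    then have "\<Theta> p (c i *\<^sub>R s i + 1 *\<^sub>R (\<Sum>i\<in>I. c i *\<^sub>R s i)) =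
        c i *\<^sub>R \<Theta> p (s i) + 1 *\<^sub>R \<Theta> p (\<Sum>i\<in>I. c i *\<^sub>R s i)"
      using lin insert.prems unfolding linear_on_def by blast
    moreover have "\<Theta> p (\<Sum>i\<in>I. c i *\<^sub>R s i) = (\<Sum>i\<in>I. c i *\<^sub>R \<Theta> p (s i))"
      using insert by blast
    ultimately show ?case unfolding sum.insert[OF insert.hyps] scaleR_one by metis
  qed (simp_all add: 0)
qed

lemma plane_basis_in: "plane_basis p x y \<Longrightarrow> x \<in> E p \<and> y \<in> E p"
  unfolding plane_basis_def using span_base[of _ "{x, y}"] by auto

lemma power_frame_in_tangent_space:
  assumes "p \<in> points M" "x \<in> E p" "y \<in> E p"
  shows "power_frame k \<Theta> p x y i \<in> tangent_space M p"
proof (cases "i \<le> k")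
  case True
  then show ?thesis
    using gl2 assms sym_mono_in_sym_power[of x "E p" y i k]
    unfolding gl2_structure_def power_frame_def by (auto dest: bij_betwE)
next
  case False
  then show ?thesis
    using subspace_0[OF M.tangent_space_subspace] by (simp add: power_frame_def)
qed

lemma indep_power_frame:
  assumes p: "p \<in> points M" and b: "plane_basis p x y"
  shows "indep_family {..k} (power_frame k \<Theta> p x y)"
  unfolding indep_family_def
proof (intro allI impI)
  fix c assume 0: "(\<Sum>i\<le>k. c i *\<^sub>R power_frame k \<Theta> p x y i) = 0"
  have s: "sym_mono k i x y \<in> sym_power k (E p)" if "i \<in> {..k}" for i
    using plane_basis_in[OF b] that by (intro sym_mono_in_sym_power) auto
  have sub: "subspace (sym_power k (E p))" unfolding sym_power_def by (rule subspace_span)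
  have "\<Theta> p (\<Sum>i\<le>k. c i *\<^sub>R sym_mono k i x y) = (\<Sum>i\<le>k. c i *\<^sub>R \<Theta> p (sym_mono k i x y))"
    by (rule Theta_sum[OF p s])
  also have "\<dots> = (\<Sum>i\<le>k. c i *\<^sub>R power_frame k \<Theta> p x y i)"
    by (intro sum.cong) (auto simp: power_frame_def)
  also have "\<dots> = 0" by (rule 0)
  also have "0 = \<Theta> p 0" using Theta_sum[OF p, of "{}"] by simp
  finally have "(\<Sum>i\<le>k. c i *\<^sub>R sym_mono k i x y) = 0"
  proof (rule inj_onD[of "\<Theta> p" "sym_power k (E p)", rotated])
    show "inj_on (\<Theta> p) (sym_power k (E p))"
      using gl2 p unfolding gl2_structure_def bij_betw_def by blast
    show "(\<Sum>i\<le>k. c i *\<^sub>R sym_mono k i x y) \<in> sym_power k (E p)"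
      using s by (intro subspace_sum[OF sub] subspace_scale[OF sub]) auto
  qed (rule subspace_0[OF sub])
  then show "\<forall>i\<in>{..k}. c i = 0"
    using indep_sym_mono[of x y k] b unfolding plane_basis_def indep_family_def by blast
qed

lemma obtain_chart_at:
  assumes "p \<in> points M" obtains C where "chart_at M p C"
  using assms unfolding points_def chart_at_def by auto

text \<open>\<open>k + 1\<close> independent tangent vectors form a basis, since the dimension of \<open>M\<close> is \<open>k + 1\<close>.\<close>

lemma span_power_frame:
  assumes p: "p \<in> points M" and b: "plane_basis p x y"
  shows "span (power_frame k \<Theta> p x y ` {..k}) = tangent_space M p"
proof -
  obtain C where C: "chart_at M p C" using p by (rule obtain_chart_at)
  let ?t = "coord_vec M C p ` Basis"
  have "v \<in> span ?t" if v: "v \<in> tangent_space M p" for v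
  proof -
    have "v = (\<Sum>b\<in>Basis. (v C \<bullet> b) *\<^sub>R coord_vec M C p b)"
      using M.coord_vec_eq[OF v C] linear_sum_Basis[OF M.coord_vec_linear[OF C], of "v C"] by simp
    moreover have "(\<Sum>b\<in>Basis. (v C \<bullet> b) *\<^sub>R coord_vec M C p b) \<in> span ?t"
      by (intro span_sum span_scale span_base imageI)
    ultimately show ?thesis by metis
  qed
  moreover have "span ?t \<subseteq> tangent_space M p"
    by (rule span_minimal[OF _ M.tangent_space_subspace]) (auto intro: M.coord_vec_in_tangent_space[OF C])
  ultimately have t: "span ?t = tangent_space M p" by blast
  have "span (power_frame k \<Theta> p x y ` {..k}) = span ?t"
  proof (rule span_eq_card)
    show "independent (power_frame k \<Theta> p x y ` {..k})"
      by (rule indep_family_independent[OF _ indep_power_frame[OF p b]]) simp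
    show "power_frame k \<Theta> p x y ` {..k} \<subseteq> span ?t"
      using power_frame_in_tangent_space[OF p] plane_basis_in[OF b] by (auto simp: t)
    have "inj_on (coord_vec M C p) Basis"
      by (rule inj_onI) (metis M.coord_vec_self[OF C])
    then have "card ?t = k + 1" by (simp add: card_image dim)
    moreover have "card (power_frame k \<Theta> p x y ` {..k}) = k + 1"
      using indep_family_inj_on[OF _ indep_power_frame[OF p b]] by (simp add: card_image)
    ultimately show "card (power_frame k \<Theta> p x y ` {..k}) = card ?t" by simp
  qed simp
  then show ?thesis by (simp add: t)
qed

lemma power_frame_inj:
  assumes p: "p \<in> points M" and E: "x \<in> E p" "y \<in> E p" "x' \<in> E p" "y' \<in> E p"
    and eq: "power_frame k \<Theta> p x y = power_frame k \<Theta> p x' y'"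
  shows "x = x'" "y = y'"
proof -
  have "sym_mono k i x y = sym_mono k i x' y'" if i: "i \<le> k" for i
  proof (rule inj_onD[of "\<Theta> p" "sym_power k (E p)"])
    show "inj_on (\<Theta> p) (sym_power k (E p))"
      using gl2 p unfolding gl2_structure_def bij_betw_def by blast
    show "\<Theta> p (sym_mono k i x y) = \<Theta> p (sym_mono k i x' y')"
      using fun_cong[OF eq, of i] i by (simp add: power_frame_def)
  qed (use E i in \<open>auto intro: sym_mono_in_sym_power\<close>)
  then show "x = x'" "y = y'" using sym_mono_inj[OF odd_k, of x y x' y'] by auto
qed

lemma frame_act_power_frame:
  assumes p: "p \<in> points M" and E: "x \<in> E p" "y \<in> E p"
  shows "frame_act k (p, power_frame k \<Theta> p x y) g =
    (p, power_frame k \<Theta> p (g$1$1 *\<^sub>R x + g$2$1 *\<^sub>R y) (g$1$2 *\<^sub>R x + g$2$2 *\<^sub>R y))"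
proof -
  have "\<Theta> p (\<Sum>j\<le>k. rho k g j i *\<^sub>R sym_mono k j x y) = (\<Sum>j\<le>k. rho k g j i *\<^sub>R \<Theta> p (sym_mono k j x y))" for i
    by (rule Theta_sum[OF p]) (use E in \<open>auto intro: sym_mono_in_sym_power\<close>)
  then show ?thesis
    by (simp add: frame_act_def power_frame_def fun_eq_iff sym_mono_change_basis)
qed

end

section \<open>Charts of the frame bundle\<close>

abbreviation GL2 :: "(real^2^2) set" where "GL2 \<equiv> {g. invertible g}"

lemma smooth_on_matrix:
  fixes f :: "'a::euclidean_space \<Rightarrow> real^'n^'m"
  assumes "open S" "\<And>i j. smooth_on S (\<lambda>x. f x $ i $ j)"
  shows "smooth_on S f"
proof (rule smooth_on_componentwise[OF assms(1)])
  fix b :: "real^'n^'m" assume "b \<in> Basis"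
  then obtain i j where "b = axis i (axis j 1)" by (auto simp: Basis_vec_def)
  then show "smooth_on S (\<lambda>x. f x \<bullet> b)" using assms(2) by (simp add: inner_axis)
qed

lemma bounded_linear_entry: "bounded_linear (\<lambda>g::real^'n^'m. g $ i $ j)"
  using bounded_linear_compose[OF bounded_linear_vec_nth bounded_linear_vec_nth] .

lemma smooth_on_entry: "open S \<Longrightarrow> smooth_on S f \<Longrightarrow> smooth_on S (\<lambda>x. f x $ i $ j :: real)"
  by (rule smooth_on_bounded_linear[OF _ bounded_linear_entry])

lemma smooth_on_matrix_mult:
  fixes f :: "'a::euclidean_space \<Rightarrow> real^'n^'m" and g :: "'a \<Rightarrow> real^'l^'n"
  assumes "open S" "smooth_on S f" "smooth_on S g"
  shows "smooth_on S (\<lambda>x. f x ** g x)"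
  using assms by (intro smooth_on_matrix) (auto simp: matrix_matrix_mult_def intro!: smooth_intros smooth_on_entry)

lemma open_GL2: "open GL2"
proof -
  have "GL2 = (\<lambda>g::real^2^2. g$1$1 * g$2$2 - g$1$2 * g$2$1) -` (- {0})"
    by (auto simp: invertible_det_nz det_2)
  also have "open \<dots>"
    by (intro open_vimage open_Compl continuous_intros)
  finally show ?thesis .
qed

lemma matrix_mult_in_GL2: "g \<in> GL2 \<Longrightarrow> h \<in> GL2 \<Longrightarrow> g ** h \<in> GL2"
  by (simp add: invertible_mult)

lemma column_matrix_mult_2:
  fixes a g :: "real^2^2"
  shows "column 1 (a ** g) = g$1$1 *\<^sub>R column 1 a + g$2$1 *\<^sub>R column 2 a"
    and "column 2 (a ** g) = g$1$2 *\<^sub>R column 1 a + g$2$2 *\<^sub>R column 2 a"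
  by (simp_all add: vec_eq_iff column_def matrix_matrix_mult_def sum_2 mult.commute)

lemma column_matrix_mult: "column i (h ** g) = h *v column i g"
  by (simp add: vec_eq_iff column_def matrix_matrix_mult_def matrix_vector_mult_def)

lemma invertible_iff_span_columns_2:
  fixes g :: "real^2^2"
  shows "invertible g \<longleftrightarrow> span {column 1 g, column 2 g} = UNIV"
proof -
  have "columns g = {column 1 g, column 2 g}" unfolding columns_def by (auto simp: UNIV_2)
  then show ?thesis
    using matrix_right_invertible_span_columns[of g] by (simp add: invertible_right_inverse span_vec_eq)
qed

context gl2_bundle
begin

lemma bundle_frame:
  assumes "R \<in> T"
  shows "mopen M (fst R)"
    and "p \<in> fst R \<Longrightarrow> linear (snd R p)" and "p \<in> fst R \<Longrightarrow> inj (snd R p)"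
    and "p \<in> fst R \<Longrightarrow> range (snd R p) = E p"
  using gl2 assms unfolding gl2_structure_def vector_bundle_def by (auto simp: case_prod_beta)

text \<open>Both conditions say that the columns of \<open>g\<close> are a basis of the plane, as the local frame is an
  isomorphism onto the fibre.\<close>

lemma plane_basis_iff_invertible:
  fixes g :: "real^2^2"
  assumes R: "R \<in> T" "p \<in> fst R"
  shows "plane_basis p (snd R p (column 1 g)) (snd R p (column 2 g)) \<longleftrightarrow> invertible g"
proof -
  define t where "t = snd R p"
  have t: "linear t" "inj t" "range t = E p"
    using bundle_frame[OF R(1)] R(2) by (auto simp: t_def)
  let ?S = "{column 1 g, column 2 g}"
  have image: "span {t (column 1 g), t (column 2 g)} = t ` span ?S"
    using linear_span_image[OF t(1), of ?S] by simp
  show ?thesis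
    unfolding t_def[symmetric]
  proof
    assume "plane_basis p (t (column 1 g)) (t (column 2 g))"
    then have "t ` span ?S = t ` UNIV" using image t(3) by (simp add: plane_basis_def)
    then have "span ?S = UNIV" using t(2) by (simp add: inj_image_eq_iff)
    then show "invertible g" by (simp add: invertible_iff_span_columns_2)
  next
    assume "invertible g"
    then have S: "span ?S = UNIV" by (simp add: invertible_iff_span_columns_2)
    have "dim (UNIV :: (real^2) set) = 2" by simp
    then have card: "card ?S = 2"
      using dim_le_card[of UNIV ?S] S card_insert_le_m1[of 2 "{column 2 g}" "column 1 g"] by fastforce
    then have ne: "column 1 g \<noteq> column 2 g" by (auto simp: card_insert_if split: if_splits)
    have "independent ?S"
      by (rule card_le_dim_spanning[of _ UNIV]) (use S card in auto)
    then have "independent (t ` ?S)"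
      by (rule linear_independent_injective_image[OF t(1)]) (use t(2) inj_on_subset in blast)
    then show "plane_basis p (t (column 1 g)) (t (column 2 g))"
      using image S t(2,3) ne by (auto simp: plane_basis_def inj_eq)
  qed
qed

text \<open>The point of \<open>B(E)\<close> over \<open>p\<close> that has the coordinate \<open>g\<close> with respect to the local frame \<open>t\<close>.\<close>

definition frame_pt :: "('m \<Rightarrow> real^2 \<Rightarrow> 'v) \<Rightarrow> 'm \<Rightarrow> real^2^2 \<Rightarrow> ('m, 'e) fpoint" where
  "frame_pt t p g = (p, power_frame k \<Theta> p (t p (column 1 g)) (t p (column 2 g)))"

definition frame_chart ::
  "('m, 'e) chart \<Rightarrow> 'm set \<times> ('m \<Rightarrow> real^2 \<Rightarrow> 'v) \<Rightarrow> (('m, 'e) fpoint, 'e \<times> (real^2^2)) chart" where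
  "frame_chart C R = ({b \<in> frame_set k M E \<Theta>. fst b \<in> fst C \<inter> fst R},
     \<lambda>(p, F). (snd C p, THE g. F = power_frame k \<Theta> p (snd R p (column 1 g)) (snd R p (column 2 g))))"

abbreviation B :: "(('m, 'e) fpoint, 'e \<times> (real^2^2)) atlas" where
  "B \<equiv> frame_bundle k M E T \<Theta>"

lemma B_eq: "B = {frame_chart C R | C R. C \<in> M \<and> R \<in> T}"
  unfolding frame_bundle_def frame_chart_def by force

lemma fst_frame_pt [simp]: "fst (frame_pt t p g) = p"
  by (simp add: frame_pt_def)

lemma frame_pt_in_frame_set:
  assumes "R \<in> T" "p \<in> fst R" "g \<in> GL2"
  shows "frame_pt (snd R) p g \<in> frame_set k M E \<Theta>"
proof -
  have "p \<in> points M" using bundle_frame(1)[OF assms(1)] assms(2) unfolding mopen_def by blast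
  then show ?thesis
    unfolding frame_set_iff frame_pt_def
    using plane_basis_iff_invertible[OF assms(1,2)] assms(3) by blast
qed

lemma frame_pt_inj:
  assumes R: "R \<in> T" "p \<in> fst R" and eq: "frame_pt (snd R) p g = frame_pt (snd R) p h"
  shows "g = h"
proof -
  have p: "p \<in> points M" using bundle_frame(1)[OF R(1)] R(2) unfolding mopen_def by blast
  have E: "snd R p w \<in> E p" for w using bundle_frame(4)[OF R] by blast
  have "power_frame k \<Theta> p (snd R p (column 1 g)) (snd R p (column 2 g)) =
      power_frame k \<Theta> p (snd R p (column 1 h)) (snd R p (column 2 h))"
    using eq by (simp add: frame_pt_def)
  from power_frame_inj[OF p E E E E this]
  have "column 1 g = column 1 h" "column 2 g = column 2 h"
    using injD[OF bundle_frame(3)[OF R]] by blast+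
  then have "column i g = column i h" for i
    using exhaust_2[of i] by metis
  then show ?thesis by (simp add: vec_eq_iff column_def)
qed

lemma frame_set_cases:
  assumes b: "b \<in> frame_set k M E \<Theta>" and R: "R \<in> T" "fst b \<in> fst R"
  obtains g where "g \<in> GL2" "b = frame_pt (snd R) (fst b) g"
proof -
  obtain p x y where pxy: "b = (p, power_frame k \<Theta> p x y)" "plane_basis p x y"
    using b unfolding frame_set_iff by blast
  have p: "p \<in> fst R" using R(2) pxy(1) by simp
  obtain u v where "x = snd R p u" "y = snd R p v"
    using plane_basis_in[OF pxy(2)] bundle_frame(4)[OF R(1) p] by blast
  moreover define g where "g = (transpose (vector [u, v]) :: real^2^2)"
  moreover have "column 1 g = u" "column 2 g = v"
    by (simp_all add: g_def vec_eq_iff column_def transpose_def)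
  ultimately have xy: "x = snd R p (column 1 g)" "y = snd R p (column 2 g)" by simp_all
  show ?thesis
  proof
    show "g \<in> GL2" using plane_basis_iff_invertible[OF R(1) p, of g] pxy(2) xy by simp
    show "b = frame_pt (snd R) (fst b) g" by (simp add: frame_pt_def pxy(1) xy)
  qed
qed

lemma frame_chart_frame_pt:
  assumes "R \<in> T" "p \<in> fst R"
  shows "snd (frame_chart C R) (frame_pt (snd R) p g) = (snd C p, g)"
proof -
  have "(THE h :: real^2^2. snd (frame_pt (snd R) p g) =
      power_frame k \<Theta> p (snd R p (column 1 h)) (snd R p (column 2 h))) = g"
  proof (rule the_equality)
    fix h :: "real^2^2" assume "snd (frame_pt (snd R) p g) = power_frame k \<Theta> p (snd R p (column 1 h)) (snd R p (column 2 h))"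
    then have "frame_pt (snd R) p h = frame_pt (snd R) p g" by (simp add: frame_pt_def)
    then show "h = g" by (rule frame_pt_inj[OF assms])
  qed (simp add: frame_pt_def)
  then show ?thesis by (simp add: frame_chart_def frame_pt_def)
qed

lemma frame_chart_domain: "fst (frame_chart C R) = {b \<in> frame_set k M E \<Theta>. fst b \<in> fst C \<inter> fst R}"
  by (simp add: frame_chart_def)

lemma frame_pt_in_domain:
  "R \<in> T \<Longrightarrow> p \<in> fst C \<Longrightarrow> p \<in> fst R \<Longrightarrow> g \<in> GL2 \<Longrightarrow> frame_pt (snd R) p g \<in> fst (frame_chart C R)"
  using frame_pt_in_frame_set by (simp add: frame_chart_domain)

lemma frame_chart_cases:
  assumes "R \<in> T" "b \<in> fst (frame_chart C R)"
  obtains p g where "p \<in> fst C" "p \<in> fst R" "g \<in> GL2" "b = frame_pt (snd R) p g"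
proof -
  have b: "b \<in> frame_set k M E \<Theta>" "fst b \<in> fst C" "fst b \<in> fst R"
    using assms(2) by (auto simp: frame_chart_domain)
  from b(1) assms(1) b(3) obtain g where "g \<in> GL2" "b = frame_pt (snd R) (fst b) g"
    by (rule frame_set_cases)
  with b that show ?thesis by blast
qed

lemma image_frame_chart:
  assumes "R \<in> T"
  shows "snd (frame_chart C R) ` {b \<in> fst (frame_chart C R). fst b \<in> W} =
    snd C ` (fst C \<inter> (fst R \<inter> W)) \<times> GL2"
proof (intro equalityI subsetI)
  fix z assume "z \<in> snd (frame_chart C R) ` {b \<in> fst (frame_chart C R). fst b \<in> W}"
  then obtain b where b: "b \<in> fst (frame_chart C R)" "fst b \<in> W" "z = snd (frame_chart C R) b" by blast
  obtain p g where "p \<in> fst C" "p \<in> fst R" "g \<in> GL2" "b = frame_pt (snd R) p g"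
    using frame_chart_cases[OF assms b(1)] by blast
  then show "z \<in> snd C ` (fst C \<inter> (fst R \<inter> W)) \<times> GL2"
    using b by (simp add: frame_chart_frame_pt[OF assms])
next
  fix z assume "z \<in> snd C ` (fst C \<inter> (fst R \<inter> W)) \<times> GL2"
  then obtain p g where p: "p \<in> fst C" "p \<in> fst R" "p \<in> W" "g \<in> GL2" "z = (snd C p, g)" by auto
  then show "z \<in> snd (frame_chart C R) ` {b \<in> fst (frame_chart C R). fst b \<in> W}"
    by (intro image_eqI[of _ _ "frame_pt (snd R) p g"])
      (auto simp: frame_chart_frame_pt[OF assms] intro!: frame_pt_in_domain assms)
qed

lemma inj_on_frame_chart:
  assumes C: "C \<in> M" and R: "R \<in> T"
  shows "inj_on (snd (frame_chart C R)) (fst (frame_chart C R))"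
proof (rule inj_onI)
  fix b b' assume b: "b \<in> fst (frame_chart C R)" "b' \<in> fst (frame_chart C R)"
    "snd (frame_chart C R) b = snd (frame_chart C R) b'"
  obtain q h where "q \<in> fst C" "q \<in> fst R" "b = frame_pt (snd R) q h"
    using frame_chart_cases[OF R b(1)] by blast
  moreover obtain q' h' where "q' \<in> fst C" "q' \<in> fst R" "b' = frame_pt (snd R) q' h'"
    using frame_chart_cases[OF R b(2)] by blast
  ultimately show "b = b'"
    using b(3) M.chart_inj[OF C] by (auto simp: frame_chart_frame_pt[OF R] dest: inj_onD)
qed

lemma chart_inv_frame_chart:
  assumes C: "C \<in> M" and R: "R \<in> T" and p: "p \<in> fst C" "p \<in> fst R" "g \<in> GL2"
  shows "chart_inv (frame_chart C R) (snd C p, g) = frame_pt (snd R) p g"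
  using inv_into_f_f[OF inj_on_frame_chart[OF C R] frame_pt_in_domain[OF R p]]
  by (simp add: chart_inv_def frame_chart_frame_pt[OF R p(2)])

text \<open>Matrix of the change from one local frame of \<open>E\<close> to another. It multiplies the coordinate \<open>g\<close>
  from the left and so commutes with the action of \<open>GL(2)\<close>.\<close>

definition transition :: "'m set \<times> ('m \<Rightarrow> real^2 \<Rightarrow> 'v) \<Rightarrow> 'm set \<times> ('m \<Rightarrow> real^2 \<Rightarrow> 'v) \<Rightarrow> 'm \<Rightarrow> real^2^2" where
  "transition R R' p = matrix (inv (snd R' p) \<circ> snd R p)"

lemma transition:
  assumes "R \<in> T" "R' \<in> T" "p \<in> fst R" "p \<in> fst R'"
  shows "snd R p w = snd R' p (transition R R' p *v w)"
    and "frame_pt (snd R) p g = frame_pt (snd R') p (transition R R' p ** g)"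
    and "transition R R' p ** transition R' R p = mat 1"
proof -
  have transition_apply: "transition R R' p *v w = inv (snd R' p) (snd R p w) \<and>
      snd R' p (inv (snd R' p) (snd R p w)) = snd R p w"
    if R: "R \<in> T" "R' \<in> T" "p \<in> fst R" "p \<in> fst R'" for w R R'
  proof -
    obtain f where f: "linear f" "f \<circ> snd R' p = id"
      using linear_injective_left_inverse bundle_frame(2,3)[OF R(2,4)] by metis
    have inverted: "snd R' p (inv (snd R' p) (snd R p w)) = snd R p w" for w
      by (rule f_inv_into_f) (use bundle_frame(4)[OF R(1,3)] bundle_frame(4)[OF R(2,4)] in auto)
    have "inv (snd R' p) (snd R p w) = f (snd R p w)" for w
      using fun_cong[OF f(2), of "inv (snd R' p) (snd R p w)"] inverted by simp
    then have "inv (snd R' p) \<circ> snd R p = f \<circ> snd R p" by auto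
    then have "linear (inv (snd R' p) \<circ> snd R p)"
      using linear_compose[OF bundle_frame(2)[OF R(1,3)] f(1)] by simp
    then show ?thesis
      unfolding transition_def using matrix_works[of "inv (snd R' p) \<circ> snd R p" w] inverted by simp
  qed
  have works: "transition R R' p *v w = inv (snd R' p) (snd R p w)"
    and inverted: "snd R' p (inv (snd R' p) (snd R p w)) = snd R p w"
    if "R \<in> T" "R' \<in> T" "p \<in> fst R" "p \<in> fst R'" for w R R'
    using transition_apply[OF that] by blast+
  show 1: "snd R p w = snd R' p (transition R R' p *v w)" for w
    using works[OF assms] inverted[OF assms] by simp
  show "frame_pt (snd R) p g = frame_pt (snd R') p (transition R R' p ** g)"
    by (simp add: frame_pt_def 1 column_matrix_mult)
  have "(transition R R' p ** transition R' R p) *v w = w" for w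
  proof -
    have "(transition R R' p ** transition R' R p) *v w = inv (snd R' p) (snd R p (inv (snd R p) (snd R' p w)))"
      using works[OF assms] works[of R' R] assms by (simp add: matrix_vector_mul_assoc[symmetric])
    also have "\<dots> = w" using inverted[of R' R w] assms bundle_frame(3)[OF assms(2,4)] by simp
    finally show ?thesis .
  qed
  then show "transition R R' p ** transition R' R p = mat 1"
    by (metis matrix_eq matrix_vector_mul_lid)
qed

lemma transition_in_GL2:
  assumes "R \<in> T" "R' \<in> T" "p \<in> fst R" "p \<in> fst R'"
  shows "transition R R' p \<in> GL2"
  using transition(3)[OF assms] by (auto simp: invertible_right_inverse)

lemma smooth_transition:
  assumes C: "C \<in> M" and R: "R \<in> T" "R' \<in> T"
  shows "smooth_on (snd C ` (fst C \<inter> (fst R \<inter> fst R'))) (\<lambda>e. transition R R' (chart_inv C e))"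
proof (rule smooth_on_matrix)
  let ?W = "fst R \<inter> fst R'"
  have W: "mopen M ?W" by (rule M.mopen_Int[OF bundle_frame(1)[OF R(1)] bundle_frame(1)[OF R(2)]])
  show op: "open (snd C ` (fst C \<inter> ?W))" by (rule M.mopen_open_image[OF W C])
  fix i j :: 2
  have "smooth_section M T (fst R) (\<lambda>p. snd R p (axis j 1))"
    using gl2 R(1) unfolding gl2_structure_def vector_bundle_def by (auto simp: case_prod_beta)
  then obtain c where c: "smooth_fun M (fst R' \<inter> fst R) c"
    "\<forall>p\<in>fst R' \<inter> fst R. snd R p (axis j 1) = snd R' p (c p)"
    using R(2) unfolding smooth_section_def by (auto simp: case_prod_beta)
  have eq: "c p $ i = transition R R' p $ i $ j" if "p \<in> ?W" for p
  proof -
    have "snd R' p (c p) = snd R' p (transition R R' p *v axis j 1)"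
      using c(2) transition(1)[OF R, of p "axis j 1"] that by auto
    then have "c p = transition R R' p *v axis j 1"
      using bundle_frame(3)[OF R(2)] that by (auto dest: injD)
    then show ?thesis by (simp add: matrix_vector_mult_basis column_def)
  qed
  have "smooth_on (snd C ` (fst C \<inter> ?W)) (c \<circ> chart_inv C)"
    using M.smooth_funD[OF c(1) C] by (simp add: Int_commute)
  then have "smooth_on (snd C ` (fst C \<inter> ?W)) (\<lambda>e. (c \<circ> chart_inv C) e $ i)"
    by (rule smooth_on_bounded_linear[OF op bounded_linear_vec_nth])
  then show "smooth_on (snd C ` (fst C \<inter> ?W)) (\<lambda>e. transition R R' (chart_inv C e) $ i $ j)"
    by (rule smooth_on_cong[OF op, rotated]) (use eq C in \<open>auto\<close>)
qed

lemma coord_change_frame_chart: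
  assumes C: "C \<in> M" "C' \<in> M" and R: "R \<in> T" "R' \<in> T"
    and p: "p \<in> fst C" "p \<in> fst C'" "p \<in> fst R" "p \<in> fst R'" "g \<in> GL2"
  shows "coord_change (frame_chart C R) (frame_chart C' R') (snd C p, g) =
    (snd C' p, transition R R' p ** g)"
  unfolding coord_change_def comp_def chart_inv_frame_chart[OF C(1) R(1) p(1,3,5)]
    transition(2)[OF R p(3,4)] frame_chart_frame_pt[OF R(2) p(4)] ..

lemma overlap_frame_chart:
  assumes "R \<in> T"
  shows "snd (frame_chart C R) ` (fst (frame_chart C R) \<inter> fst (frame_chart C' R')) =
    snd C ` (fst C \<inter> (fst R \<inter> (fst C' \<inter> fst R'))) \<times> GL2"
proof -
  have "fst (frame_chart C R) \<inter> fst (frame_chart C' R') =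
      {b \<in> fst (frame_chart C R). fst b \<in> fst C' \<inter> fst R'}"
    by (auto simp: frame_chart_domain)
  then show ?thesis using image_frame_chart[OF assms, of C "fst C' \<inter> fst R'"] by simp
qed

lemma open_overlap:
  assumes "C \<in> M" "C' \<in> M" "R \<in> T" "R' \<in> T"
  shows "open (snd C ` (fst C \<inter> (fst R \<inter> (fst C' \<inter> fst R'))))"
  by (intro M.mopen_open_image M.mopen_Int M.mopen_domain bundle_frame(1) assms)

lemma smooth_atlas_B: "smooth_atlas B"
proof
  fix K assume "K \<in> B"
  then obtain C R where K: "K = frame_chart C R" "C \<in> M" "R \<in> T" unfolding B_eq by blast
  show "inj_on (snd K) (fst K)" unfolding K(1) by (rule inj_on_frame_chart[OF K(2,3)])
  show "open (snd K ` fst K)"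
    using overlap_frame_chart[OF K(3), of C C R] open_overlap[OF K(2,2,3,3)] open_GL2
    unfolding K(1) by (simp add: open_Times)
  fix K' assume "K' \<in> B"
  then obtain C' R' where K': "K' = frame_chart C' R'" "C' \<in> M" "R' \<in> T" unfolding B_eq by blast
  let ?O = "snd C ` (fst C \<inter> (fst R \<inter> (fst C' \<inter> fst R')))"
  have O: "open ?O" by (rule open_overlap[OF K(2) K'(2) K(3) K'(3)])
  have OG: "open (?O \<times> GL2)" using O open_GL2 by (rule open_Times)
  have im: "snd K ` (fst K \<inter> fst K') = ?O \<times> GL2" unfolding K(1) K'(1) by (rule overlap_frame_chart[OF K(3)])
  show "open (snd K ` (fst K \<inter> fst K'))" unfolding im by (rule OG)
  have "smooth_on (?O \<times> GL2) (\<lambda>z. (coord_change C C' (fst z), transition R R' (chart_inv C (fst z)) ** snd z))"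
  proof (intro smooth_on_Pair[OF OG] smooth_on_matrix_mult[OF OG] smooth_on_snd[OF OG] smooth_on_ident[OF OG])
    have fst: "smooth_on (?O \<times> GL2) (\<lambda>z. fst z)" by (intro smooth_on_fst[OF OG] smooth_on_ident[OF OG])
    show "smooth_on (?O \<times> GL2) (\<lambda>z. coord_change C C' (fst z))"
      by (rule smooth_on_compose[OF OG O _ fst])
        (auto intro: smooth_on_subset[OF M.coord_change_smooth[OF K(2) K'(2)]])
    show "smooth_on (?O \<times> GL2) (\<lambda>z. transition R R' (chart_inv C (fst z)))"
      by (rule smooth_on_compose[OF OG O _ fst])
        (auto intro: smooth_on_subset[OF smooth_transition[OF K(2,3) K'(3)]])
  qed
  then show "smooth_on (snd K ` (fst K \<inter> fst K')) (coord_change K K')"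
    unfolding im
  proof (rule smooth_on_cong[OF OG, rotated])
    fix z assume "z \<in> ?O \<times> GL2"
    then obtain p g where "z = (snd C p, g)" "p \<in> fst C" "p \<in> fst C'" "p \<in> fst R" "p \<in> fst R'" "g \<in> GL2"
      by auto
    then show "(coord_change C C' (fst z), transition R R' (chart_inv C (fst z)) ** snd z) = coord_change K K' z"
      unfolding K(1) K'(1)
      using coord_change_frame_chart[OF K(2) K'(2) K(3) K'(3)] M.coord_change_chart[OF K(2)] K(2) by simp
  qed
qed

sublocale B: smooth_atlas B by (rule smooth_atlas_B)

lemma frame_chart_in_B: "C \<in> M \<Longrightarrow> R \<in> T \<Longrightarrow> frame_chart C R \<in> B"
  unfolding B_eq by blast

lemma points_B: "points B = frame_set k M E \<Theta>"
proof (intro equalityI subsetI)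
  fix b assume "b \<in> points B"
  then obtain K where "K \<in> B" "b \<in> fst K" unfolding points_def by blast
  then obtain C R where "b \<in> fst (frame_chart C R)" unfolding B_eq by blast
  then show "b \<in> frame_set k M E \<Theta>" by (simp add: frame_chart_domain)
next
  fix b assume b: "b \<in> frame_set k M E \<Theta>"
  then have p: "fst b \<in> points M" unfolding frame_set_iff by auto
  then obtain C where C: "C \<in> M" "fst b \<in> fst C" unfolding points_def by blast
  have "\<Union> (fst ` T) = points M" using gl2 unfolding gl2_structure_def vector_bundle_def by blast
  then obtain R where R: "R \<in> T" "fst b \<in> fst R" using p by blast
  have "b \<in> fst (frame_chart C R)" using b C R by (simp add: frame_chart_domain)
  then show "b \<in> points B" using frame_chart_in_B[OF C(1) R(1)] unfolding points_def by blast
qed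

lemma point_B_cases:
  assumes "b \<in> points B"
  obtains C R p g where "C \<in> M" "R \<in> T" "p \<in> fst C" "p \<in> fst R" "g \<in> GL2" "b = frame_pt (snd R) p g"
proof -
  obtain K where "K \<in> B" "b \<in> fst K" using assms unfolding points_def by blast
  then obtain C R where CR: "C \<in> M" "R \<in> T" "b \<in> fst (frame_chart C R)" unfolding B_eq by blast
  from CR(2,3) obtain p g where "p \<in> fst C" "p \<in> fst R" "g \<in> GL2" "b = frame_pt (snd R) p g"
    by (rule frame_chart_cases)
  then show ?thesis by (rule that[OF CR(1,2)])
qed

lemma frame_act_frame_pt:
  assumes R: "R \<in> T" "p \<in> fst R"
  shows "frame_act k (frame_pt (snd R) p a) g = frame_pt (snd R) p (a ** g)"
proof -
  have p: "p \<in> points M" using bundle_frame(1)[OF R(1)] R(2) unfolding mopen_def by blast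
  have E: "snd R p w \<in> E p" for w using bundle_frame(4)[OF R] by blast
  show ?thesis
    unfolding frame_pt_def frame_act_power_frame[OF p E E] column_matrix_mult_2
    using bundle_frame(2)[OF R] by (simp add: linear_add linear_cmul)
qed

lemma chart_at_frame_pt:
  assumes "C \<in> M" "R \<in> T" "p \<in> fst C" "p \<in> fst R" "g \<in> GL2"
  shows "chart_at B (frame_pt (snd R) p g) (frame_chart C R)"
  using frame_chart_in_B[OF assms(1,2)] frame_pt_in_domain[OF assms(2-5)] by (simp add: chart_at_def)

lemma open_frame_image:
  assumes "C \<in> M" "R \<in> T" shows "open (snd C ` (fst C \<inter> fst R) \<times> GL2)"
  using M.mopen_open_image[OF bundle_frame(1)[OF assms(2)] assms(1)] open_GL2 by (rule open_Times)

lemma frame_image_cases: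
  assumes "z \<in> snd C ` (fst C \<inter> fst R) \<times> GL2"
  obtains p g where "p \<in> fst C" "p \<in> fst R" "g \<in> GL2" "z = (snd C p, g)"
  using assms by auto

lemma tangent_map_fst:
  assumes C: "C \<in> M" and R: "R \<in> T" and p: "p \<in> fst C" "p \<in> fst R" "g \<in> GL2"
    and v: "v \<in> tangent_space B (frame_pt (snd R) p g)"
  shows "tangent_map B M fst (frame_pt (snd R) p g) v = coord_vec M C p (fst (v (frame_chart C R)))"
proof -
  let ?b = "frame_pt (snd R) p g" and ?K = "frame_chart C R"
  let ?S = "snd C ` (fst C \<inter> fst R) \<times> GL2"
  have S: "open ?S" by (rule open_frame_image[OF C R])
  have z: "snd ?K ?b = (snd C p, g)" by (rule frame_chart_frame_pt[OF R p(2)])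
  have inS: "snd ?K ?b \<in> ?S" using p by (auto simp: z)
  have pt: "chart_inv ?K (snd C q, h) = frame_pt (snd R) q h" if "q \<in> fst C" "q \<in> fst R" "h \<in> GL2" for q h
    by (rule chart_inv_frame_chart[OF C R that])
  have "tangent_map B M fst ?b v = coord_vec M C (fst ?b) (fst (v ?K))"
  proof (rule B.tangent_map_eq_coord_vec[OF M.smooth_atlas_axioms chart_at_frame_pt[OF C R p] _ v _ S inS])
    show "chart_at M (fst ?b) C" using C p by (simp add: chart_at_def)
    show "fst (chart_inv ?K y) \<in> fst C" if "y \<in> ?S" for y
      using that pt by (auto elim!: frame_image_cases)
    show "((snd C \<circ> fst \<circ> chart_inv ?K) has_derivative fst) (at (snd ?K ?b))"
      by (rule has_derivative_transform_within_open[OF bounded_linear.has_derivative[OF bounded_linear_fst has_derivative_ident] S inS])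
        (use pt in auto)
  qed
  then show ?thesis by simp
qed

lemma tangent_map_frame_act:
  assumes C: "C \<in> M" and R: "R \<in> T" and p: "p \<in> fst C" "p \<in> fst R" "a \<in> GL2" and g: "g \<in> GL2"
    and v: "v \<in> tangent_space B (frame_pt (snd R) p a)"
  shows "tangent_map B B (\<lambda>b. frame_act k b g) (frame_pt (snd R) p a) v =
    coord_vec B (frame_chart C R) (frame_pt (snd R) p (a ** g))
      (fst (v (frame_chart C R)), snd (v (frame_chart C R)) ** g)"
proof -
  let ?b = "frame_pt (snd R) p a" and ?K = "frame_chart C R"
  let ?S = "snd C ` (fst C \<inter> fst R) \<times> GL2"
  have S: "open ?S" by (rule open_frame_image[OF C R])
  have z: "snd ?K ?b = (snd C p, a)" by (rule frame_chart_frame_pt[OF R p(2)])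
  have inS: "snd ?K ?b \<in> ?S" using p by (auto simp: z)
  have pt: "chart_inv ?K (snd C q, h) = frame_pt (snd R) q h" if "q \<in> fst C" "q \<in> fst R" "h \<in> GL2" for q h
    by (rule chart_inv_frame_chart[OF C R that])
  have act: "frame_act k (chart_inv ?K (snd C q, h)) g = frame_pt (snd R) q (h ** g)"
    if "q \<in> fst C" "q \<in> fst R" "h \<in> GL2" for q h
    using pt[OF that] frame_act_frame_pt[OF R that(2)] by simp
  have lin: "bounded_linear (\<lambda>z::'e \<times> (real^2^2). (fst z, snd z ** g))"
    by (simp add: linear_conv_bounded_linear[symmetric])
      (rule linearI; simp add: matrix_matrix_mult_def vec_eq_iff sum.distrib sum_distrib_left algebra_simps)
  have "tangent_map B B (\<lambda>b. frame_act k b g) ?b v =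
      coord_vec B ?K (frame_act k ?b g) (fst (v ?K), snd (v ?K) ** g)"
  proof (rule B.tangent_map_eq_coord_vec[OF smooth_atlas_B chart_at_frame_pt[OF C R p] _ v _ S inS])
    show "chart_at B (frame_act k ?b g) ?K"
      unfolding frame_act_frame_pt[OF R p(2)]
      by (rule chart_at_frame_pt[OF C R p(1,2) matrix_mult_in_GL2[OF p(3) g]])
    show "frame_act k (chart_inv ?K y) g \<in> fst ?K" if "y \<in> ?S" for y
    proof -
      from that obtain q h where q: "q \<in> fst C" "q \<in> fst R" "h \<in> GL2" "y = (snd C q, h)"
        by (rule frame_image_cases)
      show ?thesis unfolding q(4) act[OF q(1-3)]
        by (rule frame_pt_in_domain[OF R q(1,2) matrix_mult_in_GL2[OF q(3) g]])
    qed
    show "((snd ?K \<circ> (\<lambda>b. frame_act k b g) \<circ> chart_inv ?K) has_derivative (\<lambda>z. (fst z, snd z ** g)))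
        (at (snd ?K ?b))"
    proof (rule has_derivative_transform_within_open[OF bounded_linear.has_derivative[OF lin has_derivative_ident] S inS])
      fix y assume "y \<in> ?S"
      then obtain q h where q: "q \<in> fst C" "q \<in> fst R" "h \<in> GL2" "y = (snd C q, h)"
        by (rule frame_image_cases)
      show "(fst y, snd y ** g) = (snd ?K \<circ> (\<lambda>b. frame_act k b g) \<circ> chart_inv ?K) y"
        unfolding comp_def q(4) act[OF q(1-3)] by (simp add: frame_chart_frame_pt[OF R q(2)])
    qed
  qed
  then show ?thesis by (simp add: frame_act_frame_pt[OF R p(2)])
qed

lemma fundamental_vector:
  assumes C: "C \<in> M" and R: "R \<in> T" and p: "p \<in> fst C" "p \<in> fst R" "a \<in> GL2"
  shows "velocity B (\<lambda>t. frame_act k (frame_pt (snd R) p a) (mat 1 + t *\<^sub>R X)) =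
    coord_vec B (frame_chart C R) (frame_pt (snd R) p a) (0, a ** X)"
proof -
  let ?K = "frame_chart C R" and ?\<gamma> = "\<lambda>t. frame_act k (frame_pt (snd R) p a) (mat 1 + t *\<^sub>R X)"
  have \<gamma>: "?\<gamma> t = frame_pt (snd R) p (a + t *\<^sub>R (a ** X))" for t
    unfolding frame_act_frame_pt[OF R p(2)]
    by (rule arg_cong[of _ _ "frame_pt (snd R) p"])
      (simp add: matrix_matrix_mult_def vec_eq_iff sum_2 forall_2 mat_def algebra_simps)
  let ?O = "(\<lambda>t::real. a + t *\<^sub>R (a ** X)) -` GL2"
  have O: "open ?O" by (intro open_vimage open_GL2 continuous_intros)
  have "velocity B ?\<gamma> = coord_vec B ?K (?\<gamma> 0) (0, a ** X)"
  proof (rule B.velocity_eq_coord_vec[OF _ _ O])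
    show "chart_at B (?\<gamma> 0) ?K" unfolding \<gamma> using chart_at_frame_pt[OF C R p] by simp
    have eq: "snd ?K \<circ> ?\<gamma> = (\<lambda>t. (snd C p, a + t *\<^sub>R (a ** X)))"
      by (simp add: fun_eq_iff \<gamma> frame_chart_frame_pt[OF R p(2)])
    show "((snd ?K \<circ> ?\<gamma>) has_vector_derivative (0, a ** X)) (at 0)"
      unfolding eq has_vector_derivative_def by (auto intro!: derivative_eq_intros)
    show "?\<gamma> t \<in> fst ?K" if "t \<in> ?O" for t
      unfolding \<gamma> using that frame_pt_in_domain[OF R p(1,2)] by simp
  qed (use p in simp)
  then show ?thesis unfolding \<gamma> by simp
qed

end

section \<open>The forms \<open>\<xi>\<close> and \<open>\<zeta>\<close> in coordinates\<close>

text \<open>Conformal matrices, acting from the right, commute with the complex structure on the rows in which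
  a row \<open>(a, b)\<close> is \<open>a + \<i> b\<close>.\<close>

definition row_z :: "real^2^2 \<Rightarrow> 2 \<Rightarrow> complex" where
  "row_z g i = Complex (g$i$1) (g$i$2)"

definition zeta_mat :: "real^2^2 \<Rightarrow> complex" where
  "zeta_mat A = Complex (A$2$1 + A$1$2) (A$2$2 - A$1$1)"

definition conformal :: "real \<Rightarrow> real \<Rightarrow> real^2^2" where
  "conformal u v = vector [vector [u, - v], vector [v, u]]"

lemma conformal_entries [simp]:
  "conformal u v $ 1 $ 1 = u" "conformal u v $ 1 $ 2 = - v"
  "conformal u v $ 2 $ 1 = v" "conformal u v $ 2 $ 2 = u"
  by (simp_all add: conformal_def)

lemma CO2_eq: "CO2 = {conformal u v | u v. u\<^sup>2 + v\<^sup>2 \<noteq> 0}"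
  by (simp add: CO2_def conformal_def)

lemma zeta_form_eq: "zeta_form \<phi> b v = zeta_mat (\<phi> b v)"
  by (simp add: zeta_form_def zeta_mat_def complex_eq_iff)

lemma linear_zeta_mat: "linear zeta_mat"
  by (rule linearI) (simp_all add: zeta_mat_def complex_eq_iff algebra_simps)

text \<open>The left side is, up to the square of \<open>row_z g 1\<close>, the derivative of \<open>row_z g 2 / row_z g 1\<close> in the
  direction \<open>g ** Y\<close>. This identity links \<open>\<zeta>\<close> with the quotient by conformal matrices.\<close>

lemma det_zeta_mat:
  "row_z g 1 * row_z (g ** Y) 2 - row_z g 2 * row_z (g ** Y) 1 = of_real (det g) * zeta_mat Y"
  by (simp add: row_z_def zeta_mat_def complex_eq_iff matrix_matrix_mult_def sum_2 det_2 algebra_simps)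

text \<open>Up to the factor \<open>- \<i>\<close>, \<open>zeta_mat\<close> is the value of the quadratic form of \<open>A\<close> at the isotropic
  vector \<open>(1, \<i>)\<close>, which is an eigenvector of every conformal matrix.\<close>

lemma zeta_mat_conformal:
  assumes "conformal u v ** A' = A ** conformal u v"
  shows "of_real (u\<^sup>2 + v\<^sup>2) * zeta_mat A' = Complex u (- v) ^ 2 * zeta_mat A"
proof -
  have "transpose (conformal u v) ** (conformal u v ** A') = transpose (conformal u v) ** (A ** conformal u v)"
    by (simp only: assms)
  then have "zeta_mat (transpose (conformal u v) ** (conformal u v ** A')) =
      zeta_mat (transpose (conformal u v) ** (A ** conformal u v))" by simp
  moreover have "zeta_mat (transpose (conformal u v) ** (conformal u v ** A')) = of_real (u\<^sup>2 + v\<^sup>2) * zeta_mat A'"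
    by (simp add: zeta_mat_def complex_eq_iff matrix_matrix_mult_def sum_2 transpose_def
        algebra_simps power2_eq_square)
  moreover have "zeta_mat (transpose (conformal u v) ** (A ** conformal u v)) = Complex u (- v) ^ 2 * zeta_mat A"
    by (simp add: zeta_mat_def complex_eq_iff matrix_matrix_mult_def sum_2 transpose_def
        algebra_simps power2_eq_square)
  ultimately show ?thesis by simp
qed

lemma conformal_in_GL2: "u\<^sup>2 + v\<^sup>2 \<noteq> 0 \<Longrightarrow> conformal u v \<in> GL2"
proof -
  assume "u\<^sup>2 + v\<^sup>2 \<noteq> 0"
  moreover have "det (conformal u v) = u\<^sup>2 + v\<^sup>2" by (simp add: det_2 power2_eq_square)
  ultimately show ?thesis by (simp add: invertible_det_nz)
qed

lemma CO2_subset_GL2: "CO2 \<subseteq> GL2"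
  unfolding CO2_eq using conformal_in_GL2 by blast

lemma mat_1_in_CO2: "mat 1 \<in> CO2"
  unfolding CO2_eq
  by (rule CollectI, rule exI[of _ 1], rule exI[of _ 0]) (simp add: vec_eq_iff forall_2 mat_def)

lemma matrix_inv_mult:
  fixes g :: "real^2^2"
  assumes "g \<in> GL2"
  shows "matrix_inv g ** g = mat 1" "g ** matrix_inv g = mat 1"
proof -
  have "\<exists>h. g ** h = mat 1 \<and> h ** g = mat 1" using assms unfolding invertible_def by blast
  then have "g ** matrix_inv g = mat 1 \<and> matrix_inv g ** g = mat 1"
    unfolding matrix_inv_def by (rule someI_ex)
  then show "matrix_inv g ** g = mat 1" "g ** matrix_inv g = mat 1" by blast+
qed

context gl2_bundle
begin

lemma frame_of_point:
  assumes "b \<in> points B"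
  shows "fst b \<in> points M" "indep_family {..k} (snd b)" "span (snd b ` {..k}) = tangent_space M (fst b)"
proof -
  obtain p x y where b: "b = (p, power_frame k \<Theta> p x y)" "p \<in> points M" "plane_basis p x y"
    using assms unfolding points_B frame_set_iff by blast
  show "fst b \<in> points M" using b by simp
  show "indep_family {..k} (snd b)" using indep_power_frame[OF b(2,3)] b(1) by simp
  show "span (snd b ` {..k}) = tangent_space M (fst b)" using span_power_frame[OF b(2,3)] b(1) by simp
qed

lemma soldering_eqI:
  assumes b: "b \<in> points B" and "tangent_map B M fst b v = (\<Sum>i\<le>k. a i *\<^sub>R snd b i)"
  shows "soldering k M B b v = (\<Sum>i\<le>k. a i *\<^sub>R mono_xy k i)"
  unfolding soldering_def assms(2)
  by (intro sum.cong refl arg_cong[of _ _ "\<lambda>r. r *\<^sub>R _"])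
    (rule indep_family_representation[OF _ frame_of_point(2)[OF b]], auto)

lemma tangent_map_fst_in:
  assumes b: "b \<in> points B" and v: "v \<in> tangent_space B b"
  shows "tangent_map B M fst b v \<in> tangent_space M (fst b)"
proof -
  obtain C R p g where *: "C \<in> M" "R \<in> T" "p \<in> fst C" "p \<in> fst R" "g \<in> GL2" "b = frame_pt (snd R) p g"
    using b by (rule point_B_cases)
  have "chart_at M p C" using * by (simp add: chart_at_def)
  then show ?thesis
    using tangent_map_fst[OF *(1-5)] v *(6) M.coord_vec_in_tangent_space by simp
qed

lemma soldering_expand:
  assumes b: "b \<in> points B" and v: "v \<in> tangent_space B b"
  obtains a where "tangent_map B M fst b v = (\<Sum>i\<le>k. a i *\<^sub>R snd b i)"
    "soldering k M B b v = (\<Sum>i\<le>k. a i *\<^sub>R mono_xy k i)"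
proof -
  have "tangent_map B M fst b v \<in> span (snd b ` {..k})"
    using tangent_map_fst_in[OF b v] frame_of_point(3)[OF b] by simp
  then obtain a where "tangent_map B M fst b v = (\<Sum>i\<le>k. a i *\<^sub>R snd b i)"
    unfolding span_family_iff[OF finite_atMost] by blast
  then show ?thesis using that soldering_eqI[OF b] by blast
qed

lemma soldering_in_forms:
  assumes "b \<in> points B" "v \<in> tangent_space B b"
  shows "soldering k M B b v \<in> forms k"
proof -
  obtain a where "soldering k M B b v = (\<Sum>i\<le>k. a i *\<^sub>R mono_xy k i)"
    using soldering_expand[OF assms] by blast
  then show ?thesis unfolding forms_iff by blast
qed

lemma tangent_map_fst_linear:
  assumes b: "b \<in> points B" and u: "u \<in> tangent_space B b" and v: "v \<in> tangent_space B b"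
  shows "tangent_map B M fst b (r *\<^sub>R u + s *\<^sub>R v) =
    r *\<^sub>R tangent_map B M fst b u + s *\<^sub>R tangent_map B M fst b v"
proof -
  obtain C R p g where *: "C \<in> M" "R \<in> T" "p \<in> fst C" "p \<in> fst R" "g \<in> GL2" "b = frame_pt (snd R) p g"
    using b by (rule point_B_cases)
  have "chart_at M p C" using * by (simp add: chart_at_def)
  note lin = M.coord_vec_linear[OF this]
  have uv: "r *\<^sub>R u + s *\<^sub>R v \<in> tangent_space B b"
    using u v B.tangent_space_subspace by (intro subspace_add subspace_scale) auto
  show ?thesis
    using tangent_map_fst[OF *(1-5)] u v uv *(6)
    by (simp add: linear_add[OF lin] linear_cmul[OF lin] scaleR_fun_apply)
qed

lemma soldering_linear:
  assumes b: "b \<in> points B" and u: "u \<in> tangent_space B b" and v: "v \<in> tangent_space B b"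
  shows "soldering k M B b (r *\<^sub>R u + s *\<^sub>R v) = r *\<^sub>R soldering k M B b u + s *\<^sub>R soldering k M B b v"
proof -
  obtain a where a: "tangent_map B M fst b u = (\<Sum>i\<le>k. a i *\<^sub>R snd b i)"
    "soldering k M B b u = (\<Sum>i\<le>k. a i *\<^sub>R mono_xy k i)" using soldering_expand[OF b u] by blast
  obtain c where c: "tangent_map B M fst b v = (\<Sum>i\<le>k. c i *\<^sub>R snd b i)"
    "soldering k M B b v = (\<Sum>i\<le>k. c i *\<^sub>R mono_xy k i)" using soldering_expand[OF b v] by blast
  have lin: "r *\<^sub>R (\<Sum>i\<le>k. a i *\<^sub>R f i) + s *\<^sub>R (\<Sum>i\<le>k. c i *\<^sub>R f i) = (\<Sum>i\<le>k. (r * a i + s * c i) *\<^sub>R f i)"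
    for f :: "nat \<Rightarrow> 'w::real_vector"
    by (simp add: scaleR_sum_right sum.distrib[symmetric] scaleR_add_left)
  show ?thesis
    unfolding a(2) c(2) lin
    by (rule soldering_eqI[OF b]) (simp only: tangent_map_fst_linear[OF b u v] a(1) c(1) lin)
qed

lemma frame_act_in_points:
  assumes "b \<in> points B" "g \<in> GL2"
  shows "frame_act k b g \<in> points B"
proof -
  obtain C R p a where *: "C \<in> M" "R \<in> T" "p \<in> fst C" "p \<in> fst R" "a \<in> GL2" "b = frame_pt (snd R) p a"
    using assms(1) by (rule point_B_cases)
  show ?thesis
    unfolding *(6) frame_act_frame_pt[OF *(2,4)] points_B
    by (rule frame_pt_in_frame_set[OF *(2,4) matrix_mult_in_GL2[OF *(5) assms(2)]])
qed

lemma tangent_map_frame_act_in: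
  assumes "b \<in> points B" "g \<in> GL2" "v \<in> tangent_space B b"
  shows "tangent_map B B (\<lambda>b. frame_act k b g) b v \<in> tangent_space B (frame_act k b g)"
proof -
  obtain C R p a where *: "C \<in> M" "R \<in> T" "p \<in> fst C" "p \<in> fst R" "a \<in> GL2" "b = frame_pt (snd R) p a"
    using assms(1) by (rule point_B_cases)
  show ?thesis
    using tangent_map_frame_act[OF *(1-5) assms(2)] assms(3)
      B.coord_vec_in_tangent_space[OF chart_at_frame_pt[OF *(1-4) matrix_mult_in_GL2[OF *(5) assms(2)]]]
    unfolding *(6) frame_act_frame_pt[OF *(2,4)] by simp
qed

lemma tangent_map_fst_frame_act:
  assumes "b \<in> points B" "g \<in> GL2" "v \<in> tangent_space B b"
  shows "tangent_map B M fst (frame_act k b g) (tangent_map B B (\<lambda>b. frame_act k b g) b v) =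
    tangent_map B M fst b v"
proof -
  obtain C R p a where *: "C \<in> M" "R \<in> T" "p \<in> fst C" "p \<in> fst R" "a \<in> GL2" "b = frame_pt (snd R) p a"
    using assms(1) by (rule point_B_cases)
  note ag = matrix_mult_in_GL2[OF *(5) assms(2)]
  have v: "v \<in> tangent_space B (frame_pt (snd R) p a)" using assms(3) *(6) by simp
  show ?thesis
    unfolding *(6) frame_act_frame_pt[OF *(2,4)] tangent_map_frame_act[OF *(1-5) assms(2) v]
      tangent_map_fst[OF *(1-4) ag B.coord_vec_in_tangent_space[OF chart_at_frame_pt[OF *(1-4) ag]]]
      tangent_map_fst[OF *(1-5) v]
    by (simp add: B.coord_vec_self[OF chart_at_frame_pt[OF *(1-4) ag]])
qed

text \<open>The frame at \<open>b g\<close> is the frame at \<open>b\<close> times \<open>\<rho>\<^sub>k(g)\<close>, so the form associated with a vector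
  transforms by the inverse of \<open>g\<close>.\<close>

lemma soldering_frame_act:
  assumes b: "b \<in> points B" and g: "g \<in> GL2" and v: "v \<in> tangent_space B b"
  shows "soldering k M B b v =
    poly_act (soldering k M B (frame_act k b g) (tangent_map B B (\<lambda>b. frame_act k b g) b v)) g"
proof -
  let ?v = "tangent_map B B (\<lambda>b. frame_act k b g) b v"
  obtain a where a: "tangent_map B M fst (frame_act k b g) ?v = (\<Sum>i\<le>k. a i *\<^sub>R snd (frame_act k b g) i)"
    "soldering k M B (frame_act k b g) ?v = (\<Sum>i\<le>k. a i *\<^sub>R mono_xy k i)"
    using soldering_expand[OF frame_act_in_points[OF b g] tangent_map_frame_act_in[OF b g v]] by blast
  have "tangent_map B M fst b v = (\<Sum>i\<le>k. a i *\<^sub>R (\<Sum>j\<le>k. rho k g j i *\<^sub>R snd b j))"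
    unfolding tangent_map_fst_frame_act[OF b g v, symmetric] a(1)
    by (intro sum.cong) (auto simp: frame_act_def)
  also have "\<dots> = (\<Sum>i\<le>k. \<Sum>j\<le>k. (rho k g j i * a i) *\<^sub>R snd b j)"
    by (simp add: scaleR_sum_right mult.commute)
  also have "\<dots> = (\<Sum>j\<le>k. (\<Sum>i\<le>k. rho k g j i * a i) *\<^sub>R snd b j)"
    by (subst sum.swap) (simp add: scaleR_sum_left)
  finally show ?thesis
    unfolding a(2) poly_act_form by (rule soldering_eqI[OF b])
qed

definition xi_char :: "real \<Rightarrow> real \<Rightarrow> nat \<Rightarrow> complex" where
  "xi_char u v j = cnj (of_real (u\<^sup>2 + v\<^sup>2) ^ j * Complex u (- v) ^ (k - 2 * j))"

text \<open>\<open>V_cplx k j\<close> is an eigenvector of every conformal matrix, with eigenvalue the conjugate of \<open>xi_char u v j\<close>; its dual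
  coordinate is therefore multiplied by \<open>xi_char u v j\<close>.\<close>

lemma xi_form_conformal:
  assumes b: "b \<in> points B" and uv: "u\<^sup>2 + v\<^sup>2 \<noteq> 0" and w: "w \<in> tangent_space B b" and j: "j \<le> k div 2"
  defines "h \<equiv> conformal u v"
  shows "xi_form k j M B b w = xi_char u v j * xi_form k j M B (frame_act k b h) (tangent_map B B (\<lambda>b. frame_act k b h) b w)"
proof -
  have h: "h \<in> GL2" unfolding h_def by (rule conformal_in_GL2[OF uv])
  define P where "P = soldering k M B (frame_act k b h) (tangent_map B B (\<lambda>b. frame_act k b h) b w)"
  have P: "P \<in> forms k"
    unfolding P_def by (rule soldering_in_forms[OF frame_act_in_points[OF b h] tangent_map_frame_act_in[OF b h w]])
  have "soldering k M B b w = poly_act P h"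
    unfolding P_def by (rule soldering_frame_act[OF b h w])
  also have "poly_act P h = form_of_xi k (\<lambda>j. xi_char u v j * xi_lin k j P)"
    using poly_act_form_of_xi[of k "\<lambda>j. xi_lin k j P" u v]
    unfolding form_of_xi_xi_lin[OF odd_k P] h_def conformal_def xi_char_def .
  finally have "xi_lin k j (soldering k M B b w) = xi_char u v j * xi_lin k j P"
    by (simp add: xi_lin_form_of_xi[OF odd_k j])
  then show ?thesis unfolding xi_form_def P_def .
qed

lemma xi_char_nonzero: "u\<^sup>2 + v\<^sup>2 \<noteq> 0 \<Longrightarrow> xi_char u v j \<noteq> 0"
proof -
  assume uv: "u\<^sup>2 + v\<^sup>2 \<noteq> 0"
  then have "Complex u (- v) \<noteq> 0" by (auto simp: complex_eq_iff)
  moreover have "complex_of_real (u\<^sup>2 + v\<^sup>2) \<noteq> 0" using uv by (simp only: of_real_eq_0_iff) simp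
  ultimately have "complex_of_real (u\<^sup>2 + v\<^sup>2) ^ j \<noteq> 0" "Complex u (- v) ^ (k - 2 * j) \<noteq> 0"
    by (simp_all only: power_not_zero not_False_eq_True)
  then show ?thesis unfolding xi_char_def by (metis complex_cnj_zero_iff mult_eq_0_iff)
qed

end

locale gl2_bundle_connection = gl2_bundle k M E T \<Theta>
  for k :: nat and M :: "('m, 'e::euclidean_space) atlas" and E :: "'m \<Rightarrow> 'v::real_vector set"
    and T :: "('m, real^2, 'v) frames" and \<Theta> :: "'m \<Rightarrow> (('v \<Rightarrow> real) \<Rightarrow> real) \<Rightarrow> ('m, 'e) tvec" +
  fixes \<phi> :: "('m, 'e) fpoint \<Rightarrow> (('m, 'e) fpoint, 'e \<times> (real^2^2)) tvec \<Rightarrow> real^2^2"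
  assumes connection: "gl2_connection k (frame_bundle k M E T \<Theta>) \<phi>"
begin

lemma k_pos: "k \<ge> 1"
  using odd_k by (cases k) auto

lemma connection_linear:
  assumes "b \<in> points B" "u \<in> tangent_space B b" "v \<in> tangent_space B b"
  shows "\<phi> b (r *\<^sub>R u + s *\<^sub>R v) = r *\<^sub>R \<phi> b u + s *\<^sub>R \<phi> b v"
  using connection assms unfolding gl2_connection_def smooth_form_def linear_on_def by blast

text \<open>The hypothesis on a connection is expressed by \<open>d\<rho>\<^sub>k\<close>, which is injective.\<close>

lemma connection_fundamental:
  assumes "b \<in> points B"
  shows "\<phi> b (velocity B (\<lambda>t. frame_act k b (mat 1 + t *\<^sub>R X))) = X"
  by (rule drho_inj[OF k_pos])
    (use connection assms in \<open>unfold gl2_connection_def principal_connection_def, blast\<close>)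

lemma connection_equivariant:
  assumes b: "b \<in> points B" and v: "v \<in> tangent_space B b" and g: "g \<in> GL2"
  shows "\<phi> (frame_act k b g) (tangent_map B B (\<lambda>b. frame_act k b g) b v) = matrix_inv g ** \<phi> b v ** g"
proof (rule drho_inj[OF k_pos])
  fix i j assume ij: "i \<le> k" "j \<le> k"
  have "drho k (\<phi> (frame_act k b g) (tangent_map B B (\<lambda>b. frame_act k b g) b v)) i j =
      nmat_mult k (rho k (matrix_inv g)) (nmat_mult k (drho k (\<phi> b v)) (rho k g)) i j"
    using connection b v g ij unfolding gl2_connection_def principal_connection_def by blast
  also have "\<dots> = drho k (matrix_inv g ** \<phi> b v ** g) i j"
    by (rule drho_conjugate[OF ij matrix_inv_mult(1)[OF g], symmetric])
  finally show "drho k (\<phi> (frame_act k b g) (tangent_map B B (\<lambda>b. frame_act k b g) b v)) i j =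
      drho k (matrix_inv g ** \<phi> b v ** g) i j" .
qed

lemma zeta_form_linear:
  assumes "b \<in> points B" "u \<in> tangent_space B b" "v \<in> tangent_space B b"
  shows "zeta_form \<phi> b (r *\<^sub>R u + s *\<^sub>R v) = r *\<^sub>R zeta_form \<phi> b u + s *\<^sub>R zeta_form \<phi> b v"
  unfolding zeta_form_eq connection_linear[OF assms]
  by (simp add: linear_add[OF linear_zeta_mat] linear_cmul[OF linear_zeta_mat])

lemma xi_form_linear:
  assumes "b \<in> points B" "u \<in> tangent_space B b" "v \<in> tangent_space B b" "j \<le> k div 2"
  shows "xi_form k j M B b (r *\<^sub>R u + s *\<^sub>R v) = r *\<^sub>R xi_form k j M B b u + s *\<^sub>R xi_form k j M B b v"
  unfolding xi_form_def soldering_linear[OF assms(1-3)]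
  by (rule xi_lin_linear[OF odd_k soldering_in_forms soldering_in_forms]) (use assms in auto)

lemma zeta_form_conformal:
  assumes b: "b \<in> points B" and uv: "u\<^sup>2 + v\<^sup>2 \<noteq> 0" and w: "w \<in> tangent_space B b"
  defines "h \<equiv> conformal u v"
  shows "of_real (u\<^sup>2 + v\<^sup>2) * zeta_form \<phi> (frame_act k b h) (tangent_map B B (\<lambda>b. frame_act k b h) b w) =
    Complex u (- v) ^ 2 * zeta_form \<phi> b w"
proof -
  have h: "h \<in> GL2" unfolding h_def by (rule conformal_in_GL2[OF uv])
  have "h ** (matrix_inv h ** \<phi> b w ** h) = \<phi> b w ** h"
    by (simp add: matrix_mul_assoc matrix_inv_mult[OF h])
  then show ?thesis
    unfolding zeta_form_eq connection_equivariant[OF b w h] unfolding h_def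
    by (rule zeta_mat_conformal)
qed

text \<open>In the coordinates \<open>(e, g)\<close> the connection is determined by its values on vectors
  tangent to the slices of constant \<open>g\<close>.\<close>

definition horizontal_zeta ::
  "('m, 'e) chart \<Rightarrow> 'm set \<times> ('m \<Rightarrow> real^2 \<Rightarrow> 'v) \<Rightarrow> ('m, 'e) fpoint \<Rightarrow> 'e \<Rightarrow> complex" where
  "horizontal_zeta C R b e = zeta_mat (\<phi> b (coord_vec B (frame_chart C R) b (e, 0)))"

lemma zeta_form_coordinates:
  assumes C: "C \<in> M" and R: "R \<in> T" and p: "p \<in> fst C" "p \<in> fst R" "g \<in> GL2"
  defines "b \<equiv> frame_pt (snd R) p g"
  shows "zeta_form \<phi> b (coord_vec B (frame_chart C R) b (e, g ** Y)) =
    horizontal_zeta C R b e + zeta_mat Y"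
proof -
  let ?K = "frame_chart C R"
  have at: "chart_at B b ?K" unfolding b_def by (rule chart_at_frame_pt[OF C R p])
  have b: "b \<in> points B" unfolding b_def points_B by (rule frame_pt_in_frame_set[OF R p(2,3)])
  note cv = B.coord_vec_in_tangent_space[OF at]
  have "coord_vec B ?K b (e, g ** Y) = coord_vec B ?K b ((e, 0) + (0, g ** Y))" by simp
  also have "\<dots> = 1 *\<^sub>R coord_vec B ?K b (e, 0) + 1 *\<^sub>R coord_vec B ?K b (0, g ** Y)"
    unfolding linear_add[OF B.coord_vec_linear[OF at]] by (simp only: scaleR_one)
  finally have "\<phi> b (coord_vec B ?K b (e, g ** Y)) =
      1 *\<^sub>R \<phi> b (coord_vec B ?K b (e, 0)) + 1 *\<^sub>R \<phi> b (coord_vec B ?K b (0, g ** Y))"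
    by (simp only: connection_linear[OF b cv cv])
  moreover have "\<phi> b (coord_vec B ?K b (0, g ** Y)) = Y"
    using connection_fundamental[OF b, of Y]
    unfolding b_def fundamental_vector[OF C R p] .
  ultimately show ?thesis
    unfolding zeta_form_eq horizontal_zeta_def by (simp add: linear_add[OF linear_zeta_mat])
qed

text \<open>The base component of \<open>v\<close> is prescribed by \<open>P\<close>; adding a vertical vector then adjusts the value of
  \<open>\<zeta>\<close> without changing that of \<open>\<omega>\<close>.\<close>

lemma forms_surjective:
  assumes b: "b \<in> points B" and P: "P \<in> forms k"
  obtains v where "v \<in> tangent_space B b" "soldering k M B b v = P" "zeta_form \<phi> b v = z"
proof -
  obtain C R p g where *: "C \<in> M" "R \<in> T" "p \<in> fst C" "p \<in> fst R" "g \<in> GL2" "b = frame_pt (snd R) p g"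
    using b by (rule point_B_cases)
  let ?K = "frame_chart C R"
  have at: "chart_at B b ?K" unfolding *(6) by (rule chart_at_frame_pt[OF *(1-5)])
  have atM: "chart_at M p C" using * by (simp add: chart_at_def)
  obtain a where a: "P = (\<Sum>i\<le>k. a i *\<^sub>R mono_xy k i)" using P unfolding forms_iff by blast
  define x where "x = (\<Sum>i\<le>k. a i *\<^sub>R snd b i)"
  have x: "x \<in> tangent_space M p"
    using frame_of_point(3)[OF b] *(6) unfolding x_def
    by (metis (no_types, lifting) fst_frame_pt imageI span_base span_scale span_sum)
  define z' where "z' = z - horizontal_zeta C R b (x C)"
  define Y :: "real^2^2" where "Y = vector [vector [0, 0], vector [Re z', Im z']]"
  have Y: "zeta_mat Y = z'" by (simp add: Y_def zeta_mat_def complex_eq_iff)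
  define v where "v = coord_vec B ?K b (x C, g ** Y)"
  have v: "v \<in> tangent_space B b" unfolding v_def by (rule B.coord_vec_in_tangent_space[OF at])
  have "tangent_map B M fst b v = coord_vec M C p (fst (v ?K))"
    using tangent_map_fst[OF *(1-5)] v *(6) by simp
  also have "\<dots> = x"
    unfolding v_def by (simp add: B.coord_vec_self[OF at] M.coord_vec_eq[OF x atM])
  finally have "soldering k M B b v = P" unfolding a x_def by (rule soldering_eqI[OF b])
  moreover have "zeta_form \<phi> b v = z"
    using zeta_form_coordinates[OF *(1-5), of "x C" Y] *(6)
    by (simp add: v_def Y z'_def)
  ultimately show ?thesis using that v by blast
qed

end

section \<open>The quotient by conformal matrices\<close>

definition ratio :: "real^2^2 \<Rightarrow> complex" where
  "ratio g = row_z g 2 / row_z g 1"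

text \<open>A section of \<^const>\<open>ratio\<close>, smooth and invertible over the non-real numbers.\<close>

definition ratio_matrix :: "complex \<Rightarrow> real^2^2" where
  "ratio_matrix w = vector [vector [1, 0], vector [Re w, Im w]]"

abbreviation non_real :: "complex set" where "non_real \<equiv> {w. Im w \<noteq> 0}"

lemma open_non_real: "open non_real"
proof -
  have "non_real = Im -` (- {0})" by auto
  also have "open \<dots>" by (intro open_vimage open_Compl continuous_intros)
  finally show ?thesis .
qed

lemma ratio_matrix_entries [simp]:
  "ratio_matrix w $ 1 $ 1 = 1" "ratio_matrix w $ 1 $ 2 = 0"
  "ratio_matrix w $ 2 $ 1 = Re w" "ratio_matrix w $ 2 $ 2 = Im w"
  by (simp_all add: ratio_matrix_def)

lemma ratio_ratio_matrix [simp]: "ratio (ratio_matrix w) = w"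
  by (simp add: ratio_def row_z_def one_complex.code[symmetric])

lemma det_ratio_matrix: "det (ratio_matrix w) = Im w"
  by (simp add: det_2)

lemma ratio_matrix_in_GL2: "w \<in> non_real \<Longrightarrow> ratio_matrix w \<in> GL2"
  by (simp add: invertible_det_nz det_ratio_matrix)

lemma linear_row_z: "linear (\<lambda>g. row_z g i)"
  by (rule linearI) (simp_all add: row_z_def complex_eq_iff)

lemma det_row_z: "det g = Im (cnj (row_z g 1) * row_z g 2)"
  by (simp add: det_2 row_z_def)

lemma row_z_nonzero: "g \<in> GL2 \<Longrightarrow> row_z g 1 \<noteq> 0"
  by (auto simp: invertible_det_nz det_row_z)

lemma ratio_non_real:
  assumes "g \<in> GL2" shows "ratio g \<in> non_real"
proof -
  have "row_z g 2 = ratio g * row_z g 1" using row_z_nonzero[OF assms] by (simp add: ratio_def)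
  then have "det g = Im (ratio g * of_real ((cmod (row_z g 1))\<^sup>2))"
    unfolding det_row_z by (metis complex_norm_square mult.assoc mult.commute)
  then show ?thesis using assms by (auto simp: invertible_det_nz)
qed

lemma row_z_conformal: "row_z (g ** conformal u v) i = Complex u (- v) * row_z g i"
  by (simp add: row_z_def complex_eq_iff matrix_matrix_mult_def sum_2 algebra_simps)

lemma Complex_conformal_nonzero: "u\<^sup>2 + v\<^sup>2 \<noteq> 0 \<Longrightarrow> Complex u (- v) \<noteq> 0"
  by (auto simp: complex_eq_iff)

lemma ratio_CO2: "h \<in> CO2 \<Longrightarrow> ratio (g ** h) = ratio g"
  unfolding CO2_eq by (auto simp: ratio_def row_z_conformal Complex_conformal_nonzero)

text \<open>The rows of \<open>g\<close>, read as complex numbers, are multiplied by \<open>u - \<i> v\<close> when a conformal matrix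
  is applied from the right; so the orbits of conformal matrices in \<open>GL(2)\<close> are classified by the
  ratio of the rows, which can be any non-real number.\<close>

lemma ratio_eq_imp_CO2:
  assumes g: "g \<in> GL2" and g': "g' \<in> GL2" and eq: "ratio g = ratio g'"
  obtains h where "h \<in> CO2" "g' = g ** h"
proof -
  define z where "z = row_z g' 1 / row_z g 1"
  note nz = row_z_nonzero[OF g] row_z_nonzero[OF g']
  have z: "z \<noteq> 0" using nz by (simp add: z_def)
  have "row_z (g ** conformal (Re z) (- Im z)) i = z * row_z g i" for i
    by (simp add: row_z_conformal)
  moreover have "z * row_z g 1 = row_z g' 1" using nz by (simp add: z_def)
  moreover have "z * row_z g 2 = row_z g' 2"
    using eq nz by (simp add: z_def ratio_def field_simps)
  ultimately have "row_z (g ** conformal (Re z) (- Im z)) i = row_z g' i" for i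
    using exhaust_2[of i] by metis
  then have "g ** conformal (Re z) (- Im z) = g'"
    by (simp add: row_z_def vec_eq_iff forall_2 complex_eq_iff)
  moreover have "conformal (Re z) (- Im z) \<in> CO2"
    unfolding CO2_eq using z
    by (intro CollectI exI[of _ "Re z"] exI[of _ "- Im z"]) (auto simp: complex_eq_iff sum_power2_eq_zero_iff)
  ultimately show ?thesis using that by metis
qed

lemma ratio_has_derivative:
  assumes "g \<in> GL2"
  shows "(ratio has_derivative (\<lambda>X. of_real (det g) / (row_z g 1)\<^sup>2 * zeta_mat (matrix_inv g ** X))) (at g)"
proof -
  have row: "((\<lambda>g. row_z g i) has_derivative (\<lambda>X. row_z X i)) (at g)" for i
    using linear_row_z by (simp add: linear_conv_bounded_linear bounded_linear_imp_has_derivative)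
  have "((\<lambda>g. row_z g 2 / row_z g 1) has_derivative
      (\<lambda>X. - row_z g 2 * (inverse (row_z g 1) * row_z X 1 * inverse (row_z g 1)) + row_z X 2 / row_z g 1)) (at g)"
    by (rule has_derivative_divide[OF row row row_z_nonzero[OF assms]])
  moreover have "- row_z g 2 * (inverse (row_z g 1) * row_z X 1 * inverse (row_z g 1)) + row_z X 2 / row_z g 1 =
      of_real (det g) / (row_z g 1)\<^sup>2 * zeta_mat (matrix_inv g ** X)" for X
  proof -
    have "of_real (det g) * zeta_mat (matrix_inv g ** X) = row_z g 1 * row_z X 2 - row_z g 2 * row_z X 1"
      using det_zeta_mat[of g "matrix_inv g ** X"] by (simp add: matrix_mul_assoc matrix_inv_mult[OF assms])
    then show ?thesis
      using row_z_nonzero[OF assms] by (simp add: field_simps power2_eq_square)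
  qed
  ultimately show ?thesis by (simp add: ratio_def[abs_def])
qed

lemma zeta_mat_inverse_surj:
  assumes "g \<in> GL2"
  shows "\<exists>X. of_real (det g) / (row_z g 1)\<^sup>2 * zeta_mat (matrix_inv g ** X) = w"
proof -
  define z where "z = w * (row_z g 1)\<^sup>2 / of_real (det g)"
  define Y :: "real^2^2" where "Y = vector [vector [0, 0], vector [Re z, Im z]]"
  have "zeta_mat Y = z" by (simp add: Y_def zeta_mat_def complex_eq_iff)
  moreover have "matrix_inv g ** (g ** Y) = Y" by (simp add: matrix_mul_assoc matrix_inv_mult[OF assms])
  moreover have "det g \<noteq> 0" using assms by (simp add: invertible_det_nz)
  ultimately show ?thesis
    using row_z_nonzero[OF assms] by (intro exI[of _ "g ** Y"]) (simp add: z_def)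
qed

lemma smooth_ratio: "smooth_on GL2 ratio"
  unfolding ratio_def[abs_def]
  using row_z_nonzero by (intro smooth_intros open_GL2 smooth_on_linear[OF open_GL2 linear_row_z]) auto

lemma smooth_ratio_matrix: "open S \<Longrightarrow> smooth_on S ratio_matrix"
proof -
  assume S: "open S"
  have "smooth_on S (\<lambda>w. ratio_matrix w $ i $ j)" for i j
  proof -
    have "smooth_on S (\<lambda>w. Re w)" "smooth_on S (\<lambda>w. Im w)"
      by (rule smooth_on_bounded_linear[OF S bounded_linear_Re smooth_on_ident[OF S]],
          rule smooth_on_bounded_linear[OF S bounded_linear_Im smooth_on_ident[OF S]])
    then show ?thesis
      using exhaust_2[of i] exhaust_2[of j] smooth_on_const[OF S] by auto
  qed
  then show ?thesis by (rule smooth_on_matrix[OF S])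
qed

definition ratio_coord :: "'e \<times> (real^2^2) \<Rightarrow> 'e \<times> complex" where
  "ratio_coord z = (fst z, ratio (snd z))"

definition ratio_section :: "'e \<times> complex \<Rightarrow> 'e \<times> (real^2^2)" where
  "ratio_section y = (fst y, ratio_matrix (snd y))"

definition ratio_coord_derivative :: "real^2^2 \<Rightarrow> 'e \<times> (real^2^2) \<Rightarrow> 'e \<times> complex" where
  "ratio_coord_derivative g z = (fst z, of_real (det g) / (row_z g 1)\<^sup>2 * zeta_mat (matrix_inv g ** snd z))"

lemma ratio_coord_section [simp]: "ratio_coord (ratio_section y) = y"
  by (simp add: ratio_coord_def ratio_section_def)

lemma ratio_coord_has_derivative:
  assumes "g \<in> GL2"
  shows "(ratio_coord has_derivative ratio_coord_derivative g) (at (e::'e::euclidean_space, g))"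
proof -
  have "((\<lambda>z::'e \<times> (real^2^2). ratio (snd z)) has_derivative
      (\<lambda>z. of_real (det g) / (row_z g 1)\<^sup>2 * zeta_mat (matrix_inv g ** snd z))) (at (e, g))"
    using has_derivative_compose[OF bounded_linear.has_derivative[OF bounded_linear_snd has_derivative_ident, of "at (e, g)"],
        of ratio "\<lambda>X. of_real (det g) / (row_z g 1)\<^sup>2 * zeta_mat (matrix_inv g ** X)"]
      ratio_has_derivative[OF assms] by simp
  then show ?thesis
    unfolding ratio_coord_def[abs_def] ratio_coord_derivative_def[abs_def]
    by (intro has_derivative_Pair bounded_linear.has_derivative[OF bounded_linear_fst has_derivative_ident])
qed

lemma surj_ratio_coord_derivative: "g \<in> GL2 \<Longrightarrow> surj (ratio_coord_derivative g)"
proof -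
  assume g: "g \<in> GL2"
  have "\<exists>z. ratio_coord_derivative g z = y" for y :: "'a \<times> complex"
  proof -
    obtain X where "of_real (det g) / (row_z g 1)\<^sup>2 * zeta_mat (matrix_inv g ** X) = snd y"
      using zeta_mat_inverse_surj[OF g] by blast
    then show ?thesis
      by (intro exI[of _ "(fst y, X)"]) (simp add: ratio_coord_derivative_def)
  qed
  then show ?thesis by (metis surjI surj_def)
qed

lemma smooth_ratio_coord:
  assumes "open O'" shows "smooth_on (O' \<times> GL2) (ratio_coord :: 'e::euclidean_space \<times> (real^2^2) \<Rightarrow> _)"
proof -
  have op: "open (O' \<times> GL2)" using assms open_GL2 by (rule open_Times)
  show ?thesis
    unfolding ratio_coord_def[abs_def]
    by (intro smooth_on_Pair[OF op] smooth_on_fst[OF op] smooth_on_ident[OF op]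
        smooth_on_compose[OF op open_GL2 _ smooth_on_snd[OF op smooth_on_ident[OF op]] smooth_ratio]) auto
qed

lemma smooth_ratio_section:
  assumes "open S" shows "smooth_on S (ratio_section :: 'e::euclidean_space \<times> complex \<Rightarrow> _)"
  unfolding ratio_section_def[abs_def]
  by (intro smooth_on_Pair[OF assms] smooth_on_fst[OF assms] smooth_on_ident[OF assms]
        smooth_on_compose[OF assms open_UNIV _ smooth_on_snd[OF assms smooth_on_ident[OF assms]]
          smooth_ratio_matrix[OF open_UNIV]]) auto

text \<open>A coordinate change between two charts factors locally through a third one. For the quotient,
  whose charts are described by a property only, \<open>R\<close> will be a set of explicit charts.\<close>

lemma smooth_atlas_from_reference:
  assumes inj: "\<And>C. C \<in> N \<Longrightarrow> inj_on (snd C) (fst C)"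
    and op: "\<And>C. C \<in> N \<Longrightarrow> open (snd C ` fst C)"
    and cover: "\<And>C q. C \<in> N \<Longrightarrow> q \<in> fst C \<Longrightarrow> \<exists>K\<in>R. q \<in> fst K"
    and R: "\<And>K. K \<in> R \<Longrightarrow> inj_on (snd K) (fst K)"
    and K_open: "\<And>C K. C \<in> N \<Longrightarrow> K \<in> R \<Longrightarrow> open (snd K ` (fst K \<inter> fst C))"
    and K_smooth: "\<And>C K. C \<in> N \<Longrightarrow> K \<in> R \<Longrightarrow> smooth_on (snd K ` (fst K \<inter> fst C)) (coord_change K C)"
    and C_open: "\<And>C K. C \<in> N \<Longrightarrow> K \<in> R \<Longrightarrow> open (snd C ` (fst C \<inter> fst K))"
    and C_smooth: "\<And>C K. C \<in> N \<Longrightarrow> K \<in> R \<Longrightarrow> smooth_on (snd C ` (fst C \<inter> fst K)) (coord_change C K)"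
  shows "smooth_atlas N"
proof
  fix C C' assume C: "C \<in> N" and C': "C' \<in> N"
  let ?P = "\<lambda>K. snd C ` (fst C \<inter> fst K) \<inter> coord_change C K -` (snd K ` (fst K \<inter> fst C'))"
  have P: "?P K = snd C ` (fst C \<inter> fst C' \<inter> fst K)" if K: "K \<in> R" for K
  proof (intro equalityI subsetI)
    fix y assume y: "y \<in> ?P K"
    then obtain q where q: "q \<in> fst C" "q \<in> fst K" "y = snd C q" by blast
    have "coord_change C K y = snd K q"
      using inj[OF C] q by (simp add: coord_change_def chart_inv_def)
    then have "q \<in> fst C'" using y q(2) R[OF K] by (auto dest: inj_onD)
    with q show "y \<in> snd C ` (fst C \<inter> fst C' \<inter> fst K)" by blast
  next
    fix y assume "y \<in> snd C ` (fst C \<inter> fst C' \<inter> fst K)"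
    then show "y \<in> ?P K"
      using inj[OF C] by (auto simp: coord_change_def chart_inv_def)
  qed
  have P_open: "open (?P K)" if K: "K \<in> R" for K
    by (rule continuous_open_preimage[OF smooth_on_imp_continuous_on[OF C_smooth[OF C K]] C_open[OF C K] K_open[OF C' K]])
  have "snd C ` (fst C \<inter> fst C') = (\<Union>K\<in>R. ?P K)"
    using P cover[OF C] by (simp cong: SUP_cong) blast
  then show "open (snd C ` (fst C \<inter> fst C'))" using P_open by auto
  show "smooth_on (snd C ` (fst C \<inter> fst C')) (coord_change C C')"
  proof (rule smooth_on_local)
    fix y assume "y \<in> snd C ` (fst C \<inter> fst C')"
    then obtain q where q: "q \<in> fst C" "q \<in> fst C'" "y = snd C q" by blast
    obtain K where K: "K \<in> R" "q \<in> fst K" using cover[OF C q(1)] by blast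
    have "smooth_on (?P K) (\<lambda>y. coord_change K C' (coord_change C K y))"
      by (rule smooth_on_compose[OF P_open[OF K(1)] K_open[OF C' K(1)] _
            smooth_on_subset[OF C_smooth[OF C K(1)]] K_smooth[OF C' K(1)]]) auto
    then have "smooth_on (?P K) (coord_change C C')"
    proof (rule smooth_on_cong[OF P_open[OF K(1)], rotated])
      fix y assume "y \<in> ?P K"
      then obtain q where "q \<in> fst C" "q \<in> fst K" "y = snd C q" by blast
      then show "coord_change K C' (coord_change C K y) = coord_change C C' y"
        using inj[OF C] R[OF K(1)] by (simp add: coord_change_def chart_inv_def)
    qed
    moreover have "y \<in> ?P K" unfolding P[OF K(1)] using q K(2) by blast
    ultimately show "\<exists>V. open V \<and> y \<in> V \<and> smooth_on V (coord_change C C')"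
      using P_open[OF K(1)] by blast
  qed
qed (use inj op in auto)

context gl2_bundle
begin

lemma orbit_frame_pt:
  assumes "R \<in> T" "p \<in> fst R"
  shows "CO2_orbit k (frame_pt (snd R) p g) = {frame_pt (snd R) p (g ** h) | h. h \<in> CO2}"
  unfolding CO2_orbit_def using frame_act_frame_pt[OF assms] by auto

lemma orbit_frame_pt_eq_iff:
  assumes R: "R \<in> T" "p \<in> fst R" and g: "g \<in> GL2" "g' \<in> GL2"
  shows "CO2_orbit k (frame_pt (snd R) p g) = CO2_orbit k (frame_pt (snd R) p g') \<longleftrightarrow> ratio g = ratio g'"
proof
  assume "CO2_orbit k (frame_pt (snd R) p g) = CO2_orbit k (frame_pt (snd R) p g')"
  then have "frame_pt (snd R) p (g' ** mat 1) \<in> CO2_orbit k (frame_pt (snd R) p g)"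
    using mat_1_in_CO2 unfolding orbit_frame_pt[OF R] by blast
  then obtain h where h: "h \<in> CO2" "frame_pt (snd R) p g' = frame_pt (snd R) p (g ** h)"
    unfolding orbit_frame_pt[OF R] by auto
  then have "g' = g ** h" using frame_pt_inj[OF R] by blast
  then show "ratio g = ratio g'" using ratio_CO2[OF h(1)] by simp
next
  have sub: "CO2_orbit k (frame_pt (snd R) p g') \<subseteq> CO2_orbit k (frame_pt (snd R) p g)"
    if r: "ratio g = ratio g'" "g \<in> GL2" "g' \<in> GL2" for g g'
  proof
    fix b assume "b \<in> CO2_orbit k (frame_pt (snd R) p g')"
    then obtain h where h: "h \<in> CO2" "b = frame_pt (snd R) p (g' ** h)" unfolding orbit_frame_pt[OF R] by blast
    have "g' ** h \<in> GL2" using matrix_mult_in_GL2[OF r(3)] h(1) CO2_subset_GL2 by blast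
    moreover have "ratio g = ratio (g' ** h)" using ratio_CO2[OF h(1)] r(1) by simp
    ultimately obtain h' where "h' \<in> CO2" "g' ** h = g ** h'"
      using ratio_eq_imp_CO2[OF r(2)] by metis
    then show "b \<in> CO2_orbit k (frame_pt (snd R) p g)" unfolding h(2) orbit_frame_pt[OF R] by auto
  qed
  assume "ratio g = ratio g'"
  then show "CO2_orbit k (frame_pt (snd R) p g) = CO2_orbit k (frame_pt (snd R) p g')"
    using sub[of g g'] sub[of g' g] g by auto
qed

lemma fst_in_orbit: "b' \<in> CO2_orbit k b \<Longrightarrow> fst b' = fst b"
  unfolding CO2_orbit_def frame_act_def by auto

lemma self_in_orbit:
  assumes "b \<in> points B" shows "b \<in> CO2_orbit k b"
proof -
  obtain C R p g where *: "C \<in> M" "R \<in> T" "p \<in> fst C" "p \<in> fst R" "g \<in> GL2" "b = frame_pt (snd R) p g"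
    using assms by (rule point_B_cases)
  have "frame_act k b (mat 1) = b" unfolding *(6) frame_act_frame_pt[OF *(2,4)] by simp
  then show ?thesis unfolding CO2_orbit_def using mat_1_in_CO2 by (metis image_eqI)
qed

lemma orbit_eq_imp_fst_eq:
  assumes "b \<in> points B" "CO2_orbit k b = CO2_orbit k b'"
  shows "fst b = fst b'"
  using self_in_orbit[OF assms(1)] assms(2) fst_in_orbit by metis

lemma orbit_eq_imp_frame_act:
  assumes "b' \<in> points B" "CO2_orbit k b = CO2_orbit k b'"
  obtains h where "h \<in> CO2" "b' = frame_act k b h"
  using self_in_orbit[OF assms(1)] assms(2) that unfolding CO2_orbit_def by blast

abbreviation Q :: "(('m, 'e) fpoint set, 'e \<times> complex) atlas" where
  "Q \<equiv> quotient_atlas B (CO2_orbit k)"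

text \<open>The coordinate of an orbit is read off from any of its members, as \<^const>\<open>ratio\<close> is invariant under
  conformal matrices.\<close>

definition orbit_chart ::
  "('m, 'e) chart \<Rightarrow> 'm set \<times> ('m \<Rightarrow> real^2 \<Rightarrow> 'v) \<Rightarrow> (('m, 'e) fpoint set, 'e \<times> complex) chart" where
  "orbit_chart C R = (CO2_orbit k ` fst (frame_chart C R),
     \<lambda>q. ratio_coord (snd (frame_chart C R) (SOME b. b \<in> q)))"

lemma orbit_chart_orbit:
  assumes R: "R \<in> T" "p \<in> fst R"
  shows "snd (orbit_chart C R) (CO2_orbit k (frame_pt (snd R) p g)) = (snd C p, ratio g)"
proof -
  let ?q = "CO2_orbit k (frame_pt (snd R) p g)"
  have "frame_pt (snd R) p (g ** mat 1) \<in> ?q"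
    unfolding orbit_frame_pt[OF R] using mat_1_in_CO2 by blast
  then have "(SOME b. b \<in> ?q) \<in> ?q" by (rule someI)
  then obtain h where h: "h \<in> CO2" "(SOME b. b \<in> ?q) = frame_pt (snd R) p (g ** h)"
    unfolding orbit_frame_pt[OF R] by blast
  show ?thesis
    unfolding orbit_chart_def snd_conv h(2) frame_chart_frame_pt[OF R]
    by (simp add: ratio_coord_def ratio_CO2[OF h(1)])
qed

lemma orbit_chart_cases:
  assumes "R \<in> T" "q \<in> fst (orbit_chart C R)"
  obtains p g where "p \<in> fst C" "p \<in> fst R" "g \<in> GL2" "q = CO2_orbit k (frame_pt (snd R) p g)"
proof -
  obtain b where b: "b \<in> fst (frame_chart C R)" "q = CO2_orbit k b"
    using assms(2) by (auto simp: orbit_chart_def)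
  from assms(1) b(1) obtain p g where "p \<in> fst C" "p \<in> fst R" "g \<in> GL2" "b = frame_pt (snd R) p g"
    by (rule frame_chart_cases)
  with b(2) that show ?thesis by blast
qed

lemma orbit_in_orbit_chart:
  "R \<in> T \<Longrightarrow> p \<in> fst C \<Longrightarrow> p \<in> fst R \<Longrightarrow> g \<in> GL2 \<Longrightarrow>
    CO2_orbit k (frame_pt (snd R) p g) \<in> fst (orbit_chart C R)"
  using frame_pt_in_domain by (simp add: orbit_chart_def)

lemma orbit_in_orbit_chart_iff:
  assumes R: "R \<in> T" and b: "b \<in> points B"
  shows "CO2_orbit k b \<in> fst (orbit_chart C R) \<longleftrightarrow> b \<in> fst (frame_chart C R)"
proof
  assume "CO2_orbit k b \<in> fst (orbit_chart C R)"
  then obtain b' where "b' \<in> fst (frame_chart C R)" "CO2_orbit k b = CO2_orbit k b'"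
    by (auto simp: orbit_chart_def)
  then show "b \<in> fst (frame_chart C R)"
    using orbit_eq_imp_fst_eq[OF b] b unfolding points_B frame_chart_domain by auto
qed (simp add: orbit_chart_def)

lemma inj_on_orbit_chart:
  assumes C: "C \<in> M" and R: "R \<in> T"
  shows "inj_on (snd (orbit_chart C R)) (fst (orbit_chart C R))"
proof (rule inj_onI)
  fix q q' assume q: "q \<in> fst (orbit_chart C R)" "q' \<in> fst (orbit_chart C R)"
    and eq: "snd (orbit_chart C R) q = snd (orbit_chart C R) q'"
  from R q(1) obtain p g where p: "p \<in> fst C" "p \<in> fst R" "g \<in> GL2" "q = CO2_orbit k (frame_pt (snd R) p g)"
    by (rule orbit_chart_cases)
  from R q(2) obtain p' g' where p': "p' \<in> fst C" "p' \<in> fst R" "g' \<in> GL2" "q' = CO2_orbit k (frame_pt (snd R) p' g')"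
    by (rule orbit_chart_cases)
  have "snd C p = snd C p'" "ratio g = ratio g'"
    using eq unfolding p(4) p'(4) orbit_chart_orbit[OF R p(2)] orbit_chart_orbit[OF R p'(2)] by auto
  then have "p = p'" "ratio g = ratio g'"
    using M.chart_inj[OF C] p(1) p'(1) by (auto dest: inj_onD)
  then show "q = q'" unfolding p(4) p'(4) using orbit_frame_pt_eq_iff[OF R p(2)] p(3) p'(3) by blast
qed

lemma image_orbit_chart:
  assumes R: "R \<in> T"
  shows "snd (orbit_chart C R) ` fst (orbit_chart C R) = snd C ` (fst C \<inter> fst R) \<times> non_real"
proof (intro equalityI subsetI)
  fix y assume "y \<in> snd (orbit_chart C R) ` fst (orbit_chart C R)"
  then obtain q where q: "q \<in> fst (orbit_chart C R)" "y = snd (orbit_chart C R) q" by blast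
  from R q(1) obtain p g where "p \<in> fst C" "p \<in> fst R" "g \<in> GL2" "q = CO2_orbit k (frame_pt (snd R) p g)"
    by (rule orbit_chart_cases)
  then show "y \<in> snd C ` (fst C \<inter> fst R) \<times> non_real"
    using q(2) ratio_non_real orbit_chart_orbit[OF R] by auto
next
  fix y assume "y \<in> snd C ` (fst C \<inter> fst R) \<times> non_real"
  then obtain p w where p: "p \<in> fst C" "p \<in> fst R" "w \<in> non_real" "y = (snd C p, w)" by auto
  then show "y \<in> snd (orbit_chart C R) ` fst (orbit_chart C R)"
    using orbit_in_orbit_chart[OF R p(1,2) ratio_matrix_in_GL2[OF p(3)]]
      orbit_chart_orbit[OF R p(2), of C "ratio_matrix w"] by (metis image_eqI ratio_ratio_matrix)
qed

lemma open_orbit_image: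
  assumes "C \<in> M" "R \<in> T" shows "open (snd C ` (fst C \<inter> fst R) \<times> non_real)"
  using M.mopen_open_image[OF bundle_frame(1)[OF assms(2)] assms(1)] open_non_real by (rule open_Times)

lemma chart_inv_orbit_chart:
  assumes C: "C \<in> M" and R: "R \<in> T" and p: "p \<in> fst C" "p \<in> fst R" "g \<in> GL2"
  shows "chart_inv (orbit_chart C R) (snd C p, ratio g) = CO2_orbit k (frame_pt (snd R) p g)"
  using inv_into_f_f[OF inj_on_orbit_chart[OF C R] orbit_in_orbit_chart[OF R p]]
  by (simp add: chart_inv_def orbit_chart_orbit[OF R p(2)])

lemma orbit_chart_inv_frame_chart:
  assumes C: "C \<in> M" and R: "R \<in> T" and z: "z \<in> snd C ` (fst C \<inter> fst R) \<times> GL2"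
  shows "CO2_orbit k (chart_inv (frame_chart C R) z) = chart_inv (orbit_chart C R) (ratio_coord z)"
proof -
  from z obtain p g where p: "p \<in> fst C" "p \<in> fst R" "g \<in> GL2" "z = (snd C p, g)"
    by (rule frame_image_cases)
  show ?thesis
    unfolding p(4) chart_inv_frame_chart[OF C R p(1-3)]
    by (simp add: ratio_coord_def chart_inv_orbit_chart[OF C R p(1-3)])
qed

end

section \<open>The quotient manifold\<close>

context gl2_bundle
begin

lemma quotient_chart_iff:
  "D \<in> Q \<longleftrightarrow> fst D \<subseteq> CO2_orbit k ` points B \<and> inj_on (snd D) (fst D) \<and> open (snd D ` fst D) \<and>
     mopen B (points B \<inter> CO2_orbit k -` fst D) \<and>
     smooth_fun B (points B \<inter> CO2_orbit k -` fst D) (snd D \<circ> CO2_orbit k) \<and>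
     (\<forall>K\<in>B. \<forall>b\<in>fst K \<inter> CO2_orbit k -` fst D.
        surj (frechet_derivative (snd D \<circ> CO2_orbit k \<circ> chart_inv K) (at (snd K b))))"
  unfolding quotient_atlas_def chart_inv_def by (simp add: case_prod_beta)

lemma orbit_chart_coordinates_smooth:
  assumes C: "C \<in> M" "C' \<in> M" and R: "R \<in> T" "R' \<in> T"
  defines "O' \<equiv> snd C' ` (fst C' \<inter> (fst R' \<inter> (fst C \<inter> fst R)))"
  shows "smooth_on (O' \<times> GL2) (\<lambda>z. ratio_coord (coord_change (frame_chart C' R') (frame_chart C R) z))"
    and "\<And>z. z \<in> O' \<times> GL2 \<Longrightarrow> (snd (orbit_chart C R) \<circ> CO2_orbit k \<circ> chart_inv (frame_chart C' R')) z =
      ratio_coord (coord_change (frame_chart C' R') (frame_chart C R) z)"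
proof -
  have im: "snd (frame_chart C' R') ` (fst (frame_chart C' R') \<inter> fst (frame_chart C R)) = O' \<times> GL2"
    unfolding O'_def by (rule overlap_frame_chart[OF R(2)])
  have O: "open O'" unfolding O'_def by (rule open_overlap[OF C(2,1) R(2,1)])
  have OG: "open (O' \<times> GL2)" using O open_GL2 by (rule open_Times)
  have cc: "coord_change (frame_chart C' R') (frame_chart C R) (snd C' p, g) = (snd C p, transition R' R p ** g)"
    if "p \<in> fst C'" "p \<in> fst C" "p \<in> fst R'" "p \<in> fst R" "g \<in> GL2" for p g
    by (rule coord_change_frame_chart[OF C(2,1) R(2,1) that])
  show "smooth_on (O' \<times> GL2) (\<lambda>z. ratio_coord (coord_change (frame_chart C' R') (frame_chart C R) z))"
  proof (rule smooth_on_compose[OF OG _ _ _ smooth_ratio_coord[OF open_UNIV]])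
    show "smooth_on (O' \<times> GL2) (coord_change (frame_chart C' R') (frame_chart C R))"
      using B.coord_change_smooth[OF frame_chart_in_B[OF C(2) R(2)] frame_chart_in_B[OF C(1) R(1)]]
      unfolding im .
    show "coord_change (frame_chart C' R') (frame_chart C R) ` (O' \<times> GL2) \<subseteq> UNIV \<times> GL2"
    proof (rule image_subsetI)
      fix z assume "z \<in> O' \<times> GL2"
      then obtain p g where p: "z = (snd C' p, g)" "p \<in> fst C'" "p \<in> fst C" "p \<in> fst R'" "p \<in> fst R" "g \<in> GL2"
        unfolding O'_def by blast
      have "transition R' R p ** g \<in> GL2"
        by (rule matrix_mult_in_GL2[OF transition_in_GL2[OF R(2,1) p(4,5)] p(6)])
      then show "coord_change (frame_chart C' R') (frame_chart C R) z \<in> UNIV \<times> GL2"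
        unfolding p(1) cc[OF p(2-6)] by simp
    qed
  qed (intro open_Times open_UNIV open_GL2)
  fix z assume "z \<in> O' \<times> GL2"
  then obtain p g where p: "z = (snd C' p, g)" "p \<in> fst C'" "p \<in> fst C" "p \<in> fst R'" "p \<in> fst R" "g \<in> GL2"
    unfolding O'_def by blast
  show "(snd (orbit_chart C R) \<circ> CO2_orbit k \<circ> chart_inv (frame_chart C' R')) z =
      ratio_coord (coord_change (frame_chart C' R') (frame_chart C R) z)"
    unfolding comp_def p(1) cc[OF p(2-6)] chart_inv_frame_chart[OF C(2) R(2) p(2,4,6)]
      transition(2)[OF R(2,1) p(4,5)] orbit_chart_orbit[OF R(1) p(5)]
    by (simp add: ratio_coord_def)
qed

lemma orbit_chart_in_Q:
  assumes C: "C \<in> M" and R: "R \<in> T"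
  shows "orbit_chart C R \<in> Q"
  unfolding quotient_chart_iff
proof (intro conjI)
  let ?D = "orbit_chart C R"
  have pre: "points B \<inter> CO2_orbit k -` fst ?D = fst (frame_chart C R)"
  proof -
    have "fst (frame_chart C R) \<subseteq> points B" unfolding points_B frame_chart_domain by blast
    then show ?thesis using orbit_in_orbit_chart_iff[OF R] by blast
  qed
  show "fst ?D \<subseteq> CO2_orbit k ` points B"
    unfolding orbit_chart_def points_B frame_chart_domain by auto
  show "inj_on (snd ?D) (fst ?D)" by (rule inj_on_orbit_chart[OF C R])
  show "open (snd ?D ` fst ?D)" unfolding image_orbit_chart[OF R] by (rule open_orbit_image[OF C R])
  show "mopen B (points B \<inter> CO2_orbit k -` fst ?D)"
    unfolding pre by (rule B.mopen_domain[OF frame_chart_in_B[OF C R]])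
  show "smooth_fun B (points B \<inter> CO2_orbit k -` fst ?D) (snd ?D \<circ> CO2_orbit k)"
    unfolding pre
  proof (rule B.smooth_funI_local)
    fix b assume b: "b \<in> fst (frame_chart C R)"
    let ?O = "snd C ` (fst C \<inter> (fst R \<inter> (fst C \<inter> fst R))) \<times> GL2"
    have im: "snd (frame_chart C R) ` fst (frame_chart C R) = ?O"
      using overlap_frame_chart[OF R, of C C R] by simp
    have O: "open ?O" using open_overlap[OF C C R R] open_GL2 by (rule open_Times)
    have "smooth_on ?O (snd ?D \<circ> CO2_orbit k \<circ> chart_inv (frame_chart C R))"
      using smooth_on_cong[OF O orbit_chart_coordinates_smooth(2)[OF C C R R, symmetric]
          orbit_chart_coordinates_smooth(1)[OF C C R R]] .
    then show "\<exists>K G. chart_at B b K \<and> open G \<and> snd K b \<in> G \<and> G \<subseteq> snd K ` fst K \<and>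
        smooth_on G (snd ?D \<circ> CO2_orbit k \<circ> chart_inv K)"
      using b im O frame_chart_in_B[OF C R]
      by (intro exI[of _ "frame_chart C R"] exI[of _ ?O]) (auto simp: chart_at_def)
  qed
  show "\<forall>K\<in>B. \<forall>b\<in>fst K \<inter> CO2_orbit k -` fst ?D.
      surj (frechet_derivative (snd ?D \<circ> CO2_orbit k \<circ> chart_inv K) (at (snd K b)))"
  proof (intro ballI)
    fix K b assume "K \<in> B" and "b \<in> fst K \<inter> CO2_orbit k -` fst ?D"
    then have b: "b \<in> fst K" "CO2_orbit k b \<in> fst ?D" by simp_all
    obtain C' R' where K: "K = frame_chart C' R'" "C' \<in> M" "R' \<in> T"
      using \<open>K \<in> B\<close> unfolding B_eq by blast
    have bB: "b \<in> points B" using \<open>K \<in> B\<close> b(1) unfolding points_def by blast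
    have bK: "b \<in> fst (frame_chart C R)" using orbit_in_orbit_chart_iff[OF R bB] b(2) by simp
    have at: "chart_at B b K" "chart_at B b (frame_chart C R)"
      using \<open>K \<in> B\<close> b(1) bK frame_chart_in_B[OF C R] by (simp_all add: chart_at_def)
    let ?O = "snd C' ` (fst C' \<inter> (fst R' \<inter> (fst C \<inter> fst R))) \<times> GL2"
    have O: "open ?O" using open_overlap[OF K(2) C K(3) R] open_GL2 by (rule open_Times)
    have inO: "snd K b \<in> ?O"
      using overlap_frame_chart[OF K(3), of C' C R] b(1) bK unfolding K(1) by blast
    from R bK obtain p g where p: "p \<in> fst C" "p \<in> fst R" "g \<in> GL2" "b = frame_pt (snd R) p g"
      by (rule frame_chart_cases)
    have z: "coord_change K (frame_chart C R) (snd K b) = (snd C p, g)"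
      using B.coord_change_chart[OF \<open>K \<in> B\<close> b(1)] frame_chart_frame_pt[OF R p(2)] p(4) by simp
    have "((\<lambda>z. ratio_coord (coord_change K (frame_chart C R) z)) has_derivative
        (\<lambda>v. ratio_coord_derivative g (coord_jacobian K (frame_chart C R) b v))) (at (snd K b))"
    proof -
      have "(ratio_coord has_derivative ratio_coord_derivative g)
          (at (coord_change K (frame_chart C R) (snd K b)))"
        unfolding z by (rule ratio_coord_has_derivative[OF p(3)])
      from has_derivative_compose[OF B.coord_change_derivative[OF at] this] show ?thesis .
    qed
    then have "((snd ?D \<circ> CO2_orbit k \<circ> chart_inv K) has_derivative
        (\<lambda>v. ratio_coord_derivative g (coord_jacobian K (frame_chart C R) b v))) (at (snd K b))"
      by (rule has_derivative_transform_within_open[OF _ O inO])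
        (use orbit_chart_coordinates_smooth(2)[OF C K(2) R K(3)] K(1) in simp)
    then have D: "frechet_derivative (snd ?D \<circ> CO2_orbit k \<circ> chart_inv K) (at (snd K b)) =
        ratio_coord_derivative g \<circ> coord_jacobian K (frame_chart C R) b"
      by (simp add: frechet_derivative_at[symmetric] comp_def)
    have "surj (coord_jacobian K (frame_chart C R) b)"
    proof (rule surjI)
      show "coord_jacobian K (frame_chart C R) b (coord_jacobian (frame_chart C R) K b v) = v" for v
        using B.coord_jacobian_trans[OF at(2,1,2), of v] B.coord_jacobian_self[OF at(2)] by simp
    qed
    then show "surj (frechet_derivative (snd ?D \<circ> CO2_orbit k \<circ> chart_inv K) (at (snd K b)))"
      unfolding D using surj_ratio_coord_derivative[OF p(3)] by (metis comp_surj)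
  qed
qed

text \<open>The section \<^const>\<open>ratio_section\<close> expresses \<open>D\<close> in the coordinates of \<open>K\<close> by the smooth map that \<open>D\<close> induces
  on \<open>B(E)\<close>. The latter is a submersion, so its factor \<open>coord_change K D\<close> has surjective, hence
  bijective derivatives, and \<open>smooth_inverse_function\<close> applies.\<close>

lemma quotient_chart_compatible:
  assumes D: "D \<in> Q" and C: "C \<in> M" and R: "R \<in> T"
  defines "K \<equiv> orbit_chart C R"
  shows "open (snd K ` (fst K \<inter> fst D))" "smooth_on (snd K ` (fst K \<inter> fst D)) (coord_change K D)"
    and "open (snd D ` (fst D \<inter> fst K))" "smooth_on (snd D ` (fst D \<inter> fst K)) (coord_change D K)"
proof -
  note DQ = D[unfolded quotient_chart_iff]
  let ?F = "frame_chart C R" and ?W = "points B \<inter> CO2_orbit k -` fst D"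
  let ?I = "snd C ` (fst C \<inter> fst R)"
  have W: "mopen B ?W" using DQ by blast
  have F: "?F \<in> B" by (rule frame_chart_in_B[OF C R])
  define S where "S = snd ?F ` (fst ?F \<inter> ?W)"
  have S: "open S" unfolding S_def by (rule B.mopen_open_image[OF W F])
  have Simage: "S \<subseteq> ?I \<times> GL2"
    using image_frame_chart[OF R, of C UNIV] unfolding S_def by auto
  have I: "open (?I \<times> non_real)" by (rule open_orbit_image[OF C R])
  define P where "P = ?I \<times> non_real \<inter> ratio_section -` S"
  have P: "open P"
    unfolding P_def
    by (rule continuous_open_preimage[OF smooth_on_imp_continuous_on[OF smooth_ratio_section[OF I]] I S])
  have Kinv: "inj_on (snd K) (fst K)" unfolding K_def by (rule inj_on_orbit_chart[OF C R])
  have P_iff: "snd K q \<in> P \<longleftrightarrow> q \<in> fst D" if q: "q \<in> fst K" for q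
  proof -
    from R q[unfolded K_def] obtain p g where p: "p \<in> fst C" "p \<in> fst R" "g \<in> GL2" "q = CO2_orbit k (frame_pt (snd R) p g)"
      by (rule orbit_chart_cases)
    have w: "ratio g \<in> non_real" by (rule ratio_non_real[OF p(3)])
    let ?b = "frame_pt (snd R) p (ratio_matrix (ratio g))"
    have bF: "?b \<in> fst ?F" by (rule frame_pt_in_domain[OF R p(1,2) ratio_matrix_in_GL2[OF w]])
    have qb: "q = CO2_orbit k ?b"
      unfolding p(4) using orbit_frame_pt_eq_iff[OF R p(2,3) ratio_matrix_in_GL2[OF w]] by simp
    have Kq: "snd K q = (snd C p, ratio g)" unfolding K_def p(4) by (rule orbit_chart_orbit[OF R p(2)])
    have "snd K q \<in> P \<longleftrightarrow> snd ?F ?b \<in> S"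
      unfolding P_def Kq using p w by (simp add: ratio_section_def frame_chart_frame_pt[OF R p(2)])
    also have "\<dots> \<longleftrightarrow> ?b \<in> ?W"
      unfolding S_def using inj_on_frame_chart[OF C R] bF by (auto dest: inj_onD)
    also have "\<dots> \<longleftrightarrow> q \<in> fst D"
      using bF unfolding qb points_B frame_chart_domain by blast
    finally show ?thesis .
  qed
  have imP: "snd K ` (fst K \<inter> fst D) = P"
  proof (intro equalityI subsetI)
    fix y assume "y \<in> P"
    then have "y \<in> snd K ` fst K" unfolding P_def K_def image_orbit_chart[OF R] by blast
    then show "y \<in> snd K ` (fst K \<inter> fst D)" using P_iff \<open>y \<in> P\<close> by blast
  qed (use P_iff in blast)
  show "open (snd K ` (fst K \<inter> fst D))" unfolding imP by (rule P)
  have rep: "(snd D \<circ> CO2_orbit k \<circ> chart_inv ?F) z = coord_change K D (ratio_coord z)"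
    if "z \<in> ?I \<times> GL2" for z
    unfolding comp_def orbit_chart_inv_frame_chart[OF C R that] by (simp add: coord_change_def K_def)
  have smS: "smooth_on S (snd D \<circ> CO2_orbit k \<circ> chart_inv ?F)"
  proof -
    have "smooth_fun B ?W (snd D \<circ> CO2_orbit k)" using DQ by blast
    from B.smooth_funD[OF this F] show ?thesis unfolding S_def .
  qed
  have secS: "ratio_section y \<in> S" if "y \<in> P" for y using that unfolding P_def by blast
  have sm: "smooth_on P (coord_change K D)"
  proof (rule smooth_on_cong[OF P])
    show "smooth_on P (\<lambda>y. (snd D \<circ> CO2_orbit k \<circ> chart_inv ?F) (ratio_section y))"
      by (rule smooth_on_compose[OF P S _ smooth_ratio_section[OF P] smS]) (use secS in blast)
    show "(snd D \<circ> CO2_orbit k \<circ> chart_inv ?F) (ratio_section y) = coord_change K D y" if "y \<in> P" for y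
      using rep[of "ratio_section y"] secS[OF that] Simage by auto
  qed
  then show "smooth_on (snd K ` (fst K \<inter> fst D)) (coord_change K D)" unfolding imP .
  have Dinj: "inj_on (snd D) (fst D)" using DQ by blast
  have Kq: "chart_inv K (snd K q) = q" if "q \<in> fst K" for q
    using Kinv that by (simp add: chart_inv_def)
  have Dq: "chart_inv D (snd D q) = q" if "q \<in> fst D" for q
    using Dinj that by (simp add: chart_inv_def)
  have inj: "inj_on (coord_change K D) P"
    unfolding imP[symmetric]
  proof (rule inj_onI)
    fix y y' assume "y \<in> snd K ` (fst K \<inter> fst D)" "y' \<in> snd K ` (fst K \<inter> fst D)"
      and eq: "coord_change K D y = coord_change K D y'"
    then obtain q q' where q: "y = snd K q" "q \<in> fst K" "q \<in> fst D" "y' = snd K q'" "q' \<in> fst K" "q' \<in> fst D"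
      by blast
    then have "snd D q = snd D q'" using eq by (simp add: coord_change_def Kq)
    then show "y = y'" using inj_onD[OF Dinj] q by blast
  qed
  have surj: "surj (frechet_derivative (coord_change K D) (at y))" if y: "y \<in> P" for y
  proof -
    obtain e g where eg: "ratio_section y = (e, g)" by fastforce
    have eS: "(e, g) \<in> S" using secS[OF y] eg by simp
    have g: "g \<in> GL2" using eS Simage by blast
    have y': "ratio_coord (e, g) = y" using ratio_coord_section[of y] eg by simp
    obtain b where b: "b \<in> fst ?F" "CO2_orbit k b \<in> fst D" "(e, g) = snd ?F b"
      using eS unfolding S_def by blast
    have "((\<lambda>z. coord_change K D (ratio_coord z)) has_derivative
        (\<lambda>v. frechet_derivative (coord_change K D) (at y) (ratio_coord_derivative g v))) (at (e, g))"
      using has_derivative_compose[OF ratio_coord_has_derivative[OF g]] smooth_on_has_derivative[OF sm y] y' by metis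
    then have "((snd D \<circ> CO2_orbit k \<circ> chart_inv ?F) has_derivative
        (\<lambda>v. frechet_derivative (coord_change K D) (at y) (ratio_coord_derivative g v))) (at (e, g))"
      by (rule has_derivative_transform_within_open[OF _ S eS]) (use rep Simage in auto)
    then have "frechet_derivative (snd D \<circ> CO2_orbit k \<circ> chart_inv ?F) (at (snd ?F b)) =
        (\<lambda>v. frechet_derivative (coord_change K D) (at y) (ratio_coord_derivative g v))"
      unfolding b(3) by (rule frechet_derivative_at[symmetric])
    moreover have "surj (frechet_derivative (snd D \<circ> CO2_orbit k \<circ> chart_inv ?F) (at (snd ?F b)))"
      using DQ F b by blast
    ultimately show ?thesis by (metis (no_types, lifting) surj_def)
  qed
  have imD: "coord_change K D ` P = snd D ` (fst D \<inter> fst K)"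
    unfolding imP[symmetric] by (auto simp: coord_change_def Kq intro!: image_eqI)
  note inverse = smooth_inverse_function[OF P sm inj surj]
  show op: "open (snd D ` (fst D \<inter> fst K))" using inverse(1) unfolding imD .
  have "smooth_on (snd D ` (fst D \<inter> fst K)) (inv_into P (coord_change K D))"
    using inverse(2) unfolding imD .
  then show "smooth_on (snd D ` (fst D \<inter> fst K)) (coord_change D K)"
  proof (rule smooth_on_cong[OF op, rotated])
    fix y assume "y \<in> snd D ` (fst D \<inter> fst K)"
    then obtain q where q: "q \<in> fst D" "q \<in> fst K" "y = snd D q" by blast
    have y: "y = coord_change K D (snd K q)" using q by (simp add: coord_change_def Kq)
    have "snd K q \<in> P" using P_iff q by blast
    then have "inv_into P (coord_change K D) y = snd K q"
      unfolding y by (rule inv_into_f_f[OF inj])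
    also have "\<dots> = coord_change D K y" unfolding q(3) using q(1) by (simp add: coord_change_def Dq)
    finally show "inv_into P (coord_change K D) y = coord_change D K y" .
  qed
qed

lemma point_Q_cases:
  assumes "q \<in> CO2_orbit k ` points B"
  obtains C R where "C \<in> M" "R \<in> T" "q \<in> fst (orbit_chart C R)"
proof -
  obtain b where b: "b \<in> points B" "q = CO2_orbit k b" using assms by blast
  obtain C R p g where *: "C \<in> M" "R \<in> T" "p \<in> fst C" "p \<in> fst R" "g \<in> GL2" "b = frame_pt (snd R) p g"
    using b(1) by (rule point_B_cases)
  show ?thesis
    using that[OF *(1,2)] orbit_in_orbit_chart[OF *(2-5)] b(2) *(6) by simp
qed

lemma smooth_atlas_Q: "smooth_atlas Q"
proof (rule smooth_atlas_from_reference[where R = "{orbit_chart C R | C R. C \<in> M \<and> R \<in> T}"])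
  show "inj_on (snd D) (fst D)" "open (snd D ` fst D)" if "D \<in> Q" for D
    using that unfolding quotient_chart_iff by blast+
  show "\<exists>K\<in>{orbit_chart C R | C R. C \<in> M \<and> R \<in> T}. q \<in> fst K" if D: "D \<in> Q" "q \<in> fst D" for D q
  proof -
    have "q \<in> CO2_orbit k ` points B" using D unfolding quotient_chart_iff by blast
    then obtain C R where "C \<in> M" "R \<in> T" "q \<in> fst (orbit_chart C R)" by (rule point_Q_cases)
    then show ?thesis by blast
  qed
qed (use inj_on_orbit_chart quotient_chart_compatible in blast)+

sublocale Q: smooth_atlas Q by (rule smooth_atlas_Q)

lemma points_Q: "points Q = CO2_orbit k ` points B"
proof (intro equalityI subsetI)
  fix q assume "q \<in> points Q"
  then obtain D where "D \<in> Q" "q \<in> fst D" unfolding points_def by blast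
  then show "q \<in> CO2_orbit k ` points B" unfolding quotient_chart_iff by blast
next
  fix q assume "q \<in> CO2_orbit k ` points B"
  then obtain C R where "C \<in> M" "R \<in> T" "q \<in> fst (orbit_chart C R)" by (rule point_Q_cases)
  then show "q \<in> points Q" using orbit_chart_in_Q unfolding points_def by blast
qed

lemma orbit_chart_preimage_mopen:
  assumes "C \<in> M" "R \<in> T" "open G"
  shows "mopen Q {q \<in> fst (orbit_chart C R). snd (orbit_chart C R) q \<in> G}"
  by (rule Q.mopen_chart_preimage[OF orbit_chart_in_Q[OF assms(1,2)] assms(3)])

text \<open>Orbits over different points are separated by open sets of \<open>M\<close>; orbits over the same point lie in a
  common chart.\<close>

lemma Hausdorff_Q: "Hausdorff_space (topology (mopen Q))"
  unfolding Hausdorff_space_def Q.topspace_mopen Q.openin_mopen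
proof (intro allI impI)
  fix q q' assume qq: "q \<in> points Q \<and> q' \<in> points Q \<and> q \<noteq> q'"
  obtain b where b: "b \<in> points B" "q = CO2_orbit k b" using qq unfolding points_Q by blast
  obtain b' where b': "b' \<in> points B" "q' = CO2_orbit k b'" using qq unfolding points_Q by blast
  obtain C R p g where *: "C \<in> M" "R \<in> T" "p \<in> fst C" "p \<in> fst R" "g \<in> GL2" "b = frame_pt (snd R) p g"
    using b(1) by (rule point_B_cases)
  obtain C' R' p' g' where **: "C' \<in> M" "R' \<in> T" "p' \<in> fst C'" "p' \<in> fst R'" "g' \<in> GL2" "b' = frame_pt (snd R') p' g'"
    using b'(1) by (rule point_B_cases)
  let ?K = "orbit_chart C R" and ?K' = "orbit_chart C' R'"
  have qK: "q \<in> fst ?K" "snd ?K q = (snd C p, ratio g)"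
    unfolding b(2) *(6) using orbit_in_orbit_chart[OF *(2-5)] orbit_chart_orbit[OF *(2,4)] by auto
  have qK': "q' \<in> fst ?K'" "snd ?K' q' = (snd C' p', ratio g')"
    unfolding b'(2) **(6) using orbit_in_orbit_chart[OF **(2-5)] orbit_chart_orbit[OF **(2,4)] by auto
  show "\<exists>U V. mopen Q U \<and> mopen Q V \<and> q \<in> U \<and> q' \<in> V \<and> disjnt U V"
  proof (cases "p = p'")
    case True
    have in': "q' \<in> fst ?K"
    proof -
      have "b' \<in> frame_set k M E \<Theta>" using b'(1) points_B by simp
      then have "b' \<in> fst (frame_chart C R)" using ** * True by (simp add: frame_chart_domain)
      then show ?thesis using b'(2) by (simp add: orbit_chart_def)
    qed
    then have "snd ?K q \<noteq> snd ?K q'"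
      using inj_on_orbit_chart[OF *(1,2)] qK(1) qq by (auto dest: inj_onD)
    then obtain G H where GH: "open G" "open H" "snd ?K q \<in> G" "snd ?K q' \<in> H" "G \<inter> H = {}"
      using hausdorff by metis
    show ?thesis
      using orbit_chart_preimage_mopen[OF *(1,2) GH(1)] orbit_chart_preimage_mopen[OF *(1,2) GH(2)] GH qK(1) in'
      by (intro exI[of _ "{q \<in> fst ?K. snd ?K q \<in> G}"] exI[of _ "{q \<in> fst ?K. snd ?K q \<in> H}"])
        (auto simp: disjnt_def)
  next
    case False
    have "p \<in> points M" "p' \<in> points M" using * ** unfolding points_def by auto
    then obtain A A' where A: "mopen M A" "mopen M A'" "p \<in> A" "p' \<in> A'" "disjnt A A'"
      using manifold False
      unfolding smooth_manifold_def Hausdorff_space_def M.topspace_mopen M.openin_mopen by metis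
    let ?G = "snd C ` (fst C \<inter> A) \<times> UNIV" and ?G' = "snd C' ` (fst C' \<inter> A') \<times> UNIV"
    have G: "open ?G" "open ?G'"
      using M.mopen_open_image A(1,2) *(1) **(1) by (simp_all add: open_Times)
    have base: "fst b0 \<in> A0"
      if b0: "b0 \<in> points B" "CO2_orbit k b0 \<in> fst (orbit_chart C0 R0)"
        "snd (orbit_chart C0 R0) (CO2_orbit k b0) \<in> snd C0 ` (fst C0 \<inter> A0) \<times> UNIV"
        and C0: "C0 \<in> M" and R0: "R0 \<in> T" for b0 C0 R0 A0
    proof -
      from R0 b0(2) obtain p0 g0 where p0: "p0 \<in> fst C0" "p0 \<in> fst R0" "g0 \<in> GL2"
        "CO2_orbit k b0 = CO2_orbit k (frame_pt (snd R0) p0 g0)"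
        by (rule orbit_chart_cases)
      have "snd C0 p0 \<in> snd C0 ` (fst C0 \<inter> A0)"
        using b0(3) unfolding p0(4) orbit_chart_orbit[OF R0 p0(2)] by simp
      then have "p0 \<in> A0" using M.chart_inj[OF C0] p0(1) by (auto dest: inj_onD)
      moreover have "fst b0 = p0" using orbit_eq_imp_fst_eq[OF b0(1) p0(4)] by simp
      ultimately show ?thesis by simp
    qed
    define U where "U = {q \<in> fst ?K. snd ?K q \<in> ?G}"
    define V where "V = {q \<in> fst ?K'. snd ?K' q \<in> ?G'}"
    have "disjnt U V"
      unfolding disjnt_iff
    proof (intro allI notI, elim conjE)
      fix q0 assume "q0 \<in> U" "q0 \<in> V"
      then have q0: "q0 \<in> fst ?K" "snd ?K q0 \<in> ?G" "q0 \<in> fst ?K'" "snd ?K' q0 \<in> ?G'"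
        by (simp_all only: U_def V_def mem_Collect_eq)
      have "q0 \<in> points Q" using q0(1) orbit_chart_in_Q[OF *(1,2)] unfolding points_def by blast
      then obtain b0 where b0: "b0 \<in> points B" "q0 = CO2_orbit k b0" unfolding points_Q by blast
      have "fst b0 \<in> A"
        by (rule base[OF b0(1) q0(1,2)[unfolded b0(2)] *(1,2)])
      moreover have "fst b0 \<in> A'"
        by (rule base[OF b0(1) q0(3,4)[unfolded b0(2)] **(1,2)])
      ultimately show False using A(5) unfolding disjnt_iff by blast
    qed
    moreover have "q \<in> U" "q' \<in> V"
      unfolding U_def V_def using qK *(3) A(3) qK' **(3) A(4) by simp_all
    moreover have "mopen Q U" "mopen Q V"
      unfolding U_def V_def
      by (rule orbit_chart_preimage_mopen[OF *(1,2) G(1)], rule orbit_chart_preimage_mopen[OF **(1,2) G(2)])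
    ultimately show ?thesis by blast
  qed
qed

text \<open>Countably many of the sets \<open>fst C \<inter> fst R\<close> cover \<open>M\<close>, so countably many charts
  \<open>orbit_chart C R\<close> cover the quotient.\<close>

lemma second_countable_Q: "second_countable (topology (mopen Q))"
proof -
  have "second_countable (topology (mopen M))" using manifold unfolding smooth_manifold_def by blast
  then have L: "Lindelof_space (topology (mopen M))" by (rule second_countable_imp_Lindelof_space)
  define \<U> where "\<U> = {fst C \<inter> fst R | C R. C \<in> M \<and> R \<in> T}"
  have "\<exists>V. countable V \<and> V \<subseteq> \<U> \<and> \<Union> V = topspace (topology (mopen M))"
  proof (rule Lindelof_spaceD[OF L])
    show "openin (topology (mopen M)) U" if "U \<in> \<U>" for U
      using that M.mopen_Int[OF M.mopen_domain bundle_frame(1)]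
      unfolding M.openin_mopen \<U>_def by blast
    have T: "\<Union> (fst ` T) = points M" using gl2 unfolding gl2_structure_def vector_bundle_def by blast
    have "\<Union> \<U> = \<Union> (fst ` M) \<inter> \<Union> (fst ` T)" unfolding \<U>_def by blast
    then show "\<Union> \<U> = topspace (topology (mopen M))"
      unfolding T M.topspace_mopen points_def by simp
  qed
  then obtain V where V: "countable V" "V \<subseteq> \<U>" "\<Union> V = points M"
    unfolding M.topspace_mopen by (elim exE conjE)
  have "\<forall>U\<in>V. \<exists>C R. C \<in> M \<and> R \<in> T \<and> U = fst C \<inter> fst R"
    using V(2) unfolding \<U>_def by blast
  then obtain \<C> \<R> where CR: "\<And>U. U \<in> V \<Longrightarrow> \<C> U \<in> M \<and> \<R> U \<in> T \<and> U = fst (\<C> U) \<inter> fst (\<R> U)"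
    by metis
  obtain \<B> :: "('e \<times> complex) set set" where \<B>: "countable \<B>" "topological_basis \<B>"
    using ex_countable_basis by blast
  define \<D> where "\<D> = (\<lambda>(U, G). {q \<in> fst (orbit_chart (\<C> U) (\<R> U)). snd (orbit_chart (\<C> U) (\<R> U)) q \<in> G}) ` (V \<times> \<B>)"
  show ?thesis
    unfolding second_countable_def Q.openin_mopen
  proof (intro exI[of _ \<D>] conjI ballI allI impI)
    show "countable \<D>" unfolding \<D>_def using V(1) \<B>(1) by simp
    show "mopen Q W" if W: "W \<in> \<D>" for W
    proof -
      obtain U G where UG: "U \<in> V" "G \<in> \<B>"
        "W = {q \<in> fst (orbit_chart (\<C> U) (\<R> U)). snd (orbit_chart (\<C> U) (\<R> U)) q \<in> G}"
        using W unfolding \<D>_def by auto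
      have "open G" using topological_basis_open[OF \<B>(2) UG(2)] .
      then show ?thesis unfolding UG(3) using orbit_chart_preimage_mopen CR[OF UG(1)] by blast
    qed
    fix W q assume Wq: "mopen Q W \<and> q \<in> W"
    then have "q \<in> points Q" unfolding mopen_def by blast
    then obtain b where b: "b \<in> points B" "q = CO2_orbit k b" unfolding points_Q by blast
    have bF: "b \<in> frame_set k M E \<Theta>" using b(1) points_B by simp
    then have "fst b \<in> \<Union> V" unfolding V(3) frame_set_iff by auto
    then obtain U where U: "U \<in> V" "fst b \<in> U" by blast
    let ?K = "orbit_chart (\<C> U) (\<R> U)"
    have K: "?K \<in> Q" using orbit_chart_in_Q CR[OF U(1)] by blast
    have qK: "q \<in> fst ?K"
      using bF U CR[OF U(1)] b(2) by (auto simp: orbit_chart_def frame_chart_domain)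
    have "open (snd ?K ` (fst ?K \<inter> W))" using Q.mopen_open_image[OF _ K] Wq by blast
    moreover have "snd ?K q \<in> snd ?K ` (fst ?K \<inter> W)" using qK Wq by blast
    ultimately obtain G where G: "G \<in> \<B>" "snd ?K q \<in> G" "G \<subseteq> snd ?K ` (fst ?K \<inter> W)"
      by (rule topological_basisE[OF \<B>(2)])
    have sub: "{q \<in> fst ?K. snd ?K q \<in> G} \<subseteq> W"
      using G(3) Q.chart_inj[OF K] by (auto dest: inj_onD)
    have mem: "{q \<in> fst ?K. snd ?K q \<in> G} \<in> \<D>" unfolding \<D>_def using U(1) G(1) by auto
    have "q \<in> {q \<in> fst ?K. snd ?K q \<in> G}" using qK G(2) by simp
    with sub mem show "\<exists>V\<in>\<D>. q \<in> V \<and> V \<subseteq> W" by (intro bexI conjI)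
  qed
qed

lemma smooth_manifold_Q: "smooth_manifold Q"
  by (rule smooth_manifoldI[OF smooth_atlas_Q Hausdorff_Q second_countable_Q])

end

section \<open>The almost complex structure\<close>

lemma ratio_derivative_eq:
  assumes "g \<in> GL2"
  shows "of_real (det g) / (row_z g 1)\<^sup>2 * zeta_mat (matrix_inv g ** X) =
    (row_z g 1 * row_z X 2 - row_z g 2 * row_z X 1) / (row_z g 1)\<^sup>2"
  using det_zeta_mat[of g "matrix_inv g ** X"] by (simp add: matrix_mul_assoc matrix_inv_mult[OF assms])

lemma ratio_coord_derivative_conformal:
  assumes g: "g \<in> GL2" and uv: "u\<^sup>2 + v\<^sup>2 \<noteq> 0"
  shows "ratio_coord_derivative (g ** conformal u v) (e, X ** conformal u v) = ratio_coord_derivative g (e, X)"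
proof -
  note gh = matrix_mult_in_GL2[OF g conformal_in_GL2[OF uv]]
  have "Complex u (- v) \<noteq> 0" by (rule Complex_conformal_nonzero[OF uv])
  then show ?thesis
    unfolding ratio_coord_derivative_def fst_conv snd_conv ratio_derivative_eq[OF gh]
      ratio_derivative_eq[OF g]
    unfolding row_z_conformal
    using row_z_nonzero[OF g] by (simp add: field_simps power2_eq_square)
qed

lemma linear_ratio_coord_derivative: "linear (ratio_coord_derivative g)"
proof (rule linearI)
  have "matrix_inv g ** (X + Y) = matrix_inv g ** X + matrix_inv g ** Y" for X Y :: "real^2^2"
    by (simp add: matrix_add_ldistrib)
  then show "ratio_coord_derivative g (x + y) = ratio_coord_derivative g x + ratio_coord_derivative g y" for x y
    by (simp add: ratio_coord_derivative_def linear_add[OF linear_zeta_mat] distrib_left add_divide_distrib)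
  have "matrix_inv g ** (r *\<^sub>R X) = r *\<^sub>R (matrix_inv g ** X)" for r and X :: "real^2^2"
    by (simp add: matrix_matrix_mult_def vec_eq_iff sum_distrib_left mult_ac)
  then show "ratio_coord_derivative g (r *\<^sub>R x) = r *\<^sub>R ratio_coord_derivative g x" for r x
    by (simp add: ratio_coord_derivative_def linear_cmul[OF linear_zeta_mat])
qed

context gl2_bundle_connection
begin

definition dorbit ::
  "('m, 'e) fpoint \<Rightarrow> (('m, 'e) fpoint, 'e \<times> (real^2^2)) tvec \<Rightarrow> (('m, 'e) fpoint set, 'e \<times> complex) tvec" where
  "dorbit b v = tangent_map B Q (CO2_orbit k) b v"

lemma chart_at_orbit:
  assumes "C \<in> M" "R \<in> T" "p \<in> fst C" "p \<in> fst R" "g \<in> GL2"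
  shows "chart_at Q (CO2_orbit k (frame_pt (snd R) p g)) (orbit_chart C R)"
  using orbit_chart_in_Q[OF assms(1,2)] orbit_in_orbit_chart[OF assms(2-5)] by (simp add: chart_at_def)

lemma dorbit_coordinates:
  assumes C: "C \<in> M" and R: "R \<in> T" and p: "p \<in> fst C" "p \<in> fst R" "g \<in> GL2"
    and v: "v \<in> tangent_space B (frame_pt (snd R) p g)"
  shows "dorbit (frame_pt (snd R) p g) v =
    coord_vec Q (orbit_chart C R) (CO2_orbit k (frame_pt (snd R) p g)) (ratio_coord_derivative g (v (frame_chart C R)))"
  unfolding dorbit_def
proof (rule B.tangent_map_eq_coord_vec[where f = "CO2_orbit k", OF smooth_atlas_Q chart_at_frame_pt[OF C R p] chart_at_orbit[OF C R p] v _ open_frame_image[OF C R]])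
  let ?S = "snd C ` (fst C \<inter> fst R) \<times> GL2"
  have z: "snd (frame_chart C R) (frame_pt (snd R) p g) = (snd C p, g)" by (rule frame_chart_frame_pt[OF R p(2)])
  show inS: "snd (frame_chart C R) (frame_pt (snd R) p g) \<in> ?S" using p by (auto simp: z)
  have orb: "CO2_orbit k (chart_inv (frame_chart C R) (snd C q, h)) = CO2_orbit k (frame_pt (snd R) q h)"
    if "q \<in> fst C" "q \<in> fst R" "h \<in> GL2" for q h
    by (simp only: chart_inv_frame_chart[OF C R that])
  show "CO2_orbit k (chart_inv (frame_chart C R) y) \<in> fst (orbit_chart C R)" if "y \<in> ?S" for y
  proof -
    from that obtain q h where q: "q \<in> fst C" "q \<in> fst R" "h \<in> GL2" "y = (snd C q, h)"
      by (rule frame_image_cases)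
    show ?thesis unfolding q(4) orb[OF q(1-3)] by (rule orbit_in_orbit_chart[OF R q(1-3)])
  qed
  have "(ratio_coord has_derivative ratio_coord_derivative g) (at (snd (frame_chart C R) (frame_pt (snd R) p g)))"
    unfolding z by (rule ratio_coord_has_derivative[OF p(3)])
  then show "((snd (orbit_chart C R) \<circ> CO2_orbit k \<circ> chart_inv (frame_chart C R)) has_derivative ratio_coord_derivative g)
      (at (snd (frame_chart C R) (frame_pt (snd R) p g)))"
  proof (rule has_derivative_transform_within_open[OF _ open_frame_image[OF C R] inS])
    fix y assume "y \<in> ?S"
    then obtain q h where q: "q \<in> fst C" "q \<in> fst R" "h \<in> GL2" "y = (snd C q, h)"
      by (rule frame_image_cases)
    show "ratio_coord y = (snd (orbit_chart C R) \<circ> CO2_orbit k \<circ> chart_inv (frame_chart C R)) y"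
      unfolding comp_def q(4) orb[OF q(1-3)] orbit_chart_orbit[OF R q(2)] by (simp add: ratio_coord_def)
  qed
qed

lemma dorbit_in:
  assumes "b \<in> points B" "v \<in> tangent_space B b"
  shows "dorbit b v \<in> tangent_space Q (CO2_orbit k b)"
proof -
  obtain C R p g where *: "C \<in> M" "R \<in> T" "p \<in> fst C" "p \<in> fst R" "g \<in> GL2" "b = frame_pt (snd R) p g"
    using assms(1) by (rule point_B_cases)
  show ?thesis
    using dorbit_coordinates[OF *(1-5)] Q.coord_vec_in_tangent_space[OF chart_at_orbit[OF *(1-5)]] assms(2)
    unfolding *(6) by simp
qed

lemma dorbit_surj:
  assumes b: "b \<in> points B" and t: "t \<in> tangent_space Q (CO2_orbit k b)"
  obtains v where "v \<in> tangent_space B b" "dorbit b v = t"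
proof -
  obtain C R p g where *: "C \<in> M" "R \<in> T" "p \<in> fst C" "p \<in> fst R" "g \<in> GL2" "b = frame_pt (snd R) p g"
    using b by (rule point_B_cases)
  note at = chart_at_frame_pt[OF *(1-5)]
  obtain z where z: "ratio_coord_derivative g z = t (orbit_chart C R)"
    using surj_ratio_coord_derivative[OF *(5)] by (metis surjD)
  define v where "v = coord_vec B (frame_chart C R) b z"
  have v: "v \<in> tangent_space B b"
    unfolding v_def *(6) by (rule B.coord_vec_in_tangent_space[OF at])
  have "v (frame_chart C R) = z" unfolding v_def *(6) by (rule B.coord_vec_self[OF at])
  then have "dorbit b v = coord_vec Q (orbit_chart C R) (CO2_orbit k b) (t (orbit_chart C R))"
    using dorbit_coordinates[OF *(1-5)] v z unfolding *(6) by simp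
  also have "\<dots> = t"
    by (rule Q.coord_vec_eq[OF t]) (use chart_at_orbit[OF *(1-5)] *(6) in simp)
  finally show ?thesis using that v by blast
qed

lemma dorbit_linear:
  assumes b: "b \<in> points B" and u: "u \<in> tangent_space B b" and v: "v \<in> tangent_space B b"
  shows "dorbit b (r *\<^sub>R u + s *\<^sub>R v) = r *\<^sub>R dorbit b u + s *\<^sub>R dorbit b v"
proof -
  obtain C R p g where *: "C \<in> M" "R \<in> T" "p \<in> fst C" "p \<in> fst R" "g \<in> GL2" "b = frame_pt (snd R) p g"
    using b by (rule point_B_cases)
  have uv: "r *\<^sub>R u + s *\<^sub>R v \<in> tangent_space B b"
    using u v B.tangent_space_subspace by (intro subspace_add subspace_scale) auto
  note lin = linear_ratio_coord_derivative[of g] Q.coord_vec_linear[OF chart_at_orbit[OF *(1-5)]]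
  show ?thesis
    using dorbit_coordinates[OF *(1-5)] u v uv unfolding *(6)
    by (simp add: scaleR_fun_apply linear_add[OF lin(1)] linear_cmul[OF lin(1)] linear_add[OF lin(2)] linear_cmul[OF lin(2)])
qed

lemma dorbit_frame_act:
  assumes b: "b \<in> points B" and h: "h \<in> CO2" and v: "v \<in> tangent_space B b"
  shows "dorbit (frame_act k b h) (tangent_map B B (\<lambda>b. frame_act k b h) b v) = dorbit b v"
proof -
  obtain C R p g where *: "C \<in> M" "R \<in> T" "p \<in> fst C" "p \<in> fst R" "g \<in> GL2" "b = frame_pt (snd R) p g"
    using b by (rule point_B_cases)
  obtain x y where xy: "h = conformal x y" "x\<^sup>2 + y\<^sup>2 \<noteq> 0" using h unfolding CO2_eq by blast
  have hG: "h \<in> GL2" using h CO2_subset_GL2 by blast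
  note gh = matrix_mult_in_GL2[OF *(5) hG]
  have v': "v \<in> tangent_space B (frame_pt (snd R) p g)" using v *(6) by simp
  note at = chart_at_frame_pt[OF *(1-4) gh]
  have orb: "CO2_orbit k (frame_pt (snd R) p (g ** h)) = CO2_orbit k (frame_pt (snd R) p g)"
    using orbit_frame_pt_eq_iff[OF *(2,4) gh *(5)] ratio_CO2[OF h] by simp
  obtain e X where eX: "v (frame_chart C R) = (e, X)" by fastforce
  have "ratio_coord_derivative (g ** h) (e, X ** h) = ratio_coord_derivative g (e, X)"
    unfolding xy(1) by (rule ratio_coord_derivative_conformal[OF *(5) xy(2)])
  then show ?thesis
    unfolding *(6) frame_act_frame_pt[OF *(2,4)] tangent_map_frame_act[OF *(1-5) hG v']
      dorbit_coordinates[OF *(1-5) v']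
      dorbit_coordinates[OF *(1-4) gh B.coord_vec_in_tangent_space[OF at]] B.coord_vec_self[OF at] eX orb
    by simp
qed

text \<open>The derivative of \<^const>\<open>ratio\<close> sees a vertical vector \<open>g ** Y\<close> only through \<open>zeta_mat Y\<close>, and \<open>\<zeta>\<close> differs from
  \<open>zeta_mat Y\<close> by a term depending only on the base component. Hence a tangent vector of the quotient is
  the same as the values of \<open>\<omega>\<close> and \<open>\<zeta>\<close> on a lift of it.\<close>

lemma dorbit_forms:
  assumes C: "C \<in> M" and R: "R \<in> T" and p: "p \<in> fst C" "p \<in> fst R" "g \<in> GL2"
  defines "b \<equiv> frame_pt (snd R) p g"
  assumes v: "v \<in> tangent_space B b" and a: "soldering k M B b v = (\<Sum>i\<le>k. a i *\<^sub>R mono_xy k i)"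
  defines "e \<equiv> \<Sum>i\<le>k. a i *\<^sub>R snd b i C"
  shows "dorbit b v = coord_vec Q (orbit_chart C R) (CO2_orbit k b)
    (e, of_real (det g) / (row_z g 1)\<^sup>2 * (zeta_form \<phi> b v - horizontal_zeta C R b e))"
proof -
  have b: "b \<in> points B" unfolding b_def points_B by (rule frame_pt_in_frame_set[OF R p(2,3)])
  have at: "chart_at B b (frame_chart C R)" unfolding b_def by (rule chart_at_frame_pt[OF C R p])
  have atM: "chart_at M p C" using C p by (simp add: chart_at_def)
  obtain e' X where eX: "v (frame_chart C R) = (e', X)" by fastforce
  obtain a' where a': "tangent_map B M fst b v = (\<Sum>i\<le>k. a' i *\<^sub>R snd b i)"
    "soldering k M B b v = (\<Sum>i\<le>k. a' i *\<^sub>R mono_xy k i)"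
    using soldering_expand[OF b v] by blast
  have aa: "a' i = a i" if "i \<le> k" for i
    using indep_family_representation[OF finite_atMost indep_mono_xy, of i k a]
      indep_family_representation[OF finite_atMost indep_mono_xy, of i k a'] a a'(2) that by simp
  have "coord_vec M C p e' = (\<Sum>i\<le>k. a' i *\<^sub>R snd b i)"
    using tangent_map_fst[OF C R p] v eX a'(1) unfolding b_def by simp
  then have "e' = (\<Sum>i\<le>k. a' i *\<^sub>R snd b i) C"
    using M.coord_vec_self[OF atM, of e'] by simp
  also have "\<dots> = e" unfolding e_def by (simp add: sum_fun_apply scaleR_fun_apply aa)
  finally have e': "e' = e" .
  define Y where "Y = matrix_inv g ** X"
  have X: "X = g ** Y" by (simp add: Y_def matrix_mul_assoc matrix_inv_mult[OF p(3)])
  have v_eq: "v = coord_vec B (frame_chart C R) b (e, g ** Y)"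
    using B.coord_vec_eq[OF v at] eX e' X by simp
  have "zeta_form \<phi> b v = horizontal_zeta C R b e + zeta_mat Y"
    using zeta_form_coordinates[OF C R p, of e Y] v_eq unfolding b_def by simp
  then have "zeta_mat Y = zeta_form \<phi> b v - horizontal_zeta C R b e" by simp
  moreover have "dorbit b v = coord_vec Q (orbit_chart C R) (CO2_orbit k b) (ratio_coord_derivative g (e, X))"
    using dorbit_coordinates[OF C R p] v eX e' unfolding b_def by simp
  ultimately show ?thesis by (simp add: ratio_coord_derivative_def Y_def)
qed

lemma dorbit_eq_iff:
  assumes b: "b \<in> points B" and v: "v \<in> tangent_space B b" "w \<in> tangent_space B b"
  shows "dorbit b v = dorbit b w \<longleftrightarrow>
    soldering k M B b v = soldering k M B b w \<and> zeta_form \<phi> b v = zeta_form \<phi> b w"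
proof -
  obtain C R p g where *: "C \<in> M" "R \<in> T" "p \<in> fst C" "p \<in> fst R" "g \<in> GL2" "b = frame_pt (snd R) p g"
    using b by (rule point_B_cases)
  note at = chart_at_orbit[OF *(1-5), folded *(6)]
  note atM = chart_at_def[of M p C, THEN iffD2, OF conjI[OF *(1,3)]]
  obtain a where a: "tangent_map B M fst b v = (\<Sum>i\<le>k. a i *\<^sub>R snd b i)"
    "soldering k M B b v = (\<Sum>i\<le>k. a i *\<^sub>R mono_xy k i)"
    using soldering_expand[OF b v(1)] by blast
  obtain c where c: "tangent_map B M fst b w = (\<Sum>i\<le>k. c i *\<^sub>R snd b i)"
    "soldering k M B b w = (\<Sum>i\<le>k. c i *\<^sub>R mono_xy k i)"
    using soldering_expand[OF b v(2)] by blast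
  let ?e = "\<lambda>a. \<Sum>i\<le>k. a i *\<^sub>R snd b i C"
  let ?f = "of_real (det g) / (row_z g 1)\<^sup>2 :: complex"
  have f: "?f \<noteq> 0" using *(5) row_z_nonzero[OF *(5)] by (simp add: invertible_det_nz)
  have dv: "dorbit b v = coord_vec Q (orbit_chart C R) (CO2_orbit k b)
      (?e a, ?f * (zeta_form \<phi> b v - horizontal_zeta C R b (?e a)))"
    using dorbit_forms[OF *(1-5)] v(1) a(2) unfolding *(6) by blast
  have dw: "dorbit b w = coord_vec Q (orbit_chart C R) (CO2_orbit k b)
      (?e c, ?f * (zeta_form \<phi> b w - horizontal_zeta C R b (?e c)))"
    using dorbit_forms[OF *(1-5)] v(2) c(2) unfolding *(6) by blast
  show ?thesis
  proof
    assume "dorbit b v = dorbit b w"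
    then have "dorbit b v (orbit_chart C R) = dorbit b w (orbit_chart C R)" by simp
    then have e: "?e a = ?e c"
      and z: "?f * (zeta_form \<phi> b v - horizontal_zeta C R b (?e a)) = ?f * (zeta_form \<phi> b w - horizontal_zeta C R b (?e c))"
      unfolding dv dw Q.coord_vec_self[OF at] by auto
    have "tangent_map B M fst b v = tangent_map B M fst b w"
    proof (rule M.tangent_space_eqI[OF _ _ atM])
      show "tangent_map B M fst b v \<in> tangent_space M p" "tangent_map B M fst b w \<in> tangent_space M p"
        using tangent_map_fst_in[OF b] v *(6) by auto
      show "tangent_map B M fst b v C = tangent_map B M fst b w C"
        unfolding a(1) c(1) using e by (simp add: sum_fun_apply scaleR_fun_apply)
    qed
    then have "soldering k M B b v = soldering k M B b w" by (simp add: soldering_def)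
    moreover have "zeta_form \<phi> b v = zeta_form \<phi> b w" using z f e by simp
    ultimately show "soldering k M B b v = soldering k M B b w \<and> zeta_form \<phi> b v = zeta_form \<phi> b w" ..
  next
    assume eq: "soldering k M B b v = soldering k M B b w \<and> zeta_form \<phi> b v = zeta_form \<phi> b w"
    have "soldering k M B b w = (\<Sum>i\<le>k. a i *\<^sub>R mono_xy k i)" using eq a(2) by simp
    then have "dorbit b w = coord_vec Q (orbit_chart C R) (CO2_orbit k b)
        (?e a, ?f * (zeta_form \<phi> b w - horizontal_zeta C R b (?e a)))"
      using dorbit_forms[OF *(1-5)] v(2) unfolding *(6) by blast
    then show "dorbit b v = dorbit b w" using dv eq by simp
  qed
qed

text \<open>\<open>turn b v w\<close> says that \<open>w\<close> is a lift of the image of \<open>v\<close> under the almost complex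
  structure.\<close>

definition turn where
  "turn b v w \<longleftrightarrow> v \<in> tangent_space B b \<and> w \<in> tangent_space B b \<and>
     (\<forall>j\<le>k div 2. xi_form k j M B b w = \<i> * xi_form k j M B b v) \<and> zeta_form \<phi> b w = \<i> * zeta_form \<phi> b v"

definition turn_form :: "(real \<Rightarrow> real \<Rightarrow> real) \<Rightarrow> real \<Rightarrow> real \<Rightarrow> real" where
  "turn_form P = form_of_xi k (\<lambda>j. \<i> * xi_lin k j P)"

text \<open>The \<open>\<xi>\<^bsup>k,j\<^esup>\<close> are coordinates on the binary forms, so the first condition determines the value of \<open>\<omega>\<close>.\<close>

lemma turn_iff:
  assumes b: "b \<in> points B" and v: "v \<in> tangent_space B b" "w \<in> tangent_space B b"
  shows "turn b v w \<longleftrightarrow> soldering k M B b w = turn_form (soldering k M B b v) \<and> zeta_form \<phi> b w = \<i> * zeta_form \<phi> b v"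
proof -
  have "(\<forall>j\<le>k div 2. xi_form k j M B b w = \<i> * xi_form k j M B b v) \<longleftrightarrow>
      soldering k M B b w = turn_form (soldering k M B b v)"
  proof
    assume "\<forall>j\<le>k div 2. xi_form k j M B b w = \<i> * xi_form k j M B b v"
    then show "soldering k M B b w = turn_form (soldering k M B b v)"
      unfolding turn_form_def
      by (intro xi_lin_eqI[OF odd_k soldering_in_forms[OF b v(2)] form_of_xi_in_forms])
        (simp add: xi_lin_form_of_xi[OF odd_k] xi_form_def)
  qed (simp add: xi_form_def turn_form_def xi_lin_form_of_xi[OF odd_k])
  then show ?thesis unfolding turn_def using v by blast
qed

lemma turn_exists:
  assumes b: "b \<in> points B" and v: "v \<in> tangent_space B b"
  obtains w where "turn b v w"
proof -
  have "turn_form (soldering k M B b v) \<in> forms k" unfolding turn_form_def by (rule form_of_xi_in_forms)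
  then obtain w where "w \<in> tangent_space B b" "soldering k M B b w = turn_form (soldering k M B b v)"
    "zeta_form \<phi> b w = \<i> * zeta_form \<phi> b v"
    using forms_surjective[OF b] by metis
  then show ?thesis using that turn_iff[OF b v] by blast
qed

lemma turn_unique:
  assumes b: "b \<in> points B" and t: "turn b v w" "turn b v' w'" and eq: "dorbit b v = dorbit b v'"
  shows "dorbit b w = dorbit b w'"
proof -
  have in_T: "v \<in> tangent_space B b" "w \<in> tangent_space B b" "v' \<in> tangent_space B b" "w' \<in> tangent_space B b"
    using t unfolding turn_def by blast+
  show ?thesis
    using t eq unfolding turn_iff[OF b in_T(1,2)] turn_iff[OF b in_T(3,4)] dorbit_eq_iff[OF b in_T(1,3)]
      dorbit_eq_iff[OF b in_T(2,4)] by simp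
qed

lemma turn_linear:
  assumes b: "b \<in> points B" and t: "turn b v w" "turn b v' w'"
  shows "turn b (r *\<^sub>R v + s *\<^sub>R v') (r *\<^sub>R w + s *\<^sub>R w')"
proof -
  have in_T: "v \<in> tangent_space B b" "w \<in> tangent_space B b" "v' \<in> tangent_space B b" "w' \<in> tangent_space B b"
    using t unfolding turn_def by blast+
  have "r *\<^sub>R v + s *\<^sub>R v' \<in> tangent_space B b" "r *\<^sub>R w + s *\<^sub>R w' \<in> tangent_space B b"
    using in_T by (simp_all add: subspace_add[OF B.tangent_space_subspace] subspace_scale[OF B.tangent_space_subspace])
  then show ?thesis
    using t unfolding turn_def
    by (simp add: xi_form_linear[OF b] zeta_form_linear[OF b] in_T algebra_simps)
qed

lemma turn_turn:
  assumes b: "b \<in> points B" and t: "turn b v w"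
  shows "turn b w (- v)"
proof -
  have in_T: "v \<in> tangent_space B b" "w \<in> tangent_space B b"
    using t unfolding turn_def by blast+
  have m: "- v = (-1) *\<^sub>R v + 0 *\<^sub>R v" by simp
  have "- v \<in> tangent_space B b" using subspace_neg[OF B.tangent_space_subspace in_T(1)] .
  moreover have "xi_form k j M B b (- v) = - xi_form k j M B b v" if "j \<le> k div 2" for j
    unfolding m by (subst xi_form_linear[OF b in_T(1) in_T(1) that]) simp
  moreover have "zeta_form \<phi> b (- v) = - zeta_form \<phi> b v"
    unfolding m by (subst zeta_form_linear[OF b in_T(1) in_T(1)]) simp
  ultimately show ?thesis
    using t unfolding turn_def by (simp add: mult.assoc[symmetric])
qed

lemma turn_frame_act:
  assumes b: "b \<in> points B" and h: "h \<in> CO2" and t: "turn b v w"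
  shows "turn (frame_act k b h) (tangent_map B B (\<lambda>b. frame_act k b h) b v) (tangent_map B B (\<lambda>b. frame_act k b h) b w)"
proof -
  have in_T: "v \<in> tangent_space B b" "w \<in> tangent_space B b"
    using t unfolding turn_def by blast+
  obtain x y where xy: "h = conformal x y" "x\<^sup>2 + y\<^sup>2 \<noteq> 0" using h unfolding CO2_eq by blast
  have hG: "h \<in> GL2" using h CO2_subset_GL2 by blast
  let ?T = "tangent_map B B (\<lambda>b. frame_act k b h) b"
  show ?thesis
    unfolding turn_def
  proof (intro conjI allI impI)
    show "?T v \<in> tangent_space B (frame_act k b h)" "?T w \<in> tangent_space B (frame_act k b h)"
      by (rule tangent_map_frame_act_in[OF b hG in_T(1)], rule tangent_map_frame_act_in[OF b hG in_T(2)])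
    fix j assume j: "j \<le> k div 2"
    have "xi_form k j M B b w = \<i> * xi_form k j M B b v" using t j unfolding turn_def by blast
    then have "xi_char x y j * xi_form k j M B (frame_act k b h) (?T w) =
        xi_char x y j * (\<i> * xi_form k j M B (frame_act k b h) (?T v))"
      unfolding xi_form_conformal[OF b xy(2) in_T(1) j, folded xy(1)]
        xi_form_conformal[OF b xy(2) in_T(2) j, folded xy(1)] by (simp only: mult.left_commute)
    then show "xi_form k j M B (frame_act k b h) (?T w) = \<i> * xi_form k j M B (frame_act k b h) (?T v)"
      using xi_char_nonzero[OF xy(2)] by simp
  next
    have "complex_of_real (x\<^sup>2 + y\<^sup>2) * zeta_form \<phi> (frame_act k b h) (?T w) =
        complex_of_real (x\<^sup>2 + y\<^sup>2) * (\<i> * zeta_form \<phi> (frame_act k b h) (?T v))"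
      using zeta_form_conformal[OF b xy(2) in_T(1)] zeta_form_conformal[OF b xy(2) in_T(2)] t
      unfolding turn_def xy(1) by (simp only: mult.left_commute[of _ \<i>])
    moreover have "complex_of_real (x\<^sup>2 + y\<^sup>2) \<noteq> 0" using xy(2) by (simp only: of_real_eq_0_iff not_False_eq_True)
    ultimately show "zeta_form \<phi> (frame_act k b h) (?T w) = \<i> * zeta_form \<phi> (frame_act k b h) (?T v)"
      by (simp only: mult_cancel_left simp_thms)
  qed
qed

text \<open>\<open>dorbit b w\<close> does not depend on the choice of \<open>b\<close> in the orbit, nor on that of the lifts \<open>v\<close> and \<open>w\<close>
  (\<open>J_dorbit\<close>).\<close>

definition J where
  "J q t = (SOME s. \<exists>b v w. b \<in> points B \<and> CO2_orbit k b = q \<and> turn b v w \<and> dorbit b v = t \<and> dorbit b w = s)"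

text \<open>Two frames in an orbit differ by a conformal matrix, which multiplies every \<open>\<xi>\<^bsup>k,j\<^esup>\<close> and
  \<open>\<zeta>\<close> by a complex number; so multiplication by \<open>\<i>\<close> does not depend on the frame.\<close>

lemma J_dorbit:
  assumes b: "b \<in> points B" and t: "turn b v w"
  shows "J (CO2_orbit k b) (dorbit b v) = dorbit b w"
  unfolding J_def
proof (rule some_equality)
  show "\<exists>b' v' w'. b' \<in> points B \<and> CO2_orbit k b' = CO2_orbit k b \<and> turn b' v' w' \<and> dorbit b' v' = dorbit b v \<and> dorbit b' w' = dorbit b w"
    using assms by blast
  fix s assume "\<exists>b' v' w'. b' \<in> points B \<and> CO2_orbit k b' = CO2_orbit k b \<and> turn b' v' w' \<and> dorbit b' v' = dorbit b v \<and> dorbit b' w' = s"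
  then obtain b' v' w' where b': "b' \<in> points B" "CO2_orbit k b' = CO2_orbit k b" "turn b' v' w'"
    "dorbit b' v' = dorbit b v" "dorbit b' w' = s" by blast
  from b b'(2) obtain h where h: "h \<in> CO2" "b = frame_act k b' h" by (rule orbit_eq_imp_frame_act)
  have in_T: "v' \<in> tangent_space B b'" "w' \<in> tangent_space B b'"
    using b'(3) unfolding turn_def by blast+
  let ?T = "tangent_map B B (\<lambda>b. frame_act k b h) b'"
  have "turn b (?T v') (?T w')" unfolding h(2) by (rule turn_frame_act[OF b'(1) h(1) b'(3)])
  moreover have "dorbit b (?T v') = dorbit b v"
    unfolding b'(4)[symmetric] unfolding h(2) by (rule dorbit_frame_act[OF b'(1) h(1) in_T(1)])
  ultimately have "dorbit b (?T w') = dorbit b w" using turn_unique[OF b _ t] by blast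
  moreover have "dorbit b (?T w') = dorbit b' w'"
    unfolding h(2) by (rule dorbit_frame_act[OF b'(1) h(1) in_T(2)])
  ultimately show "s = dorbit b w" using b'(5) by simp
qed

lemma tangent_Q_cases:
  assumes "q \<in> points Q" "t \<in> tangent_space Q q"
  obtains b v w where "b \<in> points B" "q = CO2_orbit k b" "t = dorbit b v" "turn b v w"
proof -
  obtain b where b: "b \<in> points B" "q = CO2_orbit k b" using assms(1) unfolding points_Q by blast
  obtain v where v: "v \<in> tangent_space B b" "dorbit b v = t"
    using dorbit_surj[OF b(1)] assms(2) b(2) by metis
  obtain w where "turn b v w" using turn_exists[OF b(1) v(1)] .
  then show ?thesis using that b v(2) by blast
qed

lemma J_in:
  assumes "q \<in> points Q" "t \<in> tangent_space Q q"
  shows "J q t \<in> tangent_space Q q"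
proof -
  obtain b v w where *: "b \<in> points B" "q = CO2_orbit k b" "t = dorbit b v" "turn b v w"
    using assms by (rule tangent_Q_cases)
  have "w \<in> tangent_space B b" using *(4) unfolding turn_def by blast
  then show ?thesis unfolding *(2,3) J_dorbit[OF *(1,4)] by (rule dorbit_in[OF *(1)])
qed

lemma J_J:
  assumes "q \<in> points Q" "t \<in> tangent_space Q q"
  shows "J q (J q t) = - t"
proof -
  obtain b v w where *: "b \<in> points B" "q = CO2_orbit k b" "t = dorbit b v" "turn b v w"
    using assms by (rule tangent_Q_cases)
  have v: "v \<in> tangent_space B b" using *(4) unfolding turn_def by blast
  have "dorbit b ((-1) *\<^sub>R v + 0 *\<^sub>R v) = (-1) *\<^sub>R dorbit b v + 0 *\<^sub>R dorbit b v"
    by (rule dorbit_linear[OF *(1) v v])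
  then have "dorbit b (- v) = - dorbit b v" by simp
  then show ?thesis
    unfolding *(2,3) J_dorbit[OF *(1,4)] J_dorbit[OF *(1) turn_turn[OF *(1,4)]] .
qed

lemma J_linear:
  assumes q: "q \<in> points Q"
  shows "linear_on (tangent_space Q q) (J q)"
  unfolding linear_on_def
proof (intro ballI allI)
  fix t t' r s assume t: "t \<in> tangent_space Q q" "t' \<in> tangent_space Q q"
  obtain b v w where *: "b \<in> points B" "q = CO2_orbit k b" "t = dorbit b v" "turn b v w"
    using q t(1) by (rule tangent_Q_cases)
  obtain v' where v': "v' \<in> tangent_space B b" "dorbit b v' = t'"
    using dorbit_surj[OF *(1)] t(2) *(2) by metis
  obtain w' where w': "turn b v' w'" using turn_exists[OF *(1) v'(1)] .
  have in_T: "v \<in> tangent_space B b" "w \<in> tangent_space B b" "w' \<in> tangent_space B b"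
    using *(4) w' unfolding turn_def by blast+
  have "r *\<^sub>R t + s *\<^sub>R t' = dorbit b (r *\<^sub>R v + s *\<^sub>R v')"
    using dorbit_linear[OF *(1) in_T(1) v'(1)] *(3) v'(2) by simp
  then have "J q (r *\<^sub>R t + s *\<^sub>R t') = dorbit b (r *\<^sub>R w + s *\<^sub>R w')"
    using J_dorbit[OF *(1) turn_linear[OF *(1,4) w']] *(2) by simp
  also have "\<dots> = r *\<^sub>R dorbit b w + s *\<^sub>R dorbit b w'" by (rule dorbit_linear[OF *(1) in_T(2,3)])
  also have "\<dots> = r *\<^sub>R J q t + s *\<^sub>R J q t'"
    using J_dorbit[OF *(1,4)] J_dorbit[OF *(1) w'] *(2,3) v'(2) by simp
  finally show "J q (r *\<^sub>R t + s *\<^sub>R t') = r *\<^sub>R J q t + s *\<^sub>R J q t'" .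
qed

end

section \<open>Smoothness of the almost complex structure\<close>

context gl2_bundle_connection
begin

text \<open>Binary forms of degree \<open>k\<close> are identified with the model space \<open>'e\<close>, which has the same dimension, in order to
  apply the calculus of smooth families to endomorphisms of one Euclidean space.\<close>

definition basis_enum :: "nat \<Rightarrow> 'e" where
  "basis_enum = (SOME \<beta>. bij_betw \<beta> {..k} Basis)"

lemma basis_enum: "bij_betw basis_enum {..k} Basis"
proof -
  have "card {..k} = card (Basis :: 'e set)" using dim by simp
  then have "\<exists>\<beta>. bij_betw \<beta> {..k} (Basis :: 'e set)" by (intro finite_same_card_bij) auto
  then show ?thesis unfolding basis_enum_def by (rule someI_ex)
qed

definition to_form :: "'e \<Rightarrow> real \<Rightarrow> real \<Rightarrow> real" where
  "to_form x = (\<Sum>i\<le>k. (x \<bullet> basis_enum i) *\<^sub>R mono_xy k i)"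

lemma to_form_in_forms: "to_form x \<in> forms k"
  unfolding to_form_def forms_iff by (rule exI[of _ "\<lambda>i. x \<bullet> basis_enum i"]) (rule refl)

lemma to_form_linear: "to_form (r *\<^sub>R x + s *\<^sub>R y) = r *\<^sub>R to_form x + s *\<^sub>R to_form y"
  by (simp add: to_form_def inner_add_left scaleR_add_left sum.distrib scaleR_sum_right)

lemma to_form_inj:
  assumes "to_form x = to_form y" shows "x = y"
proof (rule euclidean_eqI)
  have eq: "x \<bullet> basis_enum i = y \<bullet> basis_enum i" if "i \<le> k" for i
    using indep_family_representation[OF finite_atMost indep_mono_xy, of i k "\<lambda>i. x \<bullet> basis_enum i"]
      indep_family_representation[OF finite_atMost indep_mono_xy, of i k "\<lambda>i. y \<bullet> basis_enum i"]
      assms that unfolding to_form_def by simp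
  fix b :: 'e assume "b \<in> Basis"
  then obtain i where "i \<le> k" "b = basis_enum i"
    using basis_enum unfolding bij_betw_def by blast
  then show "x \<bullet> b = y \<bullet> b" using eq by simp
qed

lemma to_form_surj:
  assumes "P \<in> forms k" shows "\<exists>x. to_form x = P"
proof -
  obtain c where c: "P = (\<Sum>i\<le>k. c i *\<^sub>R mono_xy k i)" using assms unfolding forms_iff by blast
  have "(\<Sum>l\<le>k. c l *\<^sub>R basis_enum l) \<bullet> basis_enum i = c i" if i: "i \<le> k" for i
  proof -
    have "basis_enum l \<bullet> basis_enum i = (if l = i then 1 else 0)" if "l \<le> k" for l
    proof -
      have "basis_enum l \<in> Basis" "basis_enum i \<in> Basis"
        using basis_enum that i unfolding bij_betw_def by auto
      moreover have "basis_enum l = basis_enum i \<longleftrightarrow> l = i"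
        using basis_enum that i unfolding bij_betw_def by (auto dest: inj_onD)
      ultimately show ?thesis by (simp add: inner_Basis)
    qed
    then have "(\<Sum>l\<le>k. c l *\<^sub>R basis_enum l) \<bullet> basis_enum i = (\<Sum>l\<le>k. c l * (if l = i then 1 else 0))"
      unfolding inner_sum_left by (intro sum.cong) auto
    also have "\<dots> = c i" using i by (simp add: if_distrib cong: if_cong)
    finally show ?thesis .
  qed
  then have "to_form (\<Sum>l\<le>k. c l *\<^sub>R basis_enum l) = P"
    unfolding to_form_def c by (intro sum.cong) auto
  then show ?thesis by blast
qed

lemma turn_form_linear:
  assumes "P \<in> forms k" "P' \<in> forms k"
  shows "turn_form (r *\<^sub>R P + s *\<^sub>R P') = r *\<^sub>R turn_form P + s *\<^sub>R turn_form P'"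
proof -
  have "turn_form (r *\<^sub>R P + s *\<^sub>R P') =
      form_of_xi k (\<lambda>j. r *\<^sub>R (\<i> * xi_lin k j P) + s *\<^sub>R (\<i> * xi_lin k j P'))"
    unfolding turn_form_def
  proof (rule xi_lin_eqI[OF odd_k form_of_xi_in_forms form_of_xi_in_forms])
    fix j assume j: "j \<le> k div 2"
    show "xi_lin k j (form_of_xi k (\<lambda>j. \<i> * xi_lin k j (r *\<^sub>R P + s *\<^sub>R P'))) =
        xi_lin k j (form_of_xi k (\<lambda>j. r *\<^sub>R (\<i> * xi_lin k j P) + s *\<^sub>R (\<i> * xi_lin k j P')))"
      by (simp add: xi_lin_form_of_xi[OF odd_k j] xi_lin_linear[OF odd_k assms j] algebra_simps)
  qed
  then show ?thesis by (simp only: form_of_xi_linear turn_form_def)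
qed

definition turn_vec :: "'e \<Rightarrow> 'e" where
  "turn_vec x = (SOME y. to_form y = turn_form (to_form x))"

lemma to_form_turn_vec: "to_form (turn_vec x) = turn_form (to_form x)"
proof -
  have "turn_form (to_form x) \<in> forms k" unfolding turn_form_def by (rule form_of_xi_in_forms)
  from to_form_surj[OF this] show ?thesis unfolding turn_vec_def by (rule someI_ex)
qed

lemma linear_turn_vec: "linear turn_vec"
proof -
  have "turn_vec (r *\<^sub>R x + s *\<^sub>R y) = r *\<^sub>R turn_vec x + s *\<^sub>R turn_vec y" for r s x y
    by (rule to_form_inj)
      (simp only: to_form_turn_vec to_form_linear turn_form_linear[OF to_form_in_forms to_form_in_forms])
  from this[of 1 _ 1] this[of _ _ 0] show ?thesis
    by (intro linearI) (simp_all only: scaleR_one scaleR_zero_left add_0_right)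
qed

definition section_pt :: "('m, 'e) chart \<Rightarrow> 'm set \<times> ('m \<Rightarrow> real^2 \<Rightarrow> 'v) \<Rightarrow> 'e \<times> complex \<Rightarrow> ('m, 'e) fpoint" where
  "section_pt C R y = frame_pt (snd R) (chart_inv C (fst y)) (ratio_matrix (snd y))"

definition frame_map :: "('m, 'e) chart \<Rightarrow> 'm set \<times> ('m \<Rightarrow> real^2 \<Rightarrow> 'v) \<Rightarrow> 'e \<times> complex \<Rightarrow> 'e \<Rightarrow> 'e" where
  "frame_map C R y x = (\<Sum>i\<le>k. (x \<bullet> basis_enum i) *\<^sub>R snd (section_pt C R y) i C)"

text \<open>The coordinates of the tangent vector of the quotient with prescribed values \<open>x\<close> of \<open>\<omega>\<close> and
  \<open>z\<close> of \<open>\<zeta>\<close>.\<close>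

definition form_coords ::
  "('m, 'e) chart \<Rightarrow> 'm set \<times> ('m \<Rightarrow> real^2 \<Rightarrow> 'v) \<Rightarrow> 'e \<times> complex \<Rightarrow> 'e \<times> complex \<Rightarrow> 'e \<times> complex" where
  "form_coords C R y u = (frame_map C R y (fst u), of_real (Im (snd y)) *
     (snd u - horizontal_zeta C R (section_pt C R y) (frame_map C R y (fst u))))"

definition turn_coords :: "'e \<times> complex \<Rightarrow> 'e \<times> complex" where
  "turn_coords u = (turn_vec (fst u), \<i> * snd u)"

lemma linear_turn_coords: "linear turn_coords"
  by (rule linearI)
    (simp_all add: turn_coords_def linear_add[OF linear_turn_vec] linear_cmul[OF linear_turn_vec] algebra_simps)

context
  fixes C R
  assumes C: "C \<in> M" and R: "R \<in> T"
begin

abbreviation (input) coord_range where "coord_range \<equiv> snd C ` (fst C \<inter> fst R) \<times> non_real"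

lemma coord_range_cases:
  assumes "y \<in> coord_range"
  obtains p where "p \<in> fst C" "p \<in> fst R" "snd y \<in> non_real" "fst y = snd C p"
    "section_pt C R y = frame_pt (snd R) p (ratio_matrix (snd y))"
    "snd (orbit_chart C R) (CO2_orbit k (section_pt C R y)) = y"
    "chart_at Q (CO2_orbit k (section_pt C R y)) (orbit_chart C R)" "section_pt C R y \<in> points B"
proof -
  obtain p where p: "p \<in> fst C" "p \<in> fst R" "snd y \<in> non_real" "fst y = snd C p" using assms by auto
  have s: "section_pt C R y = frame_pt (snd R) p (ratio_matrix (snd y))"
    unfolding section_pt_def p(4) using C p(1) by simp
  note g = ratio_matrix_in_GL2[OF p(3)]
  show ?thesis
  proof (rule that[OF p s])
    show "snd (orbit_chart C R) (CO2_orbit k (section_pt C R y)) = y"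
      unfolding s orbit_chart_orbit[OF R p(2)] using p(4) by (simp add: prod_eq_iff)
    show "chart_at Q (CO2_orbit k (section_pt C R y)) (orbit_chart C R)"
      unfolding s by (rule chart_at_orbit[OF C R p(1,2) g])
    show "section_pt C R y \<in> points B" unfolding s points_B by (rule frame_pt_in_frame_set[OF R p(2) g])
  qed
qed

lemma dorbit_form_coords:
  assumes y: "y \<in> coord_range" and v: "v \<in> tangent_space B (section_pt C R y)"
    and x: "soldering k M B (section_pt C R y) v = to_form x" and z: "zeta_form \<phi> (section_pt C R y) v = z"
  shows "dorbit (section_pt C R y) v =
    coord_vec Q (orbit_chart C R) (CO2_orbit k (section_pt C R y)) (form_coords C R y (x, z))"
proof -
  obtain p where p: "p \<in> fst C" "p \<in> fst R" "snd y \<in> non_real"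
    "section_pt C R y = frame_pt (snd R) p (ratio_matrix (snd y))"
    using coord_range_cases[OF y] by metis
  have "row_z (ratio_matrix (snd y)) 1 = 1" by (simp add: row_z_def one_complex.code)
  then have one: "of_real (det (ratio_matrix (snd y))) / (row_z (ratio_matrix (snd y)) 1)\<^sup>2 = complex_of_real (Im (snd y))"
    by (simp add: det_ratio_matrix)
  show ?thesis
    using dorbit_forms[OF C R p(1,2) ratio_matrix_in_GL2[OF p(3)] v[unfolded p(4)] x[unfolded p(4) to_form_def]]
    unfolding one p(4)[symmetric] z
    by (simp add: form_coords_def frame_map_def)
qed

lemma horizontal_zeta_linear:
  assumes b: "chart_at B b (frame_chart C R)"
  shows "linear (horizontal_zeta C R b)"
proof -
  have bB: "b \<in> points B" using b unfolding chart_at_def points_def by blast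
  note lin = B.coord_vec_linear[OF b]
  note cv = B.coord_vec_in_tangent_space[OF b]
  have "horizontal_zeta C R b (r *\<^sub>R e + s *\<^sub>R e') = r *\<^sub>R horizontal_zeta C R b e + s *\<^sub>R horizontal_zeta C R b e'"
    for r s e e'
  proof -
    have "(r *\<^sub>R e + s *\<^sub>R e', 0::real^2^2) = r *\<^sub>R (e, 0) + s *\<^sub>R (e', 0)" by simp
    then have "coord_vec B (frame_chart C R) b (r *\<^sub>R e + s *\<^sub>R e', 0) =
        r *\<^sub>R coord_vec B (frame_chart C R) b (e, 0) + s *\<^sub>R coord_vec B (frame_chart C R) b (e', 0)"
      by (simp only: linear_add[OF lin] linear_cmul[OF lin])
    then show ?thesis
      unfolding horizontal_zeta_def
      by (simp only: connection_linear[OF bB cv cv] linear_add[OF linear_zeta_mat] linear_cmul[OF linear_zeta_mat])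
  qed
  from this[of 1 _ 1] this[of _ _ 0] show ?thesis
    by (intro linearI) (simp_all only: scaleR_one scaleR_zero_left add_0_right)
qed

lemma chart_at_section_pt:
  assumes "y \<in> coord_range" shows "chart_at B (section_pt C R y) (frame_chart C R)"
proof -
  obtain p where p: "p \<in> fst C" "p \<in> fst R" "snd y \<in> non_real"
    "section_pt C R y = frame_pt (snd R) p (ratio_matrix (snd y))"
    using coord_range_cases[OF assms] by metis
  show ?thesis unfolding p(4) by (rule chart_at_frame_pt[OF C R p(1,2) ratio_matrix_in_GL2[OF p(3)]])
qed

lemma linear_frame_map: "linear (frame_map C R y)"
  by (rule linearI) (simp_all add: frame_map_def inner_add_left scaleR_add_left sum.distrib scaleR_sum_right)

lemma linear_form_coords:
  assumes "y \<in> coord_range" shows "linear (form_coords C R y)"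
  by (rule linearI)
    (simp_all add: form_coords_def linear_add[OF linear_frame_map] linear_cmul[OF linear_frame_map]
      linear_add[OF horizontal_zeta_linear[OF chart_at_section_pt[OF assms]]]
      linear_cmul[OF horizontal_zeta_linear[OF chart_at_section_pt[OF assms]]] algebra_simps)

text \<open>Values of \<open>\<omega>\<close> and \<open>\<zeta>\<close> can be prescribed, and different values belong to different tangent vectors
  of the quotient.\<close>

lemma bij_form_coords:
  assumes y: "y \<in> coord_range" shows "bij (form_coords C R y)"
proof -
  let ?b = "section_pt C R y"
  obtain p where b: "?b \<in> points B" using coord_range_cases[OF y] by metis
  have "inj (form_coords C R y)"
  proof (rule injI)
    fix u u' assume eq: "form_coords C R y u = form_coords C R y u'"
    obtain v where v: "v \<in> tangent_space B ?b" "soldering k M B ?b v = to_form (fst u)" "zeta_form \<phi> ?b v = snd u"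
      using forms_surjective[OF b to_form_in_forms] by metis
    obtain v' where v': "v' \<in> tangent_space B ?b" "soldering k M B ?b v' = to_form (fst u')" "zeta_form \<phi> ?b v' = snd u'"
      using forms_surjective[OF b to_form_in_forms] by metis
    have "dorbit ?b v = dorbit ?b v'"
      using dorbit_form_coords[OF y v] dorbit_form_coords[OF y v'] eq by simp
    then have "to_form (fst u) = to_form (fst u')" "snd u = snd u'"
      unfolding dorbit_eq_iff[OF b v(1) v'(1)] v(2,3) v'(2,3) by blast+
    then show "u = u'" using to_form_inj by (simp add: prod_eq_iff)
  qed
  then show ?thesis
    using linear_injective_imp_surjective[OF linear_form_coords[OF y]] by (simp add: bij_def)
qed

text \<open>In the coordinates given by the values of \<open>\<omega>\<close> and \<open>\<zeta>\<close> the structure is the constant map \<open>turn_coords\<close>; the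
  family \<open>form_coords\<close> translates to the chart \<open>orbit_chart C R\<close>.\<close>

definition J_coords :: "'e \<times> complex \<Rightarrow> 'e \<times> complex \<Rightarrow> 'e \<times> complex" where
  "J_coords y u = form_coords C R y (turn_coords (inv (form_coords C R y) u))"

lemma J_coord_vec:
  assumes q: "q \<in> fst (orbit_chart C R)"
  shows "J q (coord_vec Q (orbit_chart C R) q u) = coord_vec Q (orbit_chart C R) q (J_coords (snd (orbit_chart C R) q) u)"
proof -
  define y where "y = snd (orbit_chart C R) q"
  have y: "y \<in> coord_range" using q image_orbit_chart[OF R, of C] unfolding y_def by blast
  let ?b = "section_pt C R y"
  have b: "?b \<in> points B" and at: "chart_at Q (CO2_orbit k ?b) (orbit_chart C R)"
    and y': "snd (orbit_chart C R) (CO2_orbit k ?b) = y"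
    using coord_range_cases[OF y] by metis+
  have qb: "q = CO2_orbit k ?b"
  proof (rule inj_onD[OF inj_on_orbit_chart[OF C R] _ q])
    show "snd (orbit_chart C R) q = snd (orbit_chart C R) (CO2_orbit k ?b)" using y' unfolding y_def by (rule sym)
    show "CO2_orbit k ?b \<in> fst (orbit_chart C R)" using at by (simp add: chart_at_def)
  qed
  obtain x z where xz: "inv (form_coords C R y) u = (x, z)" by fastforce
  have u: "u = form_coords C R y (x, z)"
    using bij_form_coords[OF y] xz by (metis bij_inv_eq_iff)
  obtain v where v: "v \<in> tangent_space B ?b" "soldering k M B ?b v = to_form x" "zeta_form \<phi> ?b v = z"
    using forms_surjective[OF b to_form_in_forms] by metis
  obtain w where w: "w \<in> tangent_space B ?b" "soldering k M B ?b w = to_form (turn_vec x)" "zeta_form \<phi> ?b w = \<i> * z"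
    using forms_surjective[OF b to_form_in_forms] by metis
  have "turn ?b v w"
    unfolding turn_iff[OF b v(1) w(1)] v(2,3) w(2,3) to_form_turn_vec by simp
  from J_dorbit[OF b this] show ?thesis
    unfolding dorbit_form_coords[OF y v] dorbit_form_coords[OF y w] qb[symmetric] y_def[symmetric] u[symmetric]
    by (simp add: J_coords_def xz turn_coords_def)
qed

lemma open_coord_range: "open coord_range"
  by (rule open_orbit_image[OF C R])

text \<open>The frame at \<open>section_pt C R y\<close> is the frame given by the local frame \<open>R\<close> of \<open>E\<close>, smooth by the definition
  of a \<open>GL(2)\<close>-structure, times \<open>\<rho>\<^sub>k\<close> of a smooth family of matrices.\<close>

lemma smooth_frame_map: "smooth_on coord_range (\<lambda>y. frame_map C R y x)"
proof -
  note op = open_coord_range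
  let ?I = "snd C ` (fst C \<inter> fst R)"
  have I: "open ?I" by (rule M.mopen_open_image[OF bundle_frame(1)[OF R] C])
  let ?s = "\<lambda>j p. \<Theta> p (sym_mono k j (snd R p (axis 1 1)) (snd R p (axis 2 1)))"
  have base: "smooth_on coord_range (\<lambda>y. ?s j (chart_inv C (fst y)) C)" if j: "j \<le> k" for j
  proof (rule smooth_on_compose[OF op I _ smooth_on_fst[OF op smooth_on_ident[OF op]]])
    have "smooth_section M (tangent_frames M) (fst R) (?s j)"
      using gl2 R j unfolding gl2_structure_def by (auto simp: case_prod_beta)
    then have "smooth_fun M (fst C \<inter> fst R) (\<lambda>p. ?s j p C)"
      by (rule M.smooth_tangent_sectionD[OF _ C bundle_frame(1)[OF R]])
    from M.smooth_funD[OF this C] show "smooth_on ?I (\<lambda>e. ?s j (chart_inv C e) C)"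
      by (simp add: comp_def Int_absorb[of "fst C"] Int_assoc[symmetric])
  qed auto
  have rho: "smooth_on coord_range (\<lambda>y. rho k (ratio_matrix (snd y)) j i)" if "i \<le> k" "j \<le> k" for i j
    by (rule smooth_on_compose[OF op open_UNIV _ _ smooth_rho[OF that(2,1)]])
      (auto intro: smooth_on_compose[OF op open_UNIV _ smooth_on_snd[OF op smooth_on_ident[OF op]] smooth_ratio_matrix[OF open_UNIV]])
  have eq: "snd (section_pt C R y) i C =
      (\<Sum>j\<le>k. rho k (ratio_matrix (snd y)) j i *\<^sub>R ?s j (chart_inv C (fst y)) C)"
    if y: "y \<in> coord_range" and i: "i \<le> k" for y i
  proof -
    obtain p where p: "p \<in> fst C" "p \<in> fst R" "fst y = snd C p"
      "section_pt C R y = frame_pt (snd R) p (ratio_matrix (snd y))"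
      using coord_range_cases[OF y] by metis
    have "section_pt C R y = frame_act k (frame_pt (snd R) p (mat 1)) (ratio_matrix (snd y))"
      unfolding p(4) frame_act_frame_pt[OF R p(2)] by simp
    moreover have "column i (mat 1 :: real^2^2) = axis i 1" for i
      by (simp add: vec_eq_iff column_def mat_def axis_def)
    ultimately show ?thesis
      using i C p by (simp add: frame_act_def frame_pt_def power_frame_def sum_fun_apply scaleR_fun_apply)
  qed
  have "smooth_on coord_range (\<lambda>y. \<Sum>i\<le>k. (x \<bullet> basis_enum i) *\<^sub>R
      (\<Sum>j\<le>k. rho k (ratio_matrix (snd y)) j i *\<^sub>R ?s j (chart_inv C (fst y)) C))"
    by (intro smooth_on_sum[OF op] smooth_on_scaleR[OF op] smooth_on_const[OF op] rho base) auto
  then show ?thesis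
    by (rule smooth_on_cong[OF op, rotated]) (simp add: frame_map_def eq)
qed

lemma smooth_horizontal_zeta: "smooth_on coord_range (\<lambda>y. horizontal_zeta C R (section_pt C R y) e)"
proof -
  note op = open_coord_range
  let ?K = "frame_chart C R" and ?G = "snd C ` (fst C \<inter> fst R) \<times> GL2"
  have K: "?K \<in> B" by (rule frame_chart_in_B[OF C R])
  have "fst ?K \<inter> (fst ?K \<inter> points B) = {b \<in> fst ?K. fst b \<in> UNIV}" using K unfolding points_def by auto
  then have im: "snd ?K ` (fst ?K \<inter> (fst ?K \<inter> points B)) = ?G"
    using image_frame_chart[OF R, of C UNIV] by simp
  have "smooth_fun B (fst ?K \<inter> points B) (\<lambda>b. \<phi> b (coord_vec B ?K b (e, 0)))"
    using connection K unfolding gl2_connection_def smooth_form_def by blast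
  from B.smooth_funD[OF this K]
  have sm: "smooth_on ?G ((\<lambda>b. \<phi> b (coord_vec B ?K b (e, 0))) \<circ> chart_inv ?K)"
    unfolding im .
  have "smooth_on coord_range (\<lambda>y. ((\<lambda>b. \<phi> b (coord_vec B ?K b (e, 0))) \<circ> chart_inv ?K) (ratio_section y))"
    by (rule smooth_on_compose[OF op open_frame_image[OF C R] _ smooth_ratio_section[OF op] sm])
      (use ratio_matrix_in_GL2 in \<open>auto simp: ratio_section_def\<close>)
  then have "smooth_on coord_range (\<lambda>y. zeta_mat (((\<lambda>b. \<phi> b (coord_vec B ?K b (e, 0))) \<circ> chart_inv ?K) (ratio_section y)))"
    by (rule smooth_on_linear[OF op linear_zeta_mat])
  then show ?thesis
  proof (rule smooth_on_cong[OF op, rotated])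
    fix y assume y: "y \<in> coord_range"
    obtain p where p: "p \<in> fst C" "p \<in> fst R" "snd y \<in> non_real" "fst y = snd C p"
      "section_pt C R y = frame_pt (snd R) p (ratio_matrix (snd y))"
      using coord_range_cases[OF y] by metis
    have "chart_inv ?K (ratio_section y) = section_pt C R y"
      unfolding ratio_section_def p(4,5) by (rule chart_inv_frame_chart[OF C R p(1,2) ratio_matrix_in_GL2[OF p(3)]])
    then show "zeta_mat (((\<lambda>b. \<phi> b (coord_vec B ?K b (e, 0))) \<circ> chart_inv ?K) (ratio_section y)) =
        horizontal_zeta C R (section_pt C R y) e"
      by (simp add: horizontal_zeta_def)
  qed
qed

lemma smooth_form_coords: "smooth_on coord_range (\<lambda>y. form_coords C R y u)"
proof -
  note op = open_coord_range
  have "smooth_on coord_range (\<lambda>y. horizontal_zeta C R (section_pt C R y) (frame_map C R y (fst u)))"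
    by (rule smooth_on_linear_family[where L = "\<lambda>y. horizontal_zeta C R (section_pt C R y)",
          OF op horizontal_zeta_linear[OF chart_at_section_pt] smooth_horizontal_zeta smooth_frame_map])
  moreover have "smooth_on coord_range (\<lambda>y. complex_of_real (Im (snd y)))"
    by (intro smooth_on_bounded_linear[OF op bounded_linear_of_real] smooth_on_bounded_linear[OF op bounded_linear_Im]
        smooth_on_snd[OF op] smooth_on_ident[OF op])
  ultimately show ?thesis
    unfolding form_coords_def
    by (intro smooth_on_Pair[OF op] smooth_on_mult[OF op] smooth_on_diff[OF op] smooth_on_const[OF op] smooth_frame_map)
qed

lemma J_coords_linear:
  assumes y: "y \<in> coord_range"
  shows "linear (J_coords y)" and "linear (inv (form_coords C R y))"
proof -
  note lin = linear_form_coords[OF y]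
  note bij = bij_form_coords[OF y]
  obtain f where f: "linear f" "f \<circ> form_coords C R y = id"
    using linear_injective_left_inverse[OF lin bij_is_inj[OF bij]] by blast
  have "inv (form_coords C R y) u = f u" for u
    using fun_cong[OF f(2), of "inv (form_coords C R y) u"] bij by (simp add: bij_is_surj surj_f_inv_f)
  then show inv: "linear (inv (form_coords C R y))" using f(1) by (metis ext)
  have "J_coords y = form_coords C R y \<circ> (turn_coords \<circ> inv (form_coords C R y))"
    by (auto simp: J_coords_def)
  then show "linear (J_coords y)"
    using linear_compose[OF linear_compose[OF inv linear_turn_coords] lin] by simp
qed

lemma smooth_J_coords: "smooth_on coord_range (\<lambda>y. J_coords y u)"
proof -
  note op = open_coord_range
  have bij: "inv (form_coords C R y) (form_coords C R y v) = v" "form_coords C R y (inv (form_coords C R y) v) = v"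
    if "y \<in> coord_range" for y v
    using bij_form_coords[OF that] by (simp_all add: bij_is_inj bij_is_surj surj_f_inv_f)
  have "smooth_on coord_range (\<lambda>y. inv (form_coords C R y) u)"
    by (rule smooth_on_linear_inverse[where A = "form_coords C R" and G = "\<lambda>y. inv (form_coords C R y)",
          OF op linear_form_coords J_coords_linear(2) bij smooth_form_coords])
  then have h: "smooth_on coord_range (\<lambda>y. turn_coords (inv (form_coords C R y) u))"
    by (rule smooth_on_linear[OF op linear_turn_coords])
  show ?thesis
    unfolding J_coords_def
    by (rule smooth_on_linear_family[where L = "form_coords C R", OF op linear_form_coords smooth_form_coords h])
qed

end

text \<open>In arbitrary charts \<open>D\<close> and \<open>D'\<close> of the quotient the matrix of \<open>J\<close> is obtained from its matrix
  in a chart \<open>orbit_chart C R\<close> by multiplication with Jacobians.\<close>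

lemma smooth_section_J:
  assumes D: "D \<in> Q"
  shows "smooth_section Q (tangent_frames Q) (fst D) (\<lambda>q. J q (coord_vec Q D q u))"
proof (rule Q.smooth_tangent_sectionI)
  fix q assume q: "q \<in> fst D"
  then have "chart_at Q q D" "q \<in> points Q" using D by (auto simp: chart_at_def points_def)
  then show "J q (coord_vec Q D q u) \<in> tangent_space Q q"
    using J_in Q.coord_vec_in_tangent_space by blast
next
  fix D' assume D': "D' \<in> Q"
  show "smooth_fun Q (fst D' \<inter> fst D) (\<lambda>q. J q (coord_vec Q D q u) D')"
  proof (rule Q.smooth_funI_local)
    fix q0 assume q0: "q0 \<in> fst D' \<inter> fst D" and "q0 \<in> points Q"
    then obtain C R where CR: "C \<in> M" "R \<in> T" "q0 \<in> fst (orbit_chart C R)"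
      using point_Q_cases points_Q by metis
    define K where "K = orbit_chart C R"
    have K: "K \<in> Q" unfolding K_def by (rule orbit_chart_in_Q[OF CR(1,2)])
    define G where "G = snd K ` (fst K \<inter> (fst D \<inter> fst D'))"
    have G: "open G"
      unfolding G_def by (rule Q.mopen_open_image[OF Q.mopen_Int[OF Q.mopen_domain[OF D] Q.mopen_domain[OF D']] K])
    have GD: "G \<subseteq> snd K ` (fst K \<inter> fst D)" "G \<subseteq> snd K ` (fst K \<inter> fst D')" unfolding G_def by auto
    have Grange: "G \<subseteq> snd C ` (fst C \<inter> fst R) \<times> non_real"
      unfolding G_def K_def using image_orbit_chart[OF CR(2), of C] by blast
    have KD: "smooth_on G (coord_change K D)" by (rule smooth_on_subset[OF Q.coord_change_smooth[OF K D] GD(1)])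
    have KD': "smooth_on G (coord_change K D')" by (rule smooth_on_subset[OF Q.coord_change_smooth[OF K D'] GD(2)])
    let ?jac = "\<lambda>y. frechet_derivative (coord_change D K) (at (coord_change K D y)) u"
    have jac: "smooth_on G ?jac"
    proof (rule smooth_on_compose[OF G Q.overlap_open[OF D K] _ KD])
      show "coord_change K D ` G \<subseteq> snd D ` (fst D \<inter> fst K)"
      proof (rule image_subsetI)
        fix y assume "y \<in> G"
        then obtain q where q: "q \<in> fst K" "q \<in> fst D" "y = snd K q" unfolding G_def by blast
        show "coord_change K D y \<in> snd D ` (fst D \<inter> fst K)"
          unfolding q(3) Q.coord_change_chart[OF K q(1)] using q(1,2) by blast
      qed
      show "smooth_on (snd D ` (fst D \<inter> fst K)) (\<lambda>x. frechet_derivative (coord_change D K) (at x) u)"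
        by (rule smooth_on_frechet_derivative[OF Q.coord_change_smooth[OF D K]])
    qed
    have Jc: "smooth_on G (\<lambda>y. J_coords C R y (?jac y))"
      by (rule smooth_on_linear_family[where L = "J_coords C R", OF G _ _ jac])
        (use J_coords_linear(1)[OF CR(1,2)] smooth_on_subset[OF smooth_J_coords[OF CR(1,2)] Grange] Grange in blast)+
    have "smooth_on G (\<lambda>y. frechet_derivative (coord_change K D') (at y) (J_coords C R y (?jac y)))"
      by (rule smooth_on_linear_family[where L = "\<lambda>y. frechet_derivative (coord_change K D') (at y)", OF G _ _ Jc])
        (use has_derivative_linear[OF smooth_on_has_derivative[OF KD']] smooth_on_frechet_derivative[OF KD'] in blast)+
    then have "smooth_on G ((\<lambda>q. J q (coord_vec Q D q u) D') \<circ> chart_inv K)"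
    proof (rule smooth_on_cong[OF G, rotated])
      fix y assume "y \<in> G"
      then obtain q where q: "q \<in> fst K" "q \<in> fst D" "q \<in> fst D'" "y = snd K q" unfolding G_def by blast
      have at: "chart_at Q q K" "chart_at Q q D" "chart_at Q q D'" using q K D D' by (simp_all add: chart_at_def)
      have "coord_vec Q D q u = coord_vec Q K q (coord_vec Q D q u K)"
        using Q.coord_vec_eq[OF Q.coord_vec_in_tangent_space[OF at(2)] at(1)] by simp
      also have "coord_vec Q D q u K = ?jac y"
        unfolding Q.coord_vec_apply[OF at(1)] coord_jacobian_def q(4) Q.coord_change_chart[OF K q(1)] ..
      finally have "J q (coord_vec Q D q u) = coord_vec Q K q (J_coords C R y (?jac y))"
        using J_coord_vec[OF CR(1,2), of q "?jac y"] q unfolding K_def by simp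
      then have "J q (coord_vec Q D q u) D' = frechet_derivative (coord_change K D') (at y) (J_coords C R y (?jac y))"
        unfolding q(4) by (simp add: Q.coord_vec_apply[OF at(3)] coord_jacobian_def)
      then show "frechet_derivative (coord_change K D') (at y) (J_coords C R y (?jac y)) =
          ((\<lambda>q. J q (coord_vec Q D q u) D') \<circ> chart_inv K) y"
        using K q by simp
    qed
    moreover have "snd K q0 \<in> G" unfolding G_def using q0 CR(3) K_def by blast
    moreover have "chart_at Q q0 K" using K CR(3) by (simp add: chart_at_def K_def)
    moreover have "G \<subseteq> snd K ` fst K" unfolding G_def by blast
    ultimately show "\<exists>K G. chart_at Q q0 K \<and> open G \<and> snd K q0 \<in> G \<and> G \<subseteq> snd K ` fst K \<and>
        smooth_on G ((\<lambda>q. J q (coord_vec Q D q u) D') \<circ> chart_inv K)"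
      using G by blast
  qed
qed

lemma almost_complex_structure_J: "almost_complex_structure Q J"
  unfolding almost_complex_structure_def
  using J_linear J_in J_J smooth_section_J by blast

section \<open>Forms of type \<open>(1,0)\<close>\<close>

text \<open>A form \<open>A\<close> on the tangent space at \<open>b\<close> that is pulled back from the quotient is a function of
  the values of the \<open>\<xi>\<^bsup>k,j\<^esup>\<close> and \<open>\<zeta>\<close>; if it commutes with multiplication by \<open>\<i>\<close>, this function is
  complex linear.\<close>

lemma complex_linear_combination:
  assumes b: "b \<in> points B"
    and lin: "\<And>v w r s. v \<in> tangent_space B b \<Longrightarrow> w \<in> tangent_space B b \<Longrightarrow> A (r *\<^sub>R v + s *\<^sub>R w) = r *\<^sub>R A v + s *\<^sub>R A w"
    and pulled: "\<And>v w. v \<in> tangent_space B b \<Longrightarrow> w \<in> tangent_space B b \<Longrightarrow> dorbit b v = dorbit b w \<Longrightarrow> A v = A w"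
    and turned: "\<And>v w. turn b v w \<Longrightarrow> A w = \<i> * A v"
  shows "\<exists>c d. \<forall>v\<in>tangent_space B b. A v = (\<Sum>j\<le>k div 2. c j * xi_form k j M B b v) + d * zeta_form \<phi> b v"
proof -
  define L where "L c z = A (SOME v. v \<in> tangent_space B b \<and> soldering k M B b v = form_of_xi k c \<and> zeta_form \<phi> b v = z)" for c z
  have L: "A v = L c z" if v: "v \<in> tangent_space B b" "soldering k M B b v = form_of_xi k c" "zeta_form \<phi> b v = z" for v c z
  proof -
    define w where "w = (SOME v. v \<in> tangent_space B b \<and> soldering k M B b v = form_of_xi k c \<and> zeta_form \<phi> b v = z)"
    have w: "w \<in> tangent_space B b \<and> soldering k M B b w = form_of_xi k c \<and> zeta_form \<phi> b w = z"
      unfolding w_def by (rule someI[of _ v]) (use v in blast)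
    then have "dorbit b v = dorbit b w" using dorbit_eq_iff[OF b, of v w] v by simp
    then have "A v = A w" using pulled v(1) w by blast
    then show ?thesis by (simp add: L_def w_def)
  qed
  have lift: "\<exists>v. v \<in> tangent_space B b \<and> soldering k M B b v = form_of_xi k c \<and> zeta_form \<phi> b v = z" for c z
    using forms_surjective[OF b form_of_xi_in_forms] by metis
  have L_lin: "L (\<lambda>j. r *\<^sub>R c j + s *\<^sub>R c' j) (r *\<^sub>R z + s *\<^sub>R z') = r *\<^sub>R L c z + s *\<^sub>R L c' z'" for r s c c' z z'
  proof -
    obtain v where v: "v \<in> tangent_space B b" "soldering k M B b v = form_of_xi k c" "zeta_form \<phi> b v = z" using lift by blast
    obtain w where w: "w \<in> tangent_space B b" "soldering k M B b w = form_of_xi k c'" "zeta_form \<phi> b w = z'" using lift by blast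
    have "r *\<^sub>R v + s *\<^sub>R w \<in> tangent_space B b"
      using v w by (simp add: subspace_add[OF B.tangent_space_subspace] subspace_scale[OF B.tangent_space_subspace])
    from L[OF this, of "\<lambda>j. r *\<^sub>R c j + s *\<^sub>R c' j" "r *\<^sub>R z + s *\<^sub>R z'"] show ?thesis
      using L[OF v] L[OF w] lin[OF v(1) w(1)] soldering_linear[OF b v(1) w(1)] zeta_form_linear[OF b v(1) w(1)]
      by (simp add: form_of_xi_linear v w)
  qed
  have L_i: "L (\<lambda>j. \<i> * c j) (\<i> * z) = \<i> * L c z" for c z
  proof -
    obtain v where v: "v \<in> tangent_space B b" "soldering k M B b v = form_of_xi k c" "zeta_form \<phi> b v = z" using lift by blast
    obtain w where w: "w \<in> tangent_space B b" "soldering k M B b w = form_of_xi k (\<lambda>j. \<i> * c j)" "zeta_form \<phi> b w = \<i> * z" using lift by blast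
    have "turn b v w"
      unfolding turn_def using v w by (simp add: xi_form_def xi_lin_form_of_xi[OF odd_k])
    then show ?thesis using turned L[OF v] L[OF w] by simp
  qed
  have L_scale: "L (\<lambda>j. a * c j) (a * z) = a * L c z" for a c z
  proof -
    have "L (\<lambda>j. Re a *\<^sub>R c j + Im a *\<^sub>R (\<i> * c j)) (Re a *\<^sub>R z + Im a *\<^sub>R (\<i> * z)) =
        Re a *\<^sub>R L c z + Im a *\<^sub>R (\<i> * L c z)" unfolding L_lin L_i ..
    moreover have "Re a *\<^sub>R x + Im a *\<^sub>R (\<i> * x) = a * x" for x by (simp add: complex_eq_iff)
    ultimately show ?thesis by simp
  qed
  have L_add: "L (\<lambda>j. c j + c' j) (z + z') = L c z + L c' z'" for c c' z z'
    using L_lin[of 1 c 1 c' z z'] by simp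
  \<comment> \<open>\<open>L\<close> is complex linear on infinite coefficient sequences, of which only the first
    \<open>k div 2 + 1\<close> matter; the induction on \<open>n\<close> replaces an expansion in a basis.\<close>
  define unit :: "nat \<Rightarrow> nat \<Rightarrow> complex" where "unit l j = (if j = l then 1 else 0)" for l j
  have L_sum: "L (\<lambda>j. if j < n then c j else 0) z = (\<Sum>j<n. c j * L (unit j) 0) + z * L (\<lambda>j. 0) 1" for n c z
  proof (induction n)
    case 0
    show ?case using L_scale[of z "\<lambda>j. 0" 1] by simp
  next
    case (Suc n)
    have "(\<lambda>j. if j < Suc n then c j else 0) = (\<lambda>j. (if j < n then c j else 0) + c n * unit n j)"
      by (auto simp: unit_def fun_eq_iff less_Suc_eq)
    then have "L (\<lambda>j. if j < Suc n then c j else 0) z = L (\<lambda>j. if j < n then c j else 0) z + c n * L (unit n) 0"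
      using L_add[of "\<lambda>j. if j < n then c j else 0" "\<lambda>j. c n * unit n j" z 0] L_scale[of "c n" "unit n" 0] by simp
    then show ?case using Suc.IH by simp
  qed
  have "A v = (\<Sum>j\<le>k div 2. L (unit j) 0 * xi_form k j M B b v) + L (\<lambda>j. 0) 1 * zeta_form \<phi> b v"
    if v: "v \<in> tangent_space B b" for v
  proof -
    define c where "c j = xi_form k j M B b v" for j
    have "form_of_xi k (\<lambda>j. if j < Suc (k div 2) then c j else 0) = form_of_xi k c"
      by (simp add: form_of_xi_def)
    also have "\<dots> = soldering k M B b v"
      unfolding c_def xi_form_def by (rule form_of_xi_xi_lin[OF odd_k soldering_in_forms[OF b v]])
    finally have "A v = L (\<lambda>j. if j < Suc (k div 2) then c j else 0) (zeta_form \<phi> b v)"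
      using L[OF v] by simp
    then show ?thesis unfolding L_sum lessThan_Suc_atMost by (simp add: c_def mult.commute)
  qed
  then show ?thesis
    by (intro exI[of _ "\<lambda>j. L (unit j) 0"] exI[of _ "L (\<lambda>j. 0) 1"] ballI)
qed

lemma forms_10_characterized_J: "forms_10_characterized k M B Q \<phi> J"
  unfolding forms_10_characterized_def
proof (intro allI impI)
  fix W and \<alpha> :: "('m, 'e) fpoint set \<Rightarrow> (('m, 'e) fpoint set, 'e \<times> complex) tvec \<Rightarrow> complex"
  assume "mopen Q W \<and> smooth_form Q W \<alpha>"
  then have W: "W \<subseteq> points Q" and lin: "\<And>q. q \<in> W \<Longrightarrow> linear_on (tangent_space Q q) (\<alpha> q)"
    unfolding mopen_def smooth_form_def by blast+
  show "form_10 Q J W \<alpha> \<longleftrightarrow> (\<exists>c d. \<forall>b\<in>points B \<inter> CO2_orbit k -` W. \<forall>v\<in>tangent_space B b.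
      \<alpha> (CO2_orbit k b) (tangent_map B Q (CO2_orbit k) b v) =
      (\<Sum>j\<le>k div 2. c j b * xi_form k j M B b v) + d b * zeta_form \<phi> b v)"
    unfolding dorbit_def[symmetric]
  proof
    assume form: "form_10 Q J W \<alpha>"
    have ex: "\<exists>c d. \<forall>v\<in>tangent_space B b. \<alpha> (CO2_orbit k b) (dorbit b v) =
        (\<Sum>j\<le>k div 2. c j * xi_form k j M B b v) + d * zeta_form \<phi> b v"
      if bW: "b \<in> points B \<inter> CO2_orbit k -` W" for b
    proof (rule complex_linear_combination)
      show b: "b \<in> points B" using bW by blast
      have q: "CO2_orbit k b \<in> W" using bW by blast
      show "\<alpha> (CO2_orbit k b) (dorbit b (r *\<^sub>R v + s *\<^sub>R w)) =
          r *\<^sub>R \<alpha> (CO2_orbit k b) (dorbit b v) + s *\<^sub>R \<alpha> (CO2_orbit k b) (dorbit b w)"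
        if "v \<in> tangent_space B b" "w \<in> tangent_space B b" for v w r s
        using lin[OF q] dorbit_in[OF b that(1)] dorbit_in[OF b that(2)]
        unfolding dorbit_linear[OF b that] linear_on_def by blast
      show "\<alpha> (CO2_orbit k b) (dorbit b w) = \<i> * \<alpha> (CO2_orbit k b) (dorbit b v)" if t: "turn b v w" for v w
      proof -
        have "v \<in> tangent_space B b" using t unfolding turn_def by blast
        then show ?thesis
          using form q dorbit_in[OF b] unfolding form_10_def J_dorbit[OF b t, symmetric] by blast
      qed
    qed simp
    then have "\<forall>b\<in>points B \<inter> CO2_orbit k -` W. \<exists>cd. \<forall>v\<in>tangent_space B b. \<alpha> (CO2_orbit k b) (dorbit b v) =
        (\<Sum>j\<le>k div 2. fst cd j * xi_form k j M B b v) + snd cd * zeta_form \<phi> b v"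
      by fastforce
    then obtain cd where "\<forall>b\<in>points B \<inter> CO2_orbit k -` W. \<forall>v\<in>tangent_space B b. \<alpha> (CO2_orbit k b) (dorbit b v) =
        (\<Sum>j\<le>k div 2. fst (cd b) j * xi_form k j M B b v) + snd (cd b) * zeta_form \<phi> b v"
      unfolding bchoice_iff by blast
    then show "\<exists>c d. \<forall>b\<in>points B \<inter> CO2_orbit k -` W. \<forall>v\<in>tangent_space B b. \<alpha> (CO2_orbit k b) (dorbit b v) =
        (\<Sum>j\<le>k div 2. c j b * xi_form k j M B b v) + d b * zeta_form \<phi> b v"
      by (intro exI[of _ "\<lambda>j b. fst (cd b) j"] exI[of _ "\<lambda>b. snd (cd b)"])
  next
    assume "\<exists>c d. \<forall>b\<in>points B \<inter> CO2_orbit k -` W. \<forall>v\<in>tangent_space B b. \<alpha> (CO2_orbit k b) (dorbit b v) =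
        (\<Sum>j\<le>k div 2. c j b * xi_form k j M B b v) + d b * zeta_form \<phi> b v"
    then obtain c d where cd: "\<And>b v. b \<in> points B \<Longrightarrow> CO2_orbit k b \<in> W \<Longrightarrow> v \<in> tangent_space B b \<Longrightarrow>
        \<alpha> (CO2_orbit k b) (dorbit b v) = (\<Sum>j\<le>k div 2. c j b * xi_form k j M B b v) + d b * zeta_form \<phi> b v"
      by blast
    show "form_10 Q J W \<alpha>"
      unfolding form_10_def
    proof (intro ballI)
      fix q t assume q: "q \<in> W" and t: "t \<in> tangent_space Q q"
      have "q \<in> points Q" using W q by blast
      from this t obtain b v w where *: "b \<in> points B" "q = CO2_orbit k b" "t = dorbit b v" "turn b v w"
        by (rule tangent_Q_cases)
      have in_T: "v \<in> tangent_space B b" "w \<in> tangent_space B b" using *(4) unfolding turn_def by blast+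
      have bW: "CO2_orbit k b \<in> W" using q *(2) by simp
      have "\<alpha> q (J q t) = (\<Sum>j\<le>k div 2. c j b * xi_form k j M B b w) + d b * zeta_form \<phi> b w"
        unfolding *(2,3) J_dorbit[OF *(1,4)] by (rule cd[OF *(1) bW in_T(2)])
      also have "\<dots> = (\<Sum>j\<le>k div 2. \<i> * (c j b * xi_form k j M B b v)) + \<i> * (d b * zeta_form \<phi> b v)"
        using *(4) unfolding turn_def by (auto intro!: arg_cong2[of _ _ _ _ "(+)"] sum.cong)
      also have "\<dots> = \<i> * \<alpha> q t"
        unfolding *(2,3) cd[OF *(1) bW in_T(1)] by (simp add: sum_distrib_left distrib_left)
      finally show "\<alpha> q (J q t) = \<i> * \<alpha> q t" .
    qed
  qed
qed

end

section \<open>Uniqueness\<close>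

context smooth_atlas
begin

lemma smooth_fun_coord_vec:
  assumes C: "C \<in> N" and D: "D \<in> N"
  shows "smooth_fun N (fst C \<inter> fst D) (\<lambda>p. coord_vec N C p e D)"
proof (rule smooth_funI_local)
  fix p assume p: "p \<in> fst C \<inter> fst D"
  let ?G = "snd C ` (fst C \<inter> fst D)"
  have G: "open ?G" by (rule overlap_open[OF C D])
  have "smooth_on ?G (\<lambda>y. frechet_derivative (coord_change C D) (at y) e)"
    by (rule smooth_on_frechet_derivative[OF coord_change_smooth[OF C D]])
  then have "smooth_on ?G ((\<lambda>p. coord_vec N C p e D) \<circ> chart_inv C)"
  proof (rule smooth_on_cong[OF G, rotated])
    fix y assume "y \<in> ?G"
    then obtain q where q: "q \<in> fst C" "q \<in> fst D" "y = snd C q" by blast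
    then have "chart_at N q D" using D by (simp add: chart_at_def)
    then show "frechet_derivative (coord_change C D) (at y) e = ((\<lambda>p. coord_vec N C p e D) \<circ> chart_inv C) y"
      using q C by (simp add: coord_vec_apply coord_jacobian_def)
  qed
  moreover have "chart_at N p C" using C p by (simp add: chart_at_def)
  moreover have "snd C p \<in> ?G" "?G \<subseteq> snd C ` fst C" using p by blast+
  ultimately show "\<exists>K G. chart_at N p K \<and> open G \<and> snd K p \<in> G \<and> G \<subseteq> snd K ` fst K \<and>
      smooth_on G ((\<lambda>p. coord_vec N C p e D) \<circ> chart_inv K)"
    using G by blast
qed

text \<open>For every coordinate form \<open>\<beta>\<close> the form \<open>\<beta> - \<i> \<beta> \<circ> J\<close> is of type \<open>(1,0)\<close> for \<open>J\<close>. If it is of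
  type \<open>(1,0)\<close> for \<open>J'\<close> as well, then its real part shows \<open>\<beta> \<circ> J' = \<beta> \<circ> J\<close>.\<close>

lemma almost_complex_structure_determined:
  assumes J: "almost_complex_structure N J" and J': "almost_complex_structure N J'"
    and forms: "\<And>W \<alpha>. mopen N W \<Longrightarrow> smooth_form N W \<alpha> \<Longrightarrow> form_10 N J W \<alpha> \<Longrightarrow> form_10 N J' W \<alpha>"
    and q: "q \<in> points N" and v: "v \<in> tangent_space N q"
  shows "J' q v = J q v"
proof -
  obtain D where D: "D \<in> N" "q \<in> fst D" using q unfolding points_def by blast
  have at: "chart_at N q D" using D by (simp add: chart_at_def)
  have points: "p \<in> points N" if "p \<in> fst D" for p using that D(1) unfolding points_def by blast
  have J_lin: "linear_on (tangent_space N p) (J p)"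
    and J_in: "\<And>t. t \<in> tangent_space N p \<Longrightarrow> J p t \<in> tangent_space N p"
    and J_J: "\<And>t. t \<in> tangent_space N p \<Longrightarrow> J p (J p t) = - t" if "p \<in> fst D" for p
    using J points[OF that] unfolding almost_complex_structure_def by blast+
  have J'_in: "J' q v \<in> tangent_space N q"
    using J' q v unfolding almost_complex_structure_def by blast
  have "u \<bullet> J' q v D = u \<bullet> J q v D" for u
  proof -
    define \<alpha> where "\<alpha> p t = complex_of_real (u \<bullet> t D) - \<i> * complex_of_real (u \<bullet> J p t D)" for p t
    have "form_10 N J (fst D) \<alpha>"
      unfolding form_10_def \<alpha>_def by (auto simp: J_J algebra_simps)
    moreover have "smooth_form N (fst D) \<alpha>"
      unfolding smooth_form_def
    proof (intro conjI ballI allI)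
      fix p assume p: "p \<in> fst D"
      show "linear_on (tangent_space N p) (\<alpha> p)"
        using J_lin[OF p] unfolding linear_on_def \<alpha>_def
        by (simp add: scaleR_fun_def inner_add_right scaleR_conv_of_real algebra_simps)
    next
      fix C e assume C: "C \<in> N"
      let ?f = "\<lambda>p. coord_vec N C p e D" and ?g = "\<lambda>p. J p (coord_vec N C p e) D"
      have f: "smooth_fun N (fst C \<inter> fst D) ?f" by (rule smooth_fun_coord_vec[OF C D(1)])
      have "smooth_section N (tangent_frames N) (fst C) (\<lambda>p. J p (coord_vec N C p e))"
        using J C unfolding almost_complex_structure_def by blast
      then have g: "smooth_fun N (fst C \<inter> fst D) ?g"
        using smooth_tangent_sectionD[OF _ D(1) mopen_domain[OF C]] by (simp add: Int_commute)
      have op: "open (snd A ` (fst A \<inter> (fst C \<inter> fst D)))" if "A \<in> N" for A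
        by (rule mopen_open_image[OF mopen_Int[OF mopen_domain[OF C] mopen_domain[OF D(1)]] that])
      show "smooth_fun N (fst C \<inter> fst D) (\<lambda>p. \<alpha> p (coord_vec N C p e))"
        unfolding smooth_fun_def
      proof clarify
        fix U c assume A: "(U, c) \<in> N"
        let ?S = "c ` (U \<inter> (fst C \<inter> fst D))"
        have S: "open ?S" using op[OF A] by simp
        have "smooth_on ?S (\<lambda>y. complex_of_real (u \<bullet> (?f \<circ> inv_into U c) y) - \<i> * complex_of_real (u \<bullet> (?g \<circ> inv_into U c) y))"
          using bspec[OF f[unfolded smooth_fun_def] A, unfolded case_prod_conv]
            bspec[OF g[unfolded smooth_fun_def] A, unfolded case_prod_conv]
          by (intro smooth_on_diff[OF S] smooth_on_mult[OF S] smooth_on_const[OF S]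
              smooth_on_bounded_linear[OF S bounded_linear_of_real]
              smooth_on_bounded_linear[OF S bounded_linear_inner_right])
        then show "smooth_on ?S ((\<lambda>p. \<alpha> p (coord_vec N C p e)) \<circ> inv_into U c)"
          by (simp add: \<alpha>_def comp_def)
      qed
    qed
    ultimately have "form_10 N J' (fst D) \<alpha>" using forms[OF mopen_domain[OF D(1)]] by blast
    then have "\<alpha> q (J' q v) = \<i> * \<alpha> q v" using D(2) v unfolding form_10_def by blast
    then show ?thesis by (simp add: \<alpha>_def complex_eq_iff)
  qed
  then have "J' q v D = J q v D" by (metis inner_commute vector_eq_rdot)
  then show ?thesis
    by (rule tangent_space_eqI[OF J'_in J_in[OF D(2) v] at])
qed

end

section \<open>The almost complex structure of a \<open>GL(2)\<close>-connection\<close>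

theorem theorem4p1:
  fixes k :: nat
    and M :: "('m, 'e::euclidean_space) atlas"
    and E :: "'m \<Rightarrow> 'v::real_vector set"
    and T :: "('m, real^2, 'v) frames"
    and \<Theta> :: "'m \<Rightarrow> (('v \<Rightarrow> real) \<Rightarrow> real) \<Rightarrow> ('m, 'e) tvec"
    and \<phi> :: "('m, 'e) fpoint \<Rightarrow> (('m, 'e) fpoint, 'e \<times> (real^2^2)) tvec \<Rightarrow> real^2^2"
    and B :: "(('m, 'e) fpoint, 'e \<times> (real^2^2)) atlas"
    and Q :: "(('m, 'e) fpoint set, 'e \<times> complex) atlas"
  defines "B \<equiv> frame_bundle k M E T \<Theta>"
    and "Q \<equiv> quotient_atlas B (CO2_orbit k)"
  assumes "smooth_manifold M" and "DIM('e) = k + 1" and "even (k + 1)"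
    and "gl2_structure k M E T \<Theta>"
    and "gl2_connection k B \<phi>"
  shows "smooth_manifold Q \<and> points Q = CO2_orbit k ` points B \<and>
    (\<exists>J. almost_complex_structure Q J \<and> forms_10_characterized k M B Q \<phi> J \<and>
       (\<forall>J'. almost_complex_structure Q J' \<and> forms_10_characterized k M B Q \<phi> J' \<longrightarrow>
          (\<forall>q\<in>points Q. \<forall>v\<in>tangent_space Q q. J' q v = J q v)))"
proof -
  interpret gl2_bundle_connection k M E T \<Theta> \<phi>
    by unfold_locales (use assms in auto)
  have "J' q v = J q v"
    if J': "almost_complex_structure Q J'" "forms_10_characterized k M B Q \<phi> J'"
      and q: "q \<in> points Q" "v \<in> tangent_space Q q" for J' q v
  proof (rule smooth_atlas.almost_complex_structure_determined[OF _ _ J'(1) _ q])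
    show "smooth_atlas Q" unfolding Q_def B_def by (rule smooth_atlas_Q)
    show "almost_complex_structure Q J" unfolding Q_def B_def by (rule almost_complex_structure_J)
    show "form_10 Q J' W \<alpha>" if "mopen Q W" "smooth_form Q W \<alpha>" "form_10 Q J W \<alpha>" for W \<alpha>
      using that J'(2) forms_10_characterized_J[folded B_def, folded Q_def]
      unfolding forms_10_characterized_def by blast
  qed
  then show ?thesis
    using smooth_manifold_Q[folded B_def, folded Q_def] points_Q[folded B_def, folded Q_def]
      almost_complex_structure_J[folded B_def, folded Q_def]
      forms_10_characterized_J[folded B_def, folded Q_def]
    by blast
qed

end
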